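(* Let $(X,\mathrm{d}_X)$ be a proper geodesic Gromov hyperbolic metric space, let $o\in X$, and let $\Gamma\subset\mathsf{Isom}(X)$ be a discrete group which acts co-compactly on $X$ and whose convergence action on $\partial_\infty X$ is non-elementary. Let $\sigma\colon \Gamma \times \partial_\infty X \to \mathbb{R}$ be an expanding coarse-cocycle. Then there exists a $\Gamma$-invariant coarsely additive potential $\psi\colon X \times X \rightarrow \mathbb{R}$ such that $$\sup_{\gamma \in \Gamma,\, x \in \partial_\infty X} \left|\sigma_{\psi}(\gamma,x)-\sigma(\gamma,x) \right| < + \infty,$$ where $\sigma_\psi(\gamma,x)=\limsup_{p\to x}\psi(\gamma^{-1}o,p)-\psi(o,p)$ (with $p\in X$). In particular, $\sigma$ is contained in a coarse GPS system, i.e. there are $\bar\sigma$ and $G$ such that $(\sigma,\bar\sigma,G)$ is a coarse GPS system.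
   Context: Potentials. A function $\psi\colon X\times X\to\mathbb{R}$ is a coarsely additive potential if: (1) $\lim_{r\to\infty}\inf_{\mathrm{d}_X(p,q)\ge r}\psi(p,q)=+\infty$; (2) for any $r>0$, $\sup_{\mathrm{d}_X(p,q)\le r}|\psi(p,q)|<+\infty$; (3) for every $r>0$ there is $\kappa=\kappa(r)>0$ such that if $u$ is contained in the $r$-neighborhood of a geodesic in $(X,\mathrm{d}_X)$ joining $p$ to $q$, then $|\psi(p,q)-(\psi(p,u)+\psi(u,q))|\le\kappa$. $\Gamma$-invariant means $\psi(\gamma p,\gamma q)=\psi(p,q)$ for all $\gamma\in\Gamma$. The group $\Gamma$ acts on the Gromov boundary $M:=\partial_\infty X$ as a convergence group; $M^{(2)}$ denotes the set of ordered pairs of distinct points. Convergence groups. For $M$ compact metrizable, $\Gamma$ acts by homeomorphisms of $M$ as a (discrete) convergence group if for every sequence $\{\gamma_n\}$ of distinct elements there are $x,y\in M$ and a subsequence $\{\gamma_{n_j}\}$ such that $\gamma_{n_j}|_{M\smallsetminus\{y\}}$ converges locally uniformly to the constant $x$. The limit set $\Lambda(\Gamma)$ is the set of $x\in M$ for which there are $y\in M$ and $\{\gamma_n\}\subset\Gamma$ with $\gamma_n|_{M\smallsetminus\{y\}}\to x$ locally uniformly; the action is non-elementary if $\#\Lambda(\Gamma)\ge3$. $\gamma$ is loxodromic if it has two fixed points $\gamma^+\ne\gamma^-$ in $\Lambda(\Gamma)$ with $\gamma^{\pm n}|_{M\smallsetminus\{\gamma^{\mp}\}}\to\gamma^{\pm}$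 locally uniformly. $\Gamma\sqcup M$ carries a unique compact metrizable topology for which the inclusions of $\Gamma$ (discrete) and $M$ are embeddings and the natural $\Gamma$ action is a convergence action; a compatible metric $\mathrm{d}$ is a metric inducing it; fix one. Coarse-cocycles. $\sigma\colon\Gamma\times M\to\mathbb{R}$ is a $\kappa$-coarse-cocycle if (i) $\limsup_{x\to x_0}|\sigma(\gamma,x_0)-\sigma(\gamma,x)|\le\kappa$ for all $\gamma$, $x_0$, and (ii) $|\sigma(\gamma_1\gamma_2,x)-(\sigma(\gamma_1,\gamma_2x)+\sigma(\gamma_2,x))|\le\kappa$ for all $\gamma_1,\gamma_2,x$; a coarse-cocycle is a $\kappa$-coarse-cocycle for some $\kappa\ge0$. It is proper if $\sigma(\gamma_n,\gamma_n^+)\to+\infty$ whenever $\{\gamma_n\}$ is a sequence of distinct loxodromic elements with $\liminf_n\mathrm{d}(\gamma_n^-,\gamma_n^+)>0$. It is expanding if it is proper and for each $\gamma\in\Gamma$ there is $\|\gamma\|_\sigma\in\mathbb{R}$ such that for every $\epsilon>0$ there is $C>0$ with $\|\gamma\|_\sigma-C\le\sigma(\gamma,x)\le\|\gamma\|_\sigma+C$ whenever $x\in M$, $\gamma\in\Gamma$, $\mathrm{d}(x,\gamma^{-1})>\epsilon$ (with $\gamma^{-1}\in\Gamma\sqcup M$). GPS systems. $(\sigma,\bar\sigma,G)$ is a coarse GPS system if for some $\kappa\ge0$: $\sigma,\bar\sigma$ are proper $\kappa$-coarse-cocycles, $G\colon M^{(2)}\to\mathbb{R}$ is locally bounded, and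 $|(\bar\sigma(\gamma,x)+\sigma(\gamma,y))-(G(\gamma x,\gamma y)-G(x,y))|\le\kappa$ for all $\gamma\in\Gamma$ and distinct $x,y\in M$. *)

theory Defs
  imports "HOL-Analysis.Analysis" "HOL-Algebra.Group_Action"
begin

section \<open>Convergence groups\<close>

text \<open>
  The acting group is a HOL-Algebra group \<open>G\<close>, and the space acted upon is the carrier
  \<open>topspace T\<close> of a topology \<open>T\<close>. The values of \<open>act g\<close>, of cocycles, and of
  functions on pairs of points outside these carriers are irrelevant.
\<close>

text \<open>
  Locally uniform convergence of \<open>f n\<close> on \<open>S\<close> to the constant \<open>x\<close>. For a constant limit,
  uniform convergence on \<open>V\<close> means that every neighbourhood of \<open>x\<close> eventually contains
  \<open>f n ` V\<close>; for a compact metrizable \<open>T\<close> this agrees with uniform convergence for any metric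
  inducing \<open>T\<close>.
\<close>

definition loc_unif_to_const ::
    "'m topology \<Rightarrow> (nat \<Rightarrow> 'm \<Rightarrow> 'm) \<Rightarrow> 'm set \<Rightarrow> 'm \<Rightarrow> bool" where
  "loc_unif_to_const T f S x \<longleftrightarrow>
     (\<forall>z\<in>S. \<exists>V. openin (subtopology T S) V \<and> z \<in> V \<and>
        (\<forall>U. openin T U \<and> x \<in> U \<longrightarrow> (\<forall>\<^sub>F n in sequentially. f n ` V \<subseteq> U)))"

definition convergence_action ::
    "('g, 'z) monoid_scheme \<Rightarrow> 'm topology \<Rightarrow> ('g \<Rightarrow> 'm \<Rightarrow> 'm) \<Rightarrow> bool" where
  "convergence_action G T act \<longleftrightarrow>
     compact_space T \<and> metrizable_space T \<and>
     group_action G (topspace T) (\<lambda>g. restrict (act g) (topspace T)) \<and>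
     (\<forall>g\<in>carrier G. homeomorphic_map T T (act g)) \<and>
     (\<forall>\<gamma>::nat \<Rightarrow> 'g. range \<gamma> \<subseteq> carrier G \<and> inj \<gamma> \<longrightarrow>
        (\<exists>x\<in>topspace T. \<exists>y\<in>topspace T. \<exists>\<phi>::nat \<Rightarrow> nat. strict_mono \<phi> \<and>
           loc_unif_to_const T (\<lambda>j. act (\<gamma> (\<phi> j))) (topspace T - {y}) x))"

definition limit_set ::
    "('g, 'z) monoid_scheme \<Rightarrow> 'm topology \<Rightarrow> ('g \<Rightarrow> 'm \<Rightarrow> 'm) \<Rightarrow> 'm set" where
  "limit_set G T act =
     {x \<in> topspace T. \<exists>y\<in>topspace T. \<exists>\<gamma>::nat \<Rightarrow> 'g. range \<gamma> \<subseteq> carrier G \<and>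
        loc_unif_to_const T (\<lambda>n. act (\<gamma> n)) (topspace T - {y}) x}"

definition non_elementary ::
    "('g, 'z) monoid_scheme \<Rightarrow> 'm topology \<Rightarrow> ('g \<Rightarrow> 'm \<Rightarrow> 'm) \<Rightarrow> bool" where
  "non_elementary G T act \<longleftrightarrow> infinite (limit_set G T act) \<or> card (limit_set G T act) \<ge> 3"

text \<open>\<open>g\<close> is loxodromic with attracting point \<open>a\<close> and repelling point \<open>r\<close>.\<close>

definition loxodromic ::
    "('g, 'z) monoid_scheme \<Rightarrow> 'm topology \<Rightarrow> ('g \<Rightarrow> 'm \<Rightarrow> 'm) \<Rightarrow> 'g \<Rightarrow> 'm \<Rightarrow> 'm \<Rightarrow> bool" where
  "loxodromic G T act g a r \<longleftrightarrow>
     g \<in> carrier G \<and> a \<in> limit_set G T act \<and> r \<in> limit_set G T act \<and> a \<noteq> r \<and>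
     act g a = a \<and> act g r = r \<and>
     loc_unif_to_const T (\<lambda>n. act (g [^]\<^bsub>G\<^esub> n)) (topspace T - {r}) a \<and>
     loc_unif_to_const T (\<lambda>n. act ((inv\<^bsub>G\<^esub> g) [^]\<^bsub>G\<^esub> n)) (topspace T - {a}) r"

text \<open>
  Metrics on the disjoint union of the group and the space which induce the compact metrizable
  topology extending the convergence action.
\<close>

definition compatible_metric ::
    "('g, 'z) monoid_scheme \<Rightarrow> 'm topology \<Rightarrow> ('g \<Rightarrow> 'm \<Rightarrow> 'm) \<Rightarrow> ('g + 'm \<Rightarrow> 'g + 'm \<Rightarrow> real) \<Rightarrow> bool" where
  "compatible_metric G T act d \<longleftrightarrow>
     Metric_space (carrier G <+> topspace T) d \<and>
     (let T' = Metric_space.mtopology (carrier G <+> topspace T) d in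
        embedding_map (discrete_topology (carrier G)) T' Inl \<and>
        embedding_map T T' Inr \<and>
        convergence_action G T' (\<lambda>g. map_sum (\<lambda>h. g \<otimes>\<^bsub>G\<^esub> h) (act g)))"


section \<open>Coarse-cocycles and GPS systems\<close>

definition coarse_cocycle_with ::
    "real \<Rightarrow> ('g, 'z) monoid_scheme \<Rightarrow> 'm topology \<Rightarrow> ('g \<Rightarrow> 'm \<Rightarrow> 'm) \<Rightarrow> ('g \<Rightarrow> 'm \<Rightarrow> real) \<Rightarrow> bool" where
  "coarse_cocycle_with \<kappa> G T act \<sigma> \<longleftrightarrow>
     (\<forall>g\<in>carrier G. \<forall>x\<^sub>0\<in>topspace T.
        Limsup (nhdsin T x\<^sub>0) (\<lambda>x. ereal \<bar>\<sigma> g x\<^sub>0 - \<sigma> g x\<bar>) \<le> ereal \<kappa>) \<and>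
     (\<forall>g\<in>carrier G. \<forall>h\<in>carrier G. \<forall>x\<in>topspace T.
        \<bar>\<sigma> (g \<otimes>\<^bsub>G\<^esub> h) x - (\<sigma> g (act h x) + \<sigma> h x)\<bar> \<le> \<kappa>)"

definition coarse_cocycle ::
    "('g, 'z) monoid_scheme \<Rightarrow> 'm topology \<Rightarrow> ('g \<Rightarrow> 'm \<Rightarrow> 'm) \<Rightarrow> ('g \<Rightarrow> 'm \<Rightarrow> real) \<Rightarrow> bool" where
  "coarse_cocycle G T act \<sigma> \<longleftrightarrow> (\<exists>\<kappa>\<ge>0. coarse_cocycle_with \<kappa> G T act \<sigma>)"

definition proper_cocycle ::
    "('g, 'z) monoid_scheme \<Rightarrow> 'm topology \<Rightarrow> ('g \<Rightarrow> 'm \<Rightarrow> 'm) \<Rightarrow> ('g + 'm \<Rightarrow> 'g + 'm \<Rightarrow> real) \<Rightarrow>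
     ('g \<Rightarrow> 'm \<Rightarrow> real) \<Rightarrow> bool" where
  "proper_cocycle G T act d \<sigma> \<longleftrightarrow>
     (\<forall>(\<gamma>::nat \<Rightarrow> 'g) a r.
        inj \<gamma> \<and> (\<forall>n. loxodromic G T act (\<gamma> n) (a n) (r n)) \<and>
        liminf (\<lambda>n. ereal (d (Inr (r n)) (Inr (a n)))) > 0 \<longrightarrow>
        filterlim (\<lambda>n. \<sigma> (\<gamma> n) (a n)) at_top sequentially)"

definition expanding_cocycle ::
    "('g, 'z) monoid_scheme \<Rightarrow> 'm topology \<Rightarrow> ('g \<Rightarrow> 'm \<Rightarrow> 'm) \<Rightarrow> ('g + 'm \<Rightarrow> 'g + 'm \<Rightarrow> real) \<Rightarrow>
     ('g \<Rightarrow> 'm \<Rightarrow> real) \<Rightarrow> bool" where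
  "expanding_cocycle G T act d \<sigma> \<longleftrightarrow>
     coarse_cocycle G T act \<sigma> \<and> proper_cocycle G T act d \<sigma> \<and>
     (\<exists>N::'g \<Rightarrow> real. \<forall>\<epsilon>>0. \<exists>C>0. \<forall>x\<in>topspace T. \<forall>g\<in>carrier G.
        d (Inr x) (Inl (inv\<^bsub>G\<^esub> g)) > \<epsilon> \<longrightarrow> N g - C \<le> \<sigma> g x \<and> \<sigma> g x \<le> N g + C)"

definition distinct_pairs :: "'m topology \<Rightarrow> ('m \<times> 'm) set" where
  "distinct_pairs T = {(x, y) \<in> topspace T \<times> topspace T. x \<noteq> y}"

definition locally_bounded_on_pairs :: "'m topology \<Rightarrow> ('m \<Rightarrow> 'm \<Rightarrow> real) \<Rightarrow> bool" where
  "locally_bounded_on_pairs T Gr \<longleftrightarrow>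
     (\<forall>p\<in>distinct_pairs T. \<exists>U. openin (subtopology (prod_topology T T) (distinct_pairs T)) U \<and>
        p \<in> U \<and> (\<exists>B. \<forall>(x, y)\<in>U. \<bar>Gr x y\<bar> \<le> B))"

definition coarse_GPS ::
    "('g, 'z) monoid_scheme \<Rightarrow> 'm topology \<Rightarrow> ('g \<Rightarrow> 'm \<Rightarrow> 'm) \<Rightarrow> ('g + 'm \<Rightarrow> 'g + 'm \<Rightarrow> real) \<Rightarrow>
     ('g \<Rightarrow> 'm \<Rightarrow> real) \<Rightarrow> ('g \<Rightarrow> 'm \<Rightarrow> real) \<Rightarrow> ('m \<Rightarrow> 'm \<Rightarrow> real) \<Rightarrow> bool" where
  "coarse_GPS G T act d \<sigma> \<sigma>' Gr \<longleftrightarrow>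
     (\<exists>\<kappa>\<ge>0.
        coarse_cocycle_with \<kappa> G T act \<sigma> \<and> proper_cocycle G T act d \<sigma> \<and>
        coarse_cocycle_with \<kappa> G T act \<sigma>' \<and> proper_cocycle G T act d \<sigma>' \<and>
        locally_bounded_on_pairs T Gr \<and>
        (\<forall>g\<in>carrier G. \<forall>x\<in>topspace T. \<forall>y\<in>topspace T. x \<noteq> y \<longrightarrow>
           \<bar>(\<sigma>' g x + \<sigma> g y) - (Gr (act g x) (act g y) - Gr x y)\<bar> \<le> \<kappa>))"


section \<open>Hyperbolic metric spaces\<close>

text \<open>\<open>c\<close> is a geodesic parametrized by arc length on \<open>{0..dist p q}\<close>.\<close>

definition geodesic_joining :: "(real \<Rightarrow> 'a::metric_space) \<Rightarrow> 'a \<Rightarrow> 'a \<Rightarrow> bool" where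
  "geodesic_joining c p q \<longleftrightarrow>
     c 0 = p \<and> c (dist p q) = q \<and>
     (\<forall>s\<in>{0..dist p q}. \<forall>t\<in>{0..dist p q}. dist (c s) (c t) = \<bar>s - t\<bar>)"

definition proper_metric_space :: "'a::metric_space itself \<Rightarrow> bool" where
  "proper_metric_space TYPE('a) \<longleftrightarrow> (\<forall>(x::'a) r. compact (cball x r))"

definition geodesic_metric_space :: "'a::metric_space itself \<Rightarrow> bool" where
  "geodesic_metric_space TYPE('a) \<longleftrightarrow> (\<forall>p q::'a. \<exists>c. geodesic_joining c p q)"

definition gromov_product :: "'a::metric_space \<Rightarrow> 'a \<Rightarrow> 'a \<Rightarrow> real" where
  "gromov_product b p q = (dist p b + dist q b - dist p q) / 2"

definition gromov_hyperbolic :: "'a::metric_space itself \<Rightarrow> bool" where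
  "gromov_hyperbolic TYPE('a) \<longleftrightarrow>
     (\<exists>\<delta>\<ge>0. \<forall>b x y z::'a.
        gromov_product b x z \<ge> min (gromov_product b x y) (gromov_product b y z) - \<delta>)"


subsection \<open>The Gromov boundary and the topology on the bordification\<close>

text \<open>
  Boundary points are equivalence classes of sequences converging to infinity. The base point
  \<open>b\<close> is a parameter of the definitions, but neither the set of boundary points nor the
  topologies depend on it.
\<close>

definition seqs_at_infinity :: "'a::metric_space \<Rightarrow> (nat \<Rightarrow> 'a) set" where
  "seqs_at_infinity b =
     {s. filterlim (\<lambda>(m, n). gromov_product b (s m) (s n)) at_top (sequentially \<times>\<^sub>F sequentially)}"

definition seqs_equiv :: "'a::metric_space \<Rightarrow> ((nat \<Rightarrow> 'a) \<times> (nat \<Rightarrow> 'a)) set" where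
  "seqs_equiv b =
     {(s, t). s \<in> seqs_at_infinity b \<and> t \<in> seqs_at_infinity b \<and>
        filterlim (\<lambda>(m, n). gromov_product b (s m) (t n)) at_top (sequentially \<times>\<^sub>F sequentially)}"

type_synonym 'a bdry_point = "(nat \<Rightarrow> 'a) set"

definition gromov_boundary :: "'a::metric_space \<Rightarrow> 'a bdry_point set" where
  "gromov_boundary b = seqs_at_infinity b // seqs_equiv b"

text \<open>The Gromov product on the bordification: \<open>sup liminf (s m | t n)\<close> over representatives.\<close>

fun bordification_reps :: "'a + 'a bdry_point \<Rightarrow> (nat \<Rightarrow> 'a) set" where
  "bordification_reps (Inl p) = {\<lambda>_. p}"
| "bordification_reps (Inr \<xi>) = \<xi>"

definition extended_gromov_product ::
    "'a::metric_space \<Rightarrow> 'a + 'a bdry_point \<Rightarrow> 'a + 'a bdry_point \<Rightarrow> ereal" where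
  "extended_gromov_product b u v =
     (SUP (s, t)\<in>bordification_reps u \<times> bordification_reps v.
        Liminf (sequentially \<times>\<^sub>F sequentially) (\<lambda>(m, n). ereal (gromov_product b (s m) (t n))))"

text \<open>
  A set is open if its trace on \<open>X\<close> is open and, with each boundary point \<open>\<xi>\<close>, it contains one of
  the basic neighbourhoods \<open>{u. (\<xi> | u) > r}\<close>.
\<close>

definition bordification_open :: "'a::metric_space \<Rightarrow> ('a + 'a bdry_point) set \<Rightarrow> bool" where
  "bordification_open b U \<longleftrightarrow>
     U \<subseteq> UNIV <+> gromov_boundary b \<and> open (Inl -` U) \<and>
     (\<forall>\<xi>\<in>gromov_boundary b. Inr \<xi> \<in> U \<longrightarrow>
        (\<exists>r::real. {u \<in> UNIV <+> gromov_boundary b.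
                      extended_gromov_product b (Inr \<xi>) u > ereal r} \<subseteq> U))"

definition bordification :: "'a::metric_space \<Rightarrow> ('a + 'a bdry_point) topology" where
  "bordification b = topology (bordification_open b)"

lemma istopology_bordification: "istopology (bordification_open b)"
  unfolding istopology_def
proof (intro conjI allI impI)
  define N where "N \<xi> r = {u \<in> UNIV <+> gromov_boundary b.
      extended_gromov_product b (Inr \<xi>) u > ereal r}" for \<xi> and r :: real
  have N_mono: "N \<xi> r \<subseteq> N \<xi> r'" if "r' \<le> r" for \<xi> r r'
    using that unfolding N_def by (auto intro: le_less_trans[of "ereal r'" "ereal r"])
  have open_iff: "bordification_open b U \<longleftrightarrow>
      U \<subseteq> UNIV <+> gromov_boundary b \<and> open (Inl -` U) \<and>
      (\<forall>\<xi>\<in>gromov_boundary b. Inr \<xi> \<in> U \<longrightarrow> (\<exists>r. N \<xi> r \<subseteq> U))" for U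
    unfolding bordification_open_def N_def ..
  {
    fix S T assume S: "bordification_open b S" and T: "bordification_open b T"
    have "\<exists>r. N \<xi> r \<subseteq> S \<inter> T" if xi: "\<xi> \<in> gromov_boundary b" "Inr \<xi> \<in> S \<inter> T" for \<xi>
    proof -
      obtain r1 r2 where "N \<xi> r1 \<subseteq> S" "N \<xi> r2 \<subseteq> T"
        using S T xi unfolding open_iff by (meson IntD1 IntD2)
      then have "N \<xi> (max r1 r2) \<subseteq> S \<inter> T"
        using N_mono[OF max.cobounded1[of r1 r2], of \<xi>] N_mono[OF max.cobounded2[of r2 r1], of \<xi>]
        by blast
      then show ?thesis ..
    qed
    moreover have "open (Inl -` (S \<inter> T))"
      using S T unfolding open_iff vimage_Int by (meson open_Int)
    moreover have "S \<inter> T \<subseteq> UNIV <+> gromov_boundary b"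
      using S unfolding open_iff by (meson inf.coboundedI1)
    ultimately show "bordification_open b (S \<inter> T)"
      unfolding open_iff by simp
  }
  fix K assume K: "\<forall>S\<in>K. bordification_open b S"
  have "open (Inl -` \<Union>K)"
    unfolding vimage_Union by (rule open_UN) (use K open_iff in simp)
  moreover have "\<exists>r. N \<xi> r \<subseteq> \<Union>K" if xi: "\<xi> \<in> gromov_boundary b" "Inr \<xi> \<in> \<Union>K" for \<xi>
  proof -
    obtain S where S: "S \<in> K" "Inr \<xi> \<in> S" using xi by (meson UnionE)
    then obtain r where "N \<xi> r \<subseteq> S"
      using K xi(1) unfolding open_iff by meson
    then show ?thesis using S(1) by (meson Sup_upper subset_trans)
  qed
  moreover have "\<Union>K \<subseteq> UNIV <+> gromov_boundary b"
    by (rule Union_least) (use K open_iff in simp)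
  ultimately show "bordification_open b (\<Union>K)"
    unfolding open_iff by simp
qed

lemma openin_bordification: "openin (bordification b) = bordification_open b"
  unfolding bordification_def by (rule topology_inverse'[OF istopology_bordification])

definition gromov_boundary_topology :: "'a::metric_space \<Rightarrow> 'a bdry_point topology" where
  "gromov_boundary_topology b = pullback_topology (gromov_boundary b) Inr (bordification b)"


subsection \<open>Groups of isometries\<close>

definition isometry_group :: "('a::metric_space \<Rightarrow> 'a) monoid" where
  "isometry_group =
     \<lparr>carrier = {f. bij f \<and> (\<forall>x y. dist (f x) (f y) = dist x y)},
      monoid.mult = (\<circ>), one = id\<rparr>"

definition compact_open_topology :: "('a::topological_space \<Rightarrow> 'b::topological_space) topology" where
  "compact_open_topology = topology_generated_by {{f. f ` K \<subseteq> U} | K U. compact K \<and> open U}"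

definition discrete_isometry_group :: "('a::metric_space \<Rightarrow> 'a) set \<Rightarrow> bool" where
  "discrete_isometry_group \<Gamma> \<longleftrightarrow>
     subgroup \<Gamma> isometry_group \<and> subtopology compact_open_topology \<Gamma> = discrete_topology \<Gamma>"

definition cocompact :: "('a::topological_space \<Rightarrow> 'a) set \<Rightarrow> bool" where
  "cocompact \<Gamma> \<longleftrightarrow> (\<exists>K. compact K \<and> (\<Union>\<gamma>\<in>\<Gamma>. \<gamma> ` K) = UNIV)"

abbreviation isometry_subgroup :: "('a::metric_space \<Rightarrow> 'a) set \<Rightarrow> ('a \<Rightarrow> 'a) monoid" where
  "isometry_subgroup \<Gamma> \<equiv> isometry_group\<lparr>carrier := \<Gamma>\<rparr>"

definition boundary_action :: "('a \<Rightarrow> 'a) \<Rightarrow> 'a bdry_point \<Rightarrow> 'a bdry_point" where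
  "boundary_action \<gamma> \<xi> = (\<lambda>s. \<gamma> \<circ> s) ` \<xi>"


section \<open>Coarsely additive potentials\<close>

definition coarsely_additive_potential :: "('a::metric_space \<Rightarrow> 'a \<Rightarrow> real) \<Rightarrow> bool" where
  "coarsely_additive_potential \<psi> \<longleftrightarrow>
     ((\<lambda>r::real. INF (p, q)\<in>{(p, q). dist p q \<ge> r}. ereal (\<psi> p q)) \<longlongrightarrow> \<infinity>) at_top \<and>
     (\<forall>r>0. (SUP (p, q)\<in>{(p, q). dist p q \<le> r}. ereal \<bar>\<psi> p q\<bar>) < \<infinity>) \<and>
     (\<forall>r>0. \<exists>\<kappa>>0. \<forall>p q u c.
        geodesic_joining c p q \<and> (\<exists>t\<in>{0..dist p q}. dist u (c t) < r) \<longrightarrow>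
        \<bar>\<psi> p q - (\<psi> p u + \<psi> u q)\<bar> \<le> \<kappa>)"

definition invariant_potential :: "('a \<Rightarrow> 'a) set \<Rightarrow> ('a \<Rightarrow> 'a \<Rightarrow> real) \<Rightarrow> bool" where
  "invariant_potential \<Gamma> \<psi> \<longleftrightarrow> (\<forall>\<gamma>\<in>\<Gamma>. \<forall>p q. \<psi> (\<gamma> p) (\<gamma> q) = \<psi> p q)"

text \<open>
  The filter is that of points \<open>p\<close> of \<open>X\<close> tending to \<open>\<xi>\<close> in the bordification. The limsup is taken
  in the extended reals, where it always exists.
\<close>

definition potential_cocycle ::
    "'a::metric_space \<Rightarrow> ('a \<Rightarrow> 'a \<Rightarrow> real) \<Rightarrow> ('a \<Rightarrow> 'a) \<Rightarrow> 'a bdry_point \<Rightarrow> ereal" where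
  "potential_cocycle b \<psi> \<gamma> \<xi> =
     Limsup (filtercomap Inl (nhdsin (bordification b) (Inr \<xi>)))
       (\<lambda>p. ereal (\<psi> (inv_into UNIV \<gamma> b) p - \<psi> b p))"

end

theory Submission
  imports Defs
begin

text \<open>
  The points of the orbit \<open>\<Gamma> b\<close> approximate all of \<open>X\<close>, so a potential is determined up to bounded
  error by its values \<open>\<psi> (\<alpha> b) (\<beta> b) = N (\<alpha>\<inverse> \<beta>)\<close>, where \<open>N\<close> is the magnitude of the expanding
  cocycle. Since the boundary has three points, some \<open>y\<close> lies far from both \<open>h\<inverse>\<close> and
  \<open>(g h)\<inverse>\<close>, and the cocycle relation at \<open>y\<close> compares \<open>N (g h)\<close> with \<open>\<sigma> g (h y) + N h\<close>. If
  \<open>g\<inverse> b\<close> and \<open>h b\<close> have bounded Gromov product, then \<open>h y\<close>, being close to \<open>h\<close>, is far from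
  \<open>g\<inverse>\<close>, and so \<open>N (g h)\<close> is close to \<open>N g + N h\<close>: this is coarse additivity. If instead \<open>h\<close> tends to \<open>x\<close>,
  then \<open>h y\<close> tends to \<open>x\<close> and \<open>N (g h) - N h\<close> is close to \<open>\<sigma> g x\<close>. That \<open>N\<close> tends to infinity
  follows from properness of \<open>\<sigma>\<close>, because a diverging sequence with distinct attracting and repelling
  limits is eventually loxodromic; the limits can be made distinct since \<open>\<Gamma>\<close> fixes no boundary point.
  The dual cocycle and the function \<open>Gr\<close> are coarse limits of \<open>\<psi> p (\<gamma>\<inverse> b) - \<psi> p b\<close> and of
  \<open>\<psi> p b + \<psi> b q - \<psi> p q\<close>.
\<close>

section \<open>The Gromov product on the bordification\<close>

text \<open>Two measures of closeness must be reconciled. Expansion of \<sigma> is stated with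
  \<open>d\<close> between boundary points and group elements, whereas coarse additivity and the
  limits towards the boundary are governed by Gromov products in X. The metric \<open>d\<close> is
  tied to X only through the topology of the boundary and the action, so the dictionary has to come
  from the convergence property: \<open>conv_near\<close>, \<open>near_orbit_imp_d\<close> and
  \<open>close_group_imp_near\<close> supply it, the last two by extracting a convergent sequence
  from supposed counterexamples. A second constraint is uniformity. How close a point must be to the
  boundary may depend on \<gamma> and on the boundary points, but the error may not, so the
  thresholds are quantified after the error constants. For the same reason additivity of the
  potential is proved from a bound on (p|q)_u instead of a geodesic through u: with the bound
  2\<delta> it applies wherever geodesics towards a boundary point have merged, with one constant
  for all of them.\<close>

lemma gromov_product_commute: "gromov_product b p q = gromov_product b q p"
  by (simp add: gromov_product_def dist_commute)

lemma gromov_product_le_dist: "gromov_product b p q \<le> dist b q"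
  using dist_triangle[of p b q] by (simp add: gromov_product_def dist_commute)

lemma gromov_product_lipschitz: "gromov_product b p q \<le> gromov_product b p q' + dist q q'"
  using dist_triangle[of q b q'] dist_triangle[of p q' q]
  by (simp add: gromov_product_def dist_commute field_simps)

lemma gromov_product_lipschitz_base: "gromov_product b p q \<le> gromov_product c p q + dist b c"
  using dist_triangle[of p b c] dist_triangle[of q b c]
  by (simp add: gromov_product_def dist_commute field_simps)

text \<open>The product (u|v)_p is roughly the distance from \<open>p\<close> to a geodesic from
  \<open>u\<close> to \<open>v\<close>. As (u|p)_b is at most \<open>dist b p\<close>, the identity
  gives (v|p)_b >= (u|v)_b - (u|v)_p: a point near that geodesic is, seen from \<open>b\<close>,
  almost as close to \<open>v\<close> as \<open>u\<close> is.\<close>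

lemma gromov_product_add:
  "gromov_product b u p + gromov_product b v p = dist b p - gromov_product p u v + gromov_product b u v"
  by (simp add: gromov_product_def dist_commute field_simps)

text \<open>In a tree the two products are the lengths into which the projection of \<open>q\<close>
  cuts the segment from \<open>b\<close> to \<open>p\<close>. A lower bound on one is therefore an
  upper bound on the other.\<close>

lemma gromov_product_basepoint_add: "gromov_product b p q + gromov_product p b q = dist b p"
  by (simp add: gromov_product_def dist_commute field_simps)

definition isometry :: "('a::metric_space \<Rightarrow> 'a) \<Rightarrow> bool" where
  "isometry f \<longleftrightarrow> bij f \<and> (\<forall>x y. dist (f x) (f y) = dist x y)"

lemma isometry_gromov_product:
  "isometry f \<Longrightarrow> gromov_product (f b) (f p) (f q) = gromov_product b p q"
  by (simp add: isometry_def gromov_product_def)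

text \<open>
  Requiring the bound for all representatives, rather than taking the supremum over them as in
  \<open>extended_gromov_product\<close>, changes the threshold by at most \<open>2 * \<delta>\<close> and makes it compose.
\<close>

definition near :: "'a::metric_space \<Rightarrow> real \<Rightarrow> 'a + 'a bdry_point \<Rightarrow> 'a + 'a bdry_point \<Rightarrow> bool" where
  "near b r u v \<longleftrightarrow> (\<forall>s\<in>bordification_reps u. \<forall>t\<in>bordification_reps v.
     \<exists>N. \<forall>m\<ge>N. \<forall>n\<ge>N. r < gromov_product b (s m) (t n))"

lemma nearD:
  "near b r u v \<Longrightarrow> s \<in> bordification_reps u \<Longrightarrow> t \<in> bordification_reps v \<Longrightarrow>
    \<exists>N. \<forall>m\<ge>N. \<forall>n\<ge>N. r < gromov_product b (s m) (t n)"
  by (simp add: near_def)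

lemma near_Inl_Inl [simp]: "near b r (Inl p) (Inl q) \<longleftrightarrow> r < gromov_product b p q"
  by (auto simp: near_def)

lemma near_sym: "near b r u v \<Longrightarrow> near b r v u"
  unfolding near_def by (subst gromov_product_commute) blast

lemma near_mono: "near b r u v \<Longrightarrow> r' \<le> r \<Longrightarrow> near b r' u v"
  unfolding near_def by (meson le_less_trans)

lemma near_lipschitz:
  assumes "near b r u (Inl p)"
  shows "near b (r - dist p q) u (Inl q)"
  unfolding near_def
proof (intro ballI)
  fix s t assume s: "s \<in> bordification_reps u" and t: "t \<in> bordification_reps (Inl q)"
  then obtain N where N: "\<And>m. m \<ge> N \<Longrightarrow> r < gromov_product b (s m) p"
    using nearD[OF assms s, of "\<lambda>_. p"] by auto
  have "r - dist p q < gromov_product b (s m) q" if "m \<ge> N" for m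
    using N[OF that] gromov_product_lipschitz[of b "s m" p q] by linarith
  then show "\<exists>N. \<forall>m\<ge>N. \<forall>n\<ge>N. r - dist p q < gromov_product b (s m) (t n)"
    using t by auto
qed

lemma near_dist_bound:
  assumes "near b r u (Inl p)" "bordification_reps u \<noteq> {}"
  shows "r < dist b p"
proof -
  obtain s where s: "s \<in> bordification_reps u" using assms(2) by blast
  obtain N where "\<And>m. m \<ge> N \<Longrightarrow> r < gromov_product b (s m) p"
    using nearD[OF assms(1) s, of "\<lambda>_. p"] by auto
  then show ?thesis
    using gromov_product_le_dist[of b "s N" p] by fastforce
qed

lemma bordification_reps_map:
  "bordification_reps (map_sum \<gamma> (boundary_action \<gamma>) u) = (\<lambda>s. \<gamma> \<circ> s) ` bordification_reps u"
  by (cases u) (auto simp: boundary_action_def)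

lemma near_isometry:
  assumes "isometry \<gamma>" "near b r u v"
  shows "near b (r - dist b (\<gamma> b)) (map_sum \<gamma> (boundary_action \<gamma>) u) (map_sum \<gamma> (boundary_action \<gamma>) v)"
  unfolding near_def bordification_reps_map
proof clarify
  fix s t assume s: "s \<in> bordification_reps u" and t: "t \<in> bordification_reps v"
  then obtain N where N: "\<And>m n. m \<ge> N \<Longrightarrow> n \<ge> N \<Longrightarrow> r < gromov_product b (s m) (t n)"
    using nearD[OF assms(2) s t] by blast
  have "r - dist b (\<gamma> b) < gromov_product b (\<gamma> (s m)) (\<gamma> (t n))" if "m \<ge> N" "n \<ge> N" for m n
    using N[OF that] gromov_product_lipschitz_base[of "\<gamma> b" "\<gamma> (s m)" "\<gamma> (t n)" b]
    by (simp add: isometry_gromov_product[OF assms(1)] dist_commute)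
  then show "\<exists>N. \<forall>m\<ge>N. \<forall>n\<ge>N. r - dist b (\<gamma> b) < gromov_product b ((\<gamma> \<circ> s) m) ((\<gamma> \<circ> t) n)"
    by auto
qed

lemma filterlim_prod_sequentially:
  fixes f :: "nat \<Rightarrow> nat \<Rightarrow> real"
  shows "filterlim (\<lambda>(m, n). f m n) at_top (sequentially \<times>\<^sub>F sequentially) \<longleftrightarrow>
     (\<forall>r. \<exists>N. \<forall>m\<ge>N. \<forall>n\<ge>N. r < f m n)"
proof -
  have "(\<exists>N. \<forall>m\<ge>N. \<forall>n\<ge>N. r < f n m) \<longleftrightarrow> (\<exists>N. \<forall>m\<ge>N. \<forall>n\<ge>N. r < f m n)" for r
    by blast
  then show ?thesis
    by (simp add: filterlim_at_top_dense eventually_prod_sequentially)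
qed

lemma seqs_at_infinity_iff:
  "s \<in> seqs_at_infinity b \<longleftrightarrow> (\<forall>r. \<exists>N. \<forall>m\<ge>N. \<forall>n\<ge>N. r < gromov_product b (s m) (s n))"
  unfolding seqs_at_infinity_def by (simp add: filterlim_prod_sequentially)

lemma seqs_equiv_iff:
  "(s, t) \<in> seqs_equiv b \<longleftrightarrow> s \<in> seqs_at_infinity b \<and> t \<in> seqs_at_infinity b \<and>
     (\<forall>r. \<exists>N. \<forall>m\<ge>N. \<forall>n\<ge>N. r < gromov_product b (s m) (t n))"
  unfolding seqs_equiv_def by (simp add: filterlim_prod_sequentially)

section \<open>Hyperbolicity, representatives of boundary points, and neighbourhoods in the
  bordification\<close>

locale gromov_hyperbolic_space =
  fixes b :: "'a::metric_space" and \<delta> :: real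
  assumes delta_nonneg: "0 \<le> \<delta>"
    and hyperbolic: "min (gromov_product (c::'a) x y) (gromov_product c y z) - \<delta> \<le> gromov_product c x z"
begin

abbreviation "M \<equiv> gromov_boundary b"
abbreviation "reps \<equiv> bordification_reps :: 'a + 'a bdry_point \<Rightarrow> (nat \<Rightarrow> 'a) set"

lemma hyperbolicD:
  "r < gromov_product (c::'a) x y \<Longrightarrow> r < gromov_product c y z \<Longrightarrow> r - \<delta> < gromov_product c x z"
  using hyperbolic[of c x y z] by linarith

lemma equiv_seqs: "equiv (seqs_at_infinity b) (seqs_equiv b)"
proof (rule equivI)
  show "seqs_equiv b \<subseteq> seqs_at_infinity b \<times> seqs_at_infinity b"
    by (auto simp: seqs_equiv_iff)
  show "refl_on (seqs_at_infinity b) (seqs_equiv b)"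
    by (auto simp: refl_on_def seqs_equiv_iff seqs_at_infinity_iff)
  show "sym (seqs_equiv b)"
  proof (rule symI)
    fix s t assume st: "(s, t) \<in> seqs_equiv b"
    then have "\<forall>r. \<exists>N. \<forall>m\<ge>N. \<forall>n\<ge>N. r < gromov_product b (s m) (t n)"
      by (simp add: seqs_equiv_iff)
    then have "\<forall>r. \<exists>N. \<forall>m\<ge>N. \<forall>n\<ge>N. r < gromov_product b (t m) (s n)"
      by (subst gromov_product_commute) blast
    with st show "(t, s) \<in> seqs_equiv b"
      by (simp add: seqs_equiv_iff)
  qed
  show "trans (seqs_equiv b)"
  proof (rule transI)
    fix s t u assume st: "(s, t) \<in> seqs_equiv b" and tu: "(t, u) \<in> seqs_equiv b"
    have "\<exists>N. \<forall>m\<ge>N. \<forall>n\<ge>N. r < gromov_product b (s m) (u n)" for r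
    proof -
      obtain N1 where N1: "\<And>m n. m\<ge>N1 \<Longrightarrow> n\<ge>N1 \<Longrightarrow> r + \<delta> < gromov_product b (s m) (t n)"
        using st by (meson seqs_equiv_iff)
      obtain N2 where N2: "\<And>m n. m\<ge>N2 \<Longrightarrow> n\<ge>N2 \<Longrightarrow> r + \<delta> < gromov_product b (t m) (u n)"
        using tu by (meson seqs_equiv_iff)
      have "r < gromov_product b (s m) (u n)" if "m \<ge> max N1 N2" "n \<ge> max N1 N2" for m n
        using hyperbolicD[OF N1 N2, of m m n] that by simp
      then show ?thesis by blast
    qed
    then show "(s, u) \<in> seqs_equiv b"
      using st tu by (simp add: seqs_equiv_iff)
  qed
qed

lemma boundary_nonempty: "\<xi> \<in> M \<Longrightarrow> \<exists>s. s \<in> \<xi>"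
  using in_quotient_imp_non_empty[OF equiv_seqs] by (auto simp: gromov_boundary_def)

lemma boundary_seq_large:
  assumes "\<xi> \<in> M" "s \<in> \<xi>" "t \<in> \<xi>"
  shows "\<exists>N. \<forall>m\<ge>N. \<forall>n\<ge>N. r < gromov_product b (s m) (t n)"
proof -
  have "(s, t) \<in> seqs_equiv b"
    using assms quotient_eqI quotient_eq_iff[OF equiv_seqs, of \<xi> \<xi> s t]
    by (auto simp: gromov_boundary_def)
  then show ?thesis by (simp add: seqs_equiv_iff)
qed

lemma boundary_eqI:
  assumes "\<xi> \<in> M" "\<eta> \<in> M" and "\<And>r. near b r (Inr \<xi>) (Inr \<eta>)"
  shows "\<xi> = \<eta>"
proof -
  obtain s t where st: "s \<in> \<xi>" "t \<in> \<eta>" using assms boundary_nonempty by meson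
  have "s \<in> seqs_at_infinity b" "t \<in> seqs_at_infinity b"
    using st assms in_quotient_imp_subset[OF equiv_seqs] by (auto simp: gromov_boundary_def)
  then have "(s, t) \<in> seqs_equiv b"
    using assms(3) st by (auto simp: seqs_equiv_iff near_def)
  then show ?thesis
    using quotient_eq_iff[OF equiv_seqs, of \<xi> \<eta> s t] st assms by (auto simp: gromov_boundary_def)
qed

lemma reps_nonempty: "u \<in> UNIV <+> M \<Longrightarrow> \<exists>s. s \<in> reps u"
  using boundary_nonempty by auto

text \<open>A single pair of representatives suffices: exchanging the representative of one side for
  an equivalent one costs \<delta> by hyperbolicity, and both sides are exchanged in turn.\<close>

lemma nearI:
  assumes "u \<in> UNIV <+> M" "v \<in> UNIV <+> M" "s \<in> reps u" "t \<in> reps v"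
    and st: "\<forall>m\<ge>N. \<forall>n\<ge>N. r < gromov_product b (s m) (t n)"
  shows "near b (r - 2 * \<delta>) u v"
proof -
  have aux: "\<exists>N. \<forall>m\<ge>N. \<forall>n\<ge>N. r - \<delta> < gromov_product b (s m) (t n)"
    if u: "u \<in> UNIV <+> M" and s': "s' \<in> reps u" and s: "s \<in> reps u"
      and st: "\<forall>m\<ge>N. \<forall>n\<ge>N. r < gromov_product b (s' m) (t n)" for u s s' t r N
  proof (cases u)
    case (Inl p)
    have "r - \<delta> < gromov_product b (s m) (t n)" if "m \<ge> N" "n \<ge> N" for m n
    proof -
      have "r < gromov_product b (s' m) (t n)" using st that by blast
      then show ?thesis using delta_nonneg s s' Inl by auto
    qed
    then show ?thesis by blast
  next
    case (Inr \<xi>)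
    have "\<xi> \<in> M" "s \<in> \<xi>" "s' \<in> \<xi>" using u s s' Inr by auto
    then obtain K where K: "\<And>m n. m \<ge> K \<Longrightarrow> n \<ge> K \<Longrightarrow> r < gromov_product b (s m) (s' n)"
      using boundary_seq_large by meson
    have "r - \<delta> < gromov_product b (s m) (t n)" if "m \<ge> max N K" "n \<ge> max N K" for m n
      using hyperbolicD[OF K, of m m "t n"] st that by auto
    then show ?thesis by blast
  qed
  show ?thesis unfolding near_def
  proof (intro ballI)
    fix s' t' assume s': "s' \<in> reps u" and t': "t' \<in> reps v"
    obtain N1 where N1: "\<And>m n. m \<ge> N1 \<Longrightarrow> n \<ge> N1 \<Longrightarrow> r - \<delta> < gromov_product b (s' m) (t n)"
      using aux[OF assms(1,3) s' st] by blast
    have "\<forall>m\<ge>N1. \<forall>n\<ge>N1. r - \<delta> < gromov_product b (t m) (s' n)"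
      using N1 by (subst gromov_product_commute) blast
    then obtain N2 where N2: "\<forall>m\<ge>N2. \<forall>n\<ge>N2. r - \<delta> - \<delta> < gromov_product b (t' m) (s' n)"
      using aux[OF assms(2,4) t'] by blast
    have "r - 2 * \<delta> < gromov_product b (s' m) (t' n)" if "m \<ge> N2" "n \<ge> N2" for m n
      using N2 that by (subst gromov_product_commute) (simp add: algebra_simps)
    then show "\<exists>N. \<forall>m\<ge>N. \<forall>n\<ge>N. r - 2 * \<delta> < gromov_product b (s' m) (t' n)"
      by blast
  qed
qed

lemma near_trans:
  assumes "near b r u v" "near b r v w" "v \<in> UNIV <+> M"
  shows "near b (r - \<delta>) u w"
  unfolding near_def
proof (intro ballI)
  fix s t assume s: "s \<in> reps u" and t: "t \<in> reps w"
  obtain v' where v': "v' \<in> reps v" using reps_nonempty assms by meson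
  obtain N1 where N1: "\<And>m n. m \<ge> N1 \<Longrightarrow> n \<ge> N1 \<Longrightarrow> r < gromov_product b (s m) (v' n)"
    using assms(1) s v' unfolding near_def by meson
  obtain N2 where N2: "\<And>m n. m \<ge> N2 \<Longrightarrow> n \<ge> N2 \<Longrightarrow> r < gromov_product b (v' m) (t n)"
    using assms(2) t v' unfolding near_def by meson
  have "r - \<delta> < gromov_product b (s m) (t n)" if "m \<ge> max N1 N2" "n \<ge> max N1 N2" for m n
    using hyperbolicD[OF N1 N2, of m m n] that by auto
  then show "\<exists>N. \<forall>m\<ge>N. \<forall>n\<ge>N. r - \<delta> < gromov_product b (s m) (t n)" by blast
qed

lemma near_self:
  assumes "\<xi> \<in> M" shows "near b r (Inr \<xi>) (Inr \<xi>)"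
  using boundary_seq_large[OF assms] by (simp add: near_def)

lemma near_rep:
  assumes "\<xi> \<in> M" "s \<in> \<xi>"
  shows "\<exists>N. \<forall>n\<ge>N. near b r (Inr \<xi>) (Inl (s n))"
proof -
  obtain N where N: "\<And>m n. m\<ge>N \<Longrightarrow> n\<ge>N \<Longrightarrow> r + 2 * \<delta> < gromov_product b (s m) (s n)"
    using boundary_seq_large[OF assms(1,2,2)] by meson
  have "near b (r + 2 * \<delta> - 2 * \<delta>) (Inr \<xi>) (Inl (s n))" if "n \<ge> N" for n
    by (rule nearI[where s=s and t="\<lambda>_. s n" and N=N]) (use assms N that in auto)
  then show ?thesis by auto
qed

lemma extended_gromov_product_imp_near:
  assumes "u \<in> UNIV <+> M" "v \<in> UNIV <+> M" "ereal r < extended_gromov_product b u v"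
  shows "near b (r - 2 * \<delta>) u v"
proof -
  obtain s t where st: "s \<in> reps u" "t \<in> reps v"
     "ereal r < Liminf (sequentially \<times>\<^sub>F sequentially) (\<lambda>(m, n). ereal (gromov_product b (s m) (t n)))"
    using assms(3) by (auto simp: extended_gromov_product_def less_SUP_iff)
  have "\<forall>\<^sub>F x in sequentially \<times>\<^sub>F sequentially. ereal r < (case x of (m, n) \<Rightarrow> ereal (gromov_product b (s m) (t n)))"
    using less_LiminfD[OF st(3)] .
  then obtain N where "\<And>m n. m \<ge> N \<Longrightarrow> n \<ge> N \<Longrightarrow> r < gromov_product b (s n) (t m)"
    by (auto simp: eventually_prod_sequentially)
  then show ?thesis
    using nearI[OF assms(1,2) st(1,2)] by blast
qed

lemma near_imp_extended_gromov_product: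
  assumes "u \<in> UNIV <+> M" "v \<in> UNIV <+> M" "near b r u v"
  shows "ereal r \<le> extended_gromov_product b u v"
proof -
  obtain s t where st: "s \<in> reps u" "t \<in> reps v" using assms reps_nonempty by meson
  have ev: "\<forall>\<^sub>F x in sequentially \<times>\<^sub>F sequentially. ereal r \<le> (case x of (m, n) \<Rightarrow> ereal (gromov_product b (s m) (t n)))"
    using assms(3) st unfolding near_def eventually_prod_sequentially
    by (auto, metis less_imp_le)
  show ?thesis
    unfolding extended_gromov_product_def
    by (rule SUP_upper2[of "(s, t)"]) (use st Liminf_bounded[OF ev] in auto)
qed

text \<open>The thresholds of \<open>near\<close> and of the extended product differ by bounded
  amounts, which the existential quantifier over \<open>r\<close> absorbs; hence \<open>near\<close>
  can replace the extended product in the topology.\<close>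

lemma bordification_nhd_iff:
  assumes "\<xi> \<in> M"
  shows "(\<exists>r::real. {u \<in> UNIV <+> M. extended_gromov_product b (Inr \<xi>) u > ereal r} \<subseteq> U) \<longleftrightarrow>
         (\<exists>r. \<forall>u\<in>UNIV <+> M. near b r (Inr \<xi>) u \<longrightarrow> u \<in> U)" (is "?L \<longleftrightarrow> ?R")
proof
  assume ?L
  then obtain r where r: "{u \<in> UNIV <+> M. extended_gromov_product b (Inr \<xi>) u > ereal r} \<subseteq> U" by blast
  have "u \<in> U" if "u \<in> UNIV <+> M" "near b (r + 1) (Inr \<xi>) u" for u
  proof -
    have "ereal r < ereal (r + 1)" by simp
    also have "\<dots> \<le> extended_gromov_product b (Inr \<xi>) u"
      by (rule near_imp_extended_gromov_product) (use assms that in auto)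
    finally show ?thesis using r that by blast
  qed
  then show ?R by blast
next
  assume ?R
  then obtain r where r: "\<And>u. u \<in> UNIV <+> M \<Longrightarrow> near b r (Inr \<xi>) u \<Longrightarrow> u \<in> U" by blast
  have "u \<in> U" if "u \<in> UNIV <+> M" "ereal (r + 2 * \<delta>) < extended_gromov_product b (Inr \<xi>) u" for u
    using extended_gromov_product_imp_near[of "Inr \<xi>" u "r + 2 * \<delta>"] assms that r by auto
  then show ?L by blast
qed

lemma openin_bordification_iff:
  "openin (bordification b) U \<longleftrightarrow> U \<subseteq> UNIV <+> M \<and> open (Inl -` U) \<and>
     (\<forall>\<xi>\<in>M. Inr \<xi> \<in> U \<longrightarrow> (\<exists>r. \<forall>u\<in>UNIV <+> M. near b r (Inr \<xi>) u \<longrightarrow> u \<in> U))"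
  unfolding openin_bordification bordification_open_def
  using bordification_nhd_iff by auto

lemma topspace_bordification: "topspace (bordification b) = UNIV <+> M"
proof
  show "topspace (bordification b) \<subseteq> UNIV <+> M"
    unfolding topspace_def openin_bordification_iff by blast
  have "openin (bordification b) (UNIV <+> M)"
    unfolding openin_bordification_iff by (auto simp: vimage_def Plus_def)
  then show "UNIV <+> M \<subseteq> topspace (bordification b)"
    by (rule openin_subset)
qed

text \<open>The points near \<xi> do not visibly form an open set, since passing to a neighbour
  lowers the threshold. The set \<open>U\<close> keeps only the points with a positive margin
  \<open>e\<close>: the margin makes the trace on X open, and at a boundary point a whole
  neighbourhood is required to share it.\<close>

lemma bordification_nhd:
  assumes "\<xi> \<in> M"
  shows "\<exists>U. openin (bordification b) U \<and> Inr \<xi> \<in> U \<and> (\<forall>u\<in>U. near b r (Inr \<xi>) u)"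
proof -
  define U where "U = {u \<in> UNIV <+> M. \<exists>e>0. near b (r + e) (Inr \<xi>) u \<and>
     (\<forall>\<eta>. u = Inr \<eta> \<longrightarrow> (\<exists>q. \<forall>v\<in>UNIV <+> M. near b q u v \<longrightarrow> near b (r + e) (Inr \<xi>) v))}"
  have "open (Inl -` U :: 'a set)"
    unfolding open_dist
  proof
    fix p :: 'a assume "p \<in> Inl -` U"
    then obtain e where e: "e > 0" "near b (r + e) (Inr \<xi>) (Inl p)"
      by (auto simp: U_def)
    have "q \<in> Inl -` U" if "dist q p < e / 2" for q
    proof -
      have "near b (r + e - dist p q) (Inr \<xi>) (Inl q)" using near_lipschitz[OF e(2)] .
      then have "near b (r + e / 2) (Inr \<xi>) (Inl q)"
        by (rule near_mono) (use that in \<open>simp add: dist_commute field_simps\<close>)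
      then show ?thesis using e unfolding U_def by (auto intro!: exI[of _ "e/2"])
    qed
    then show "\<exists>e>0. \<forall>q. dist q p < e \<longrightarrow> q \<in> Inl -` U"
      using e by (auto intro!: exI[of _ "e/2"])
  qed
  moreover have "\<exists>q. \<forall>u\<in>UNIV <+> M. near b q (Inr \<eta>) u \<longrightarrow> u \<in> U" if "\<eta> \<in> M" "Inr \<eta> \<in> U" for \<eta>
  proof -
    have "\<exists>e>0. \<exists>q. \<forall>v\<in>UNIV <+> M. near b q (Inr \<eta>) v \<longrightarrow> near b (r + e) (Inr \<xi>) v"
      using that(2) unfolding U_def by auto
    then obtain e q where e: "e > 0"
      and q: "\<And>v. v \<in> UNIV <+> M \<Longrightarrow> near b q (Inr \<eta>) v \<Longrightarrow> near b (r + e) (Inr \<xi>) v"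
      by metis
    \<comment> \<open>Two steps at level \<open>q + \<delta>\<close> compose to one at level
      \<open>q\<close>, so points this near to \<eta> inherit the neighbourhood condition of
      \<eta>.\<close>
    have "u \<in> U" if u: "u\<in>UNIV <+> M" "near b (q + \<delta>) (Inr \<eta>) u" for u
    proof -
      have 1: "near b q (Inr \<eta>) u" using u near_mono delta_nonneg by fastforce
      have 2: "near b q (Inr \<eta>) v" if "v \<in> UNIV <+> M" "near b (q + \<delta>) u v" for v
        using near_trans[OF u(2) that(2) u(1)] by simp
      have 3: "near b (r + e) (Inr \<xi>) u" by (rule q[OF u(1) 1])
      have 4: "\<forall>v\<in>UNIV <+> M. near b (q + \<delta>) u v \<longrightarrow> near b (r + e) (Inr \<xi>) v"
        using q 2 by auto
      show ?thesis unfolding U_def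
        by (rule CollectI, intro conjI u(1) exI[of _ e] e 3 allI impI exI[of _ "q + \<delta>"] 4)
    qed
    then show ?thesis by (intro exI[of _ "q + \<delta>"]) auto
  qed
  moreover have "Inr \<xi> \<in> U"
    unfolding U_def
    by (rule CollectI, intro conjI InrI assms exI[of _ 1] near_self[OF assms] allI impI exI[of _ "r + 1"]) auto
  moreover have "U \<subseteq> UNIV <+> M" unfolding U_def by blast
  moreover have "near b r (Inr \<xi>) u" if "u \<in> U" for u
    using that near_mono[of b _ "Inr \<xi>" u r] unfolding U_def by fastforce
  ultimately show ?thesis
    unfolding openin_bordification_iff by blast
qed

text \<open>This is the filter along which \<open>potential_cocycle\<close> takes its
  limsup.\<close>

definition to_boundary :: "'a bdry_point \<Rightarrow> 'a filter" where
  "to_boundary \<xi> = filtercomap Inl (nhdsin (bordification b) (Inr \<xi>))"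

lemma eventually_to_boundary:
  assumes "\<xi> \<in> M"
  shows "eventually P (to_boundary \<xi>) \<longleftrightarrow> (\<exists>r. \<forall>p. near b r (Inr \<xi>) (Inl p) \<longrightarrow> P p)"
proof
  assume "eventually P (to_boundary \<xi>)"
  then obtain U where U: "openin (bordification b) U" "Inr \<xi> \<in> U" "\<And>p. Inl p \<in> U \<Longrightarrow> P p"
    unfolding to_boundary_def eventually_filtercomap eventually_nhdsin topspace_bordification
    using assms by blast
  then show "\<exists>r. \<forall>p. near b r (Inr \<xi>) (Inl p) \<longrightarrow> P p"
    unfolding openin_bordification_iff using assms by (meson InlI UNIV_I)
next
  assume "\<exists>r. \<forall>p. near b r (Inr \<xi>) (Inl p) \<longrightarrow> P p"
  then obtain r where r: "\<And>p. near b r (Inr \<xi>) (Inl p) \<Longrightarrow> P p" by blast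
  have "eventually (near b r (Inr \<xi>)) (nhdsin (bordification b) (Inr \<xi>))"
    using bordification_nhd[OF assms] unfolding eventually_nhdsin by blast
  then show "eventually P (to_boundary \<xi>)"
    unfolding to_boundary_def eventually_filtercomap using r by blast
qed

lemma to_boundary_neq_bot:
  assumes "\<xi> \<in> M" shows "to_boundary \<xi> \<noteq> bot"
proof -
  obtain s where s: "s \<in> \<xi>" using assms boundary_nonempty by meson
  have "\<not> eventually (\<lambda>_. False) (to_boundary \<xi>)"
    unfolding eventually_to_boundary[OF assms] using near_rep[OF assms s] by blast
  then show ?thesis by (auto simp: trivial_limit_def)
qed

abbreviation "T \<equiv> gromov_boundary_topology b"

lemma topspace_boundary [simp]: "topspace T = M"
  unfolding gromov_boundary_topology_def topspace_pullback_topology topspace_bordification by auto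

lemma boundary_open_near:
  assumes "openin T U" "\<xi> \<in> U"
  shows "\<exists>r. \<forall>\<eta>\<in>M. near b r (Inr \<xi>) (Inr \<eta>) \<longrightarrow> \<eta> \<in> U"
proof -
  obtain W where W: "openin (bordification b) W" "U = Inr -` W \<inter> M"
    using assms(1) unfolding gromov_boundary_topology_def openin_pullback_topology by blast
  then obtain r where "\<forall>u\<in>UNIV <+> M. near b r (Inr \<xi>) u \<longrightarrow> u \<in> W"
    using assms unfolding openin_bordification_iff by blast
  then show ?thesis using W by auto
qed

lemma boundary_nhd:
  assumes "\<xi> \<in> M"
  shows "\<exists>U. openin T U \<and> \<xi> \<in> U \<and> (\<forall>\<eta>\<in>U. near b r (Inr \<xi>) (Inr \<eta>))"
proof -
  obtain W where W: "openin (bordification b) W" "Inr \<xi> \<in> W" "\<forall>u\<in>W. near b r (Inr \<xi>) u"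
    using bordification_nhd[OF assms] by blast
  then have "openin T (Inr -` W \<inter> M)"
    unfolding gromov_boundary_topology_def openin_pullback_topology by blast
  then show ?thesis using W assms by (intro exI[of _ "Inr -` W \<inter> M"]) auto
qed

end

section \<open>Discrete groups of isometries\<close>

lemma isometry_inv: "isometry f \<Longrightarrow> isometry (inv_into UNIV f)"
  unfolding isometry_def
  by (metis bij_imp_bij_inv bij_inv_eq_iff)

lemma carrier_isometry_group: "carrier isometry_group = Collect isometry"
  by (auto simp: isometry_group_def isometry_def)

lemma group_isometry_group: "group (isometry_group :: ('a::metric_space \<Rightarrow> 'a) monoid)"
proof (rule groupI)
  fix f :: "'a \<Rightarrow> 'a" assume "f \<in> carrier isometry_group"
  then have f: "isometry f" by (simp add: carrier_isometry_group)
  then have "inv_into UNIV f \<circ> f = id"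
    by (simp add: isometry_def bij_is_inj)
  then show "\<exists>g\<in>carrier isometry_group. g \<otimes>\<^bsub>isometry_group\<^esub> f = \<one>\<^bsub>isometry_group\<^esub>"
    using isometry_inv[OF f] unfolding carrier_isometry_group
    by (intro bexI[of _ "inv_into UNIV f"]) (auto simp: isometry_group_def)
qed (auto simp: isometry_group_def o_assoc bij_comp)

lemma inv_isometry_group:
  assumes "isometry f" shows "inv\<^bsub>isometry_group\<^esub> f = inv_into UNIV f"
proof (rule group.inv_equality[OF group_isometry_group])
  show "inv_into UNIV f \<otimes>\<^bsub>isometry_group\<^esub> f = \<one>\<^bsub>isometry_group\<^esub>"
    using assms by (simp add: isometry_group_def isometry_def bij_is_inj)
qed (use assms isometry_inv carrier_isometry_group in auto)

lemma mult_isometry_group: "f \<otimes>\<^bsub>isometry_group\<^esub> g = f \<circ> g"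
  by (simp add: isometry_group_def)

text \<open>If a subbasic set given by \<open>K\<close> and \<open>V\<close> contains
  \<open>id\<close>, then the compact \<open>K\<close> lies in the open \<open>V\<close> with a
  margin, and every map moving the points of \<open>K\<close> by less than this margin still sends
  \<open>K\<close> into \<open>V\<close>.\<close>

lemma compact_open_id_nhd:
  fixes U :: "('a::metric_space \<Rightarrow> 'a) set"
  assumes "openin compact_open_topology U" "id \<in> U"
  shows "\<exists>K e. compact K \<and> e > 0 \<and> (\<forall>f. (\<forall>x\<in>K. dist (f x) x < e) \<longrightarrow> f \<in> U)"
proof -
  have "generate_topology_on {{f. f ` K \<subseteq> U} | (K::'a set) (U::'a set). compact K \<and> open U} U"
    using assms(1) unfolding compact_open_topology_def openin_topology_generated_by_iff .
  then show ?thesis using assms(2)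
  proof induction
    case Empty
    then show ?case by simp
  next
    case (Int A B)
    then obtain K e L e' where K: "compact K" "e > 0" "\<And>f. (\<forall>x\<in>K. dist (f x) x < e) \<longrightarrow> f \<in> A"
      and L: "compact L" "e' > 0" "\<And>f. (\<forall>x\<in>L. dist (f x) x < e') \<longrightarrow> f \<in> B" by auto
    then show ?case
      by (intro exI[of _ "K \<union> L"] exI[of _ "min e e'"]) (simp add: compact_Un)
  next
    case (UN \<K>)
    then obtain A where "A \<in> \<K>" "id \<in> A" by blast
    with UN show ?case by (meson UnionI)
  next
    case (Basis A)
    then obtain K V :: "'a set" where KV: "A = {f. f ` K \<subseteq> V}" "compact K" "open V" by blast
    with Basis have "K \<subseteq> V" by auto
    then obtain e where e: "e > 0" "(\<Union>x\<in>K. ball x e) \<subseteq> V"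
      using compact_subset_open_imp_ball_epsilon_subset[OF KV(2,3)] by blast
    then show ?case
      using KV by (intro exI[of _ K] exI[of _ e]) (fastforce simp: dist_commute)
  qed
qed

lemma compact_finite_net:
  fixes K :: "'a::metric_space set"
  assumes "compact K" "e > 0"
  shows "\<exists>F. finite F \<and> F \<subseteq> K \<and> (\<forall>x\<in>K. \<exists>c\<in>F. dist x c < e)"
proof -
  have "\<exists>F. F \<subseteq> K \<and> finite F \<and> K \<subseteq> (\<Union>c\<in>F. ball c e)"
    by (rule compactE_image[OF assms(1), of K "\<lambda>c. ball c e"]) (use assms(2) in auto)
  then obtain F where "finite F" "F \<subseteq> K" "K \<subseteq> (\<Union>c\<in>F. ball c e)" by blast
  moreover have "\<exists>c\<in>F. dist x c < e" if "x \<in> K" for x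
  proof -
    have "x \<in> (\<Union>c\<in>F. ball c e)" using \<open>K \<subseteq> _\<close> that by (rule subsetD)
    then show ?thesis by (auto simp: dist_commute)
  qed
  ultimately show ?thesis by blast
qed

text \<open>Discreteness provides a compact \<open>K\<close> and an \<open>e\<close> such that only
  the identity moves all of \<open>K\<close> by less than \<open>e\<close>. An element of bounded
  displacement is then determined by a coarse record of its values on a finite net of
  \<open>K\<close>, and properness of X leaves finitely many records.\<close>

lemma finite_discrete_isometry_group:
  fixes b :: "'a::metric_space"
  assumes proper: "proper_metric_space TYPE('a)" and discr: "discrete_isometry_group \<Gamma>"
  shows "finite {g \<in> \<Gamma>. dist b (g b) \<le> r}"
proof -
  let ?S = "{g \<in> \<Gamma>. dist b (g b) \<le> r}"
  have sub: "subgroup \<Gamma> isometry_group" and top: "subtopology compact_open_topology \<Gamma> = discrete_topology \<Gamma>"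
    using discr by (auto simp: discrete_isometry_group_def)
  have iso: "isometry g" if "g \<in> \<Gamma>" for g
    using subgroup.subset[OF sub] that by (auto simp: carrier_isometry_group)
  have id: "id \<in> \<Gamma>" using subgroup.one_closed[OF sub] by (simp add: isometry_group_def)
  then have "openin (subtopology compact_open_topology \<Gamma>) {id}" unfolding top by simp
  then obtain U where U: "openin compact_open_topology U" "{id} = U \<inter> \<Gamma>"
    by (auto simp: openin_subtopology)
  have "id \<in> U" using U(2) by blast
  from compact_open_id_nhd[OF U(1) this]
  obtain K e where K: "compact K" "e > 0" "\<forall>f. (\<forall>x\<in>K. dist (f x) x < e) \<longrightarrow> f \<in> U" by metis
  obtain F where F: "finite F" "\<And>x. x \<in> K \<Longrightarrow> \<exists>c\<in>F. dist x c < e / 3"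
    using compact_finite_net[OF K(1), of "e / 3"] K(2) by auto
  have "compact (cball b (r + dist b f))" for f
    using proper by (simp add: proper_metric_space_def)
  then have "\<forall>f. \<exists>C. finite C \<and> (\<forall>x\<in>cball b (r + dist b f). \<exists>c\<in>C. dist x c < e / 6)"
    using compact_finite_net[of _ "e / 6"] K(2) by (metis divide_pos_pos zero_less_numeral)
  then obtain C where C: "\<And>f. finite (C f)"
    "\<And>f x. x \<in> cball b (r + dist b f) \<Longrightarrow> \<exists>c\<in>C f. dist x c < e / 6" by metis
  \<comment> \<open>Two images with the same record lie within e/6 + e/6 of each other; adding e/3
    twice for the passage from a point of \<open>K\<close> to the net \<open>F\<close> stays below
    \<open>e\<close>.\<close>
  define code where "code g = (\<lambda>f\<in>F. SOME c. c \<in> C f \<and> dist (g f) c < e / 6)" for g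
  have code: "code g f \<in> C f \<and> dist (g f) (code g f) < e / 6" if "g \<in> ?S" "f \<in> F" for g f
  proof -
    have "dist b (g f) \<le> dist b (g b) + dist (g b) (g f)" by (rule dist_triangle)
    also have "dist (g b) (g f) = dist b f" using iso that by (auto simp: isometry_def)
    finally have "g f \<in> cball b (r + dist b f)" using that by auto
    then have "\<exists>c. c \<in> C f \<and> dist (g f) c < e / 6" using C(2) by blast
    then show ?thesis using that(2) someI_ex[of "\<lambda>c. c \<in> C f \<and> dist (g f) c < e / 6"]
      unfolding code_def by simp
  qed
  have "inj_on code ?S"
  proof (rule inj_onI)
    fix g h assume g: "g \<in> ?S" and h: "h \<in> ?S" and gh: "code g = code h"
    define k where "k = inv_into UNIV g \<circ> h"
    have "inv\<^bsub>isometry_group\<^esub> g \<otimes>\<^bsub>isometry_group\<^esub> h \<in> \<Gamma>"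
      using g h by (intro subgroup.m_closed[OF sub] subgroup.m_inv_closed[OF sub]) auto
    then have k: "k \<in> \<Gamma>"
      using g iso by (simp add: k_def inv_isometry_group mult_isometry_group)
    have "dist (k x) x < e" if x: "x \<in> K" for x
    proof -
      obtain f where f: "f \<in> F" "dist x f < e / 3" using F(2) x by blast
      have 1: "dist (g f) (h f) < e / 3"
        using code[OF g f(1)] code[OF h f(1)] dist_triangle2[of "g f" "h f" "code g f"]
        unfolding gh by linarith
      have 2: "dist (g x) (g f) < e / 3" "dist (h x) (h f) < e / 3"
        using f(2) iso g h by (auto simp: isometry_def)
      have "dist (g (k x)) (g x) = dist (h x) (g x)"
        using iso[of g] g by (simp add: k_def isometry_def bij_is_surj surj_f_inv_f)
      then have "dist (k x) x = dist (h x) (g x)" using iso[of g] g by (simp add: isometry_def)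
      also have "\<dots> \<le> dist (h x) (h f) + dist (h f) (g f) + dist (g f) (g x)"
        using dist_triangle[of "h x" "g x" "h f"] dist_triangle[of "h f" "g x" "g f"] by linarith
      finally show ?thesis using 1 2 by (simp add: dist_commute)
    qed
    then have "k \<in> U" using K(3) by blast
    then have "k = id" using k U(2) by blast
    then have "g \<circ> k = g" by simp
    moreover have "g \<circ> k = h"
      using iso[of g] g by (auto simp: k_def isometry_def bij_is_surj surj_f_inv_f fun_eq_iff)
    ultimately show "g = h" by simp
  qed
  moreover have "code ` ?S \<subseteq> PiE F C" using code by (auto simp: code_def)
  moreover have "finite (PiE F C)" using F(1) C(1) by (rule finite_PiE)
  ultimately show ?thesis by (meson finite_imageD finite_subset)
qed

section \<open>The convergence action\<close>

abbreviation shift :: "('a \<Rightarrow> 'a) \<Rightarrow> ('a \<Rightarrow> 'a) + 'a bdry_point \<Rightarrow> ('a \<Rightarrow> 'a) + 'a bdry_point" where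
  "shift g \<equiv> map_sum (\<lambda>h. g \<circ> h) (boundary_action g)"

text \<open>Cocompactness enters as \<open>orbit_dense\<close>: every point of X can be exchanged
  for an orbit point at the cost of \<open>D\<close>.\<close>

locale hyperbolic_group_action = gromov_hyperbolic_space b \<delta>
  for b :: "'a::metric_space" and \<delta> :: real +
  fixes \<Gamma> :: "('a \<Rightarrow> 'a) set"
    and d :: "('a \<Rightarrow> 'a) + 'a bdry_point \<Rightarrow> ('a \<Rightarrow> 'a) + 'a bdry_point \<Rightarrow> real"
    and D :: real
  assumes proper: "proper_metric_space TYPE('a)"
    and geodesic: "geodesic_metric_space TYPE('a)"
    and discr: "discrete_isometry_group \<Gamma>"
    and orbit_dense: "\<exists>g\<in>\<Gamma>. dist p (g b) \<le> D"
    and non_elem: "non_elementary (isometry_subgroup \<Gamma>) T boundary_action"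
    and compat: "compatible_metric (isometry_subgroup \<Gamma>) T boundary_action d"
begin

abbreviation "E \<equiv> \<Gamma> <+> M"
abbreviation "G \<equiv> isometry_subgroup \<Gamma>"
abbreviation "cinv g \<equiv> inv_into UNIV (g :: 'a \<Rightarrow> 'a)"

sublocale MS: Metric_space E d
  using compat by (simp add: compatible_metric_def)

lemma conv_act: "convergence_action G MS.mtopology shift"
  and emb_Inl: "embedding_map (discrete_topology \<Gamma>) MS.mtopology Inl"
  and emb_Inr: "embedding_map T MS.mtopology Inr"
  using compat by (auto simp: compatible_metric_def Let_def isometry_group_def)

lemma subgroup: "subgroup \<Gamma> isometry_group"
  using discr by (simp add: discrete_isometry_group_def)

lemma group_G: "group G"
  using subgroup.subgroup_is_group[OF subgroup group_isometry_group] .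

lemma iso: "g \<in> \<Gamma> \<Longrightarrow> isometry g"
  using subgroup.subset[OF subgroup] by (auto simp: carrier_isometry_group)

lemma dist_iso [simp]: "g \<in> \<Gamma> \<Longrightarrow> dist (g x) (g y) = dist x y"
  using iso by (simp add: isometry_def)

lemma G_simps [simp]: "carrier G = \<Gamma>" "x \<otimes>\<^bsub>G\<^esub> y = x \<circ> y" "\<one>\<^bsub>G\<^esub> = id"
  by (simp_all add: isometry_group_def)

lemma inv_G: "g \<in> \<Gamma> \<Longrightarrow> inv\<^bsub>G\<^esub> g = cinv g"
  using group.m_inv_consistent[OF group_isometry_group subgroup] inv_isometry_group iso by metis

lemma id_in [simp]: "id \<in> \<Gamma>"
  using subgroup.one_closed[OF subgroup] by (simp add: isometry_group_def)

lemma comp_in [simp]: "g \<in> \<Gamma> \<Longrightarrow> h \<in> \<Gamma> \<Longrightarrow> g \<circ> h \<in> \<Gamma>"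
  using subgroup.m_closed[OF subgroup, of g h] by (simp add: isometry_group_def)

lemma cinv_in [simp]: "g \<in> \<Gamma> \<Longrightarrow> cinv g \<in> \<Gamma>"
  using subgroup.m_inv_closed[OF subgroup] inv_isometry_group iso by metis

lemma cinv_cancel [simp]:
  "g \<in> \<Gamma> \<Longrightarrow> g (cinv g x) = x" "g \<in> \<Gamma> \<Longrightarrow> cinv g (g x) = x"
  using iso[of g] by (simp_all add: isometry_def bij_is_surj surj_f_inv_f bij_is_inj)

lemma cinv_comp [simp]:
  "g \<in> \<Gamma> \<Longrightarrow> g \<circ> cinv g = id" "g \<in> \<Gamma> \<Longrightarrow> cinv g \<circ> g = id"
  by (auto simp: fun_eq_iff)

lemma cinv_cinv [simp]: "g \<in> \<Gamma> \<Longrightarrow> cinv (cinv g) = g"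
  using iso[of g] by (simp add: isometry_def inv_inv_eq)

lemma cinv_mult: "g \<in> \<Gamma> \<Longrightarrow> h \<in> \<Gamma> \<Longrightarrow> cinv (g \<circ> h) = cinv h \<circ> cinv g"
  using iso[of g] iso[of h] by (simp add: isometry_def o_inv_distrib)

lemma dist_cinv: "g \<in> \<Gamma> \<Longrightarrow> dist b (cinv g b) = dist b (g b)"
  using dist_iso[of g b "cinv g b"] by (simp add: dist_commute)

lemma finite_bounded: "finite {g \<in> \<Gamma>. dist b (g b) \<le> r}"
  by (rule finite_discrete_isometry_group[OF proper discr])

lemma boundary_action_comp: "boundary_action g (boundary_action h \<xi>) = boundary_action (g \<circ> h) \<xi>"
  by (simp add: boundary_action_def image_image o_assoc)

lemma boundary_action_id [simp]: "boundary_action id \<xi> = \<xi>"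
  by (simp add: boundary_action_def)

lemma shift_comp: "shift g (shift h u) = shift (g \<circ> h) u"
  by (cases u) (auto simp: boundary_action_comp o_assoc)

lemma shift_id [simp]: "shift id u = u" "map_sum (\<lambda>h. h) (boundary_action id) u = u"
  by (cases u; simp)+

lemma shift_cancel [simp]: "g \<in> \<Gamma> \<Longrightarrow> shift g (shift (cinv g) u) = u"
    "g \<in> \<Gamma> \<Longrightarrow> shift (cinv g) (shift g u) = u"
  by (simp_all add: shift_comp)

lemma action_cancel [simp]: "g \<in> \<Gamma> \<Longrightarrow> boundary_action g (boundary_action (cinv g) u) = u"
    "g \<in> \<Gamma> \<Longrightarrow> boundary_action (cinv g) (boundary_action g u) = u"
  by (simp_all add: boundary_action_comp)

section \<open>The compatible metric on the union of the group and its boundary\<close>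

lemma homeo_shift: "g \<in> \<Gamma> \<Longrightarrow> homeomorphic_map MS.mtopology MS.mtopology (shift g)"
  using conv_act by (simp add: convergence_action_def)

lemma shift_in: "g \<in> \<Gamma> \<Longrightarrow> u \<in> E \<Longrightarrow> shift g u \<in> E"
  using homeomorphic_imp_surjective_map[OF homeo_shift] by auto

lemma action_in [simp]: "g \<in> \<Gamma> \<Longrightarrow> \<xi> \<in> M \<Longrightarrow> boundary_action g \<xi> \<in> M"
  using shift_in[of g "Inr \<xi>"] by auto

lemma d_pos: "u \<in> E \<Longrightarrow> v \<in> E \<Longrightarrow> u \<noteq> v \<Longrightarrow> d u v > 0"
  by (meson MS.mdist_pos_eq)

lemma action_inj: "g \<in> \<Gamma> \<Longrightarrow> boundary_action g u = boundary_action g v \<longleftrightarrow> u = v"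
  by (metis action_cancel(2))

lemma shift_continuous:
  assumes "g \<in> \<Gamma>" "u \<in> E" "e > 0"
  shows "\<exists>r>0. \<forall>v\<in>E. d u v < r \<longrightarrow> d (shift g u) (shift g v) < e"
proof -
  have "continuous_map MS.mtopology MS.mtopology (shift g)"
    using homeomorphic_imp_continuous_map[OF homeo_shift[OF assms(1)]] .
  then have "openin MS.mtopology {v \<in> E. shift g v \<in> MS.mball (shift g u) e}"
    by (auto dest!: openin_continuous_map_preimage)
  then obtain r where r: "r > 0" "MS.mball u r \<subseteq> {v \<in> E. shift g v \<in> MS.mball (shift g u) e}"
    unfolding MS.openin_mtopology using assms shift_in[OF assms(1,2)]
    by (metis (no_types, lifting) MS.centre_in_mball_iff mem_Collect_eq)
  have "d (shift g u) (shift g v) < e" if "v \<in> E" "d u v < r" for v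
  proof -
    have "v \<in> MS.mball u r" using that assms(2) by (simp only: MS.in_mball)
    then have "shift g v \<in> MS.mball (shift g u) e" using r(2) by blast
    then show ?thesis by (simp only: MS.in_mball)
  qed
  then show ?thesis using r(1) by blast
qed

lemma boundary_ball_open:
  assumes "\<xi> \<in> M" shows "openin T {\<eta> \<in> M. d (Inr \<xi>) (Inr \<eta>) < e}"
proof -
  have "continuous_map T MS.mtopology Inr"
    using emb_Inr homeomorphic_imp_continuous_map continuous_map_in_subtopology
    unfolding embedding_map_def by blast
  then have "openin T {\<eta> \<in> M. Inr \<eta> \<in> MS.mball (Inr \<xi>) e}"
    using openin_continuous_map_preimage[of T _ Inr "MS.mball (Inr \<xi>) e"] by simp
  moreover have "{\<eta> \<in> M. Inr \<eta> \<in> MS.mball (Inr \<xi>) e} = {\<eta> \<in> M. d (Inr \<xi>) (Inr \<eta>) < e}"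
    using assms by auto
  ultimately show ?thesis by simp
qed

text \<open>Both \<open>d\<close> and \<open>near\<close> induce the topology \<open>T\<close> on
  the boundary, so around a fixed \<xi> each controls the other; \<open>d_imp_near\<close> is the
  converse.\<close>

lemma near_imp_d:
  assumes "\<xi> \<in> M" "e > 0"
  shows "\<exists>r. \<forall>\<eta>\<in>M. near b r (Inr \<xi>) (Inr \<eta>) \<longrightarrow> d (Inr \<xi>) (Inr \<eta>) < e"
  using boundary_open_near[OF boundary_ball_open[OF assms(1), of e], of \<xi>] assms
  by (simp add: InrI)

lemma boundary_open_d:
  assumes "openin T U" "\<xi> \<in> U"
  shows "\<exists>e>0. \<forall>\<eta>\<in>M. d (Inr \<xi>) (Inr \<eta>) < e \<longrightarrow> \<eta> \<in> U"
proof -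
  have \<xi>: "\<xi> \<in> M" using openin_subset[OF assms(1)] assms(2) by auto
  have "homeomorphic_map T (subtopology MS.mtopology (Inr ` M)) Inr"
    using emb_Inr by (simp add: embedding_map_def)
  then have "openin (subtopology MS.mtopology (Inr ` M)) (Inr ` U)"
    using homeomorphic_imp_open_map assms(1) by (auto simp: open_map_def)
  then obtain W where W: "openin MS.mtopology W" "Inr ` U = W \<inter> Inr ` M"
    by (auto simp: openin_subtopology)
  then obtain e where e: "e > 0" "MS.mball (Inr \<xi>) e \<subseteq> W"
    unfolding MS.openin_mtopology using assms(2) by blast
  have "\<eta> \<in> U" if "\<eta> \<in> M" "d (Inr \<xi>) (Inr \<eta>) < e" for \<eta>
  proof -
    have "Inr \<eta> \<in> MS.mball (Inr \<xi>) e" using that \<xi> by (auto simp: MS.in_mball)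
    then have "Inr \<eta> \<in> Inr ` U" using W e that by blast
    then show ?thesis by auto
  qed
  then show ?thesis using e by blast
qed

lemma d_imp_near:
  assumes "\<xi> \<in> M"
  shows "\<exists>e>0. \<forall>\<eta>\<in>M. d (Inr \<xi>) (Inr \<eta>) < e \<longrightarrow> near b r (Inr \<xi>) (Inr \<eta>)"
  using boundary_nhd[OF assms] boundary_open_d by meson

lemma group_isolated:
  assumes "g \<in> \<Gamma>"
  shows "\<exists>e>0. \<forall>h\<in>\<Gamma>. d (Inl g) (Inl h) < e \<longrightarrow> h = g"
proof -
  have "homeomorphic_map (discrete_topology \<Gamma>) (subtopology MS.mtopology (Inl ` \<Gamma>)) Inl"
    using emb_Inl by (simp add: embedding_map_def)
  from homeomorphic_imp_open_map[OF this]
  have "openin (subtopology MS.mtopology (Inl ` \<Gamma>)) (Inl ` {g})"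
    using assms(1) unfolding open_map_def openin_discrete_topology by blast
  then obtain W where W: "openin MS.mtopology W" "Inl ` {g} = W \<inter> Inl ` \<Gamma>"
    by (auto simp: openin_subtopology)
  then obtain e where e: "e > 0" "MS.mball (Inl g) e \<subseteq> W"
    unfolding MS.openin_mtopology by blast
  have "h = g" if "h \<in> \<Gamma>" "d (Inl g) (Inl h) < e" for h
  proof -
    have "Inl h \<in> MS.mball (Inl g) e" using that assms by (auto simp: MS.in_mball)
    then have "Inl h \<in> Inl ` {g}" using W e that by blast
    then show ?thesis by auto
  qed
  then show ?thesis using e by blast
qed

section \<open>Sequences with an attracting and a repelling point\<close>

lemma three_points:
  "\<exists>z1 z2 z3. z1 \<in> M \<and> z2 \<in> M \<and> z3 \<in> M \<and> z1 \<noteq> z2 \<and> z1 \<noteq> z3 \<and> z2 \<noteq> z3"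
proof -
  let ?L = "limit_set G T boundary_action"
  have "\<exists>A\<subseteq>?L. card A = 3 \<and> finite A"
    using non_elem unfolding non_elementary_def
    by (metis infinite_arbitrarily_large obtain_subset_with_card_n)
  then obtain A where "A \<subseteq> ?L" "card A = 3" by blast
  moreover have "?L \<subseteq> M" by (auto simp: limit_set_def)
  moreover from \<open>card A = 3\<close> obtain z1 z2 z3 where "A = {z1, z2, z3}" "z1 \<noteq> z2" "z1 \<noteq> z3" "z2 \<noteq> z3"
    unfolding card_3_iff by auto
  ultimately have "z1 \<in> M" "z2 \<in> M" "z3 \<in> M" by blast+
  then show ?thesis using \<open>z1 \<noteq> z2\<close> \<open>z1 \<noteq> z3\<close> \<open>z2 \<noteq> z3\<close> by blast
qed

text \<open>Locally uniform convergence on the complement of the repelling point \<open>y\<close>,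
  in uniform form and on the whole of \<Gamma> together with its boundary. Using the same
  \<open>e\<close> for the ball removed around \<open>y\<close> and for the target ball around
  \<open>x\<close> makes the condition symmetric under inversion.\<close>

definition conv :: "(nat \<Rightarrow> 'a \<Rightarrow> 'a) \<Rightarrow> 'a bdry_point \<Rightarrow> 'a bdry_point \<Rightarrow> bool" where
  "conv \<gamma> x y \<longleftrightarrow> range \<gamma> \<subseteq> \<Gamma> \<and> x \<in> M \<and> y \<in> M \<and>
     (\<forall>e>0. \<forall>\<^sub>F n in sequentially. \<forall>u\<in>E. e \<le> d u (Inr y) \<longrightarrow> d (shift (\<gamma> n) u) (Inr x) < e)"

lemma convD: "conv \<gamma> x y \<Longrightarrow> \<gamma> n \<in> \<Gamma>" "conv \<gamma> x y \<Longrightarrow> x \<in> M" "conv \<gamma> x y \<Longrightarrow> y \<in> M"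
  "conv \<gamma> x y \<Longrightarrow> e > 0 \<Longrightarrow> \<forall>\<^sub>F n in sequentially. \<forall>u\<in>E. e \<le> d u (Inr y) \<longrightarrow> d (shift (\<gamma> n) u) (Inr x) < e"
  by (auto simp: conv_def)

text \<open>Contraposition: if the inverse left \<open>u\<close> outside the ball around
  \<open>y\<close>, then \<gamma> would carry that point, hence \<open>u\<close> itself, into the
  ball around \<open>x\<close>.\<close>

lemma conv_cinv:
  assumes "conv \<gamma> x y" shows "conv (\<lambda>n. cinv (\<gamma> n)) y x"
  unfolding conv_def
proof (intro conjI allI impI)
  fix e :: real assume "e > 0"
  from convD(4)[OF assms this]
  show "\<forall>\<^sub>F n in sequentially. \<forall>u\<in>E. e \<le> d u (Inr x) \<longrightarrow> d (shift (cinv (\<gamma> n)) u) (Inr y) < e"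
  proof (rule eventually_mono)
    fix n assume *: "\<forall>u\<in>E. e \<le> d u (Inr y) \<longrightarrow> d (shift (\<gamma> n) u) (Inr x) < e"
    show "\<forall>u\<in>E. e \<le> d u (Inr x) \<longrightarrow> d (shift (cinv (\<gamma> n)) u) (Inr y) < e"
    proof (intro ballI impI, rule ccontr)
      fix u assume "u \<in> E" "e \<le> d u (Inr x)" "\<not> d (shift (cinv (\<gamma> n)) u) (Inr y) < e"
      then show False
        using *[rule_format, of "shift (cinv (\<gamma> n)) u"] shift_in convD(1)[OF assms, of n] by auto
    qed
  qed
qed (use assms convD in auto)

lemma conv_subseq:
  assumes "conv \<gamma> x y" "strict_mono \<phi>" shows "conv (\<lambda>n. \<gamma> (\<phi> n)) x y"
  using assms unfolding conv_def by (auto simp: image_subset_iff intro: eventually_subseq)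

lemma conv_lim:
  assumes "conv \<gamma> x y" "u \<in> E" "u \<noteq> Inr y" "e > 0"
  shows "\<forall>\<^sub>F n in sequentially. d (shift (\<gamma> n) u) (Inr x) < e"
proof -
  have "d u (Inr y) > 0" using d_pos[OF assms(2) InrI[OF convD(3)[OF assms(1)]] assms(3)] .
  then have "0 < min e (d u (Inr y))" using assms by auto
  from convD(4)[OF assms(1) this] show ?thesis
    by (rule eventually_mono) (use assms(2) in force)
qed

lemma conv_lim_group:
  assumes "conv \<gamma> x y" "e > 0"
  shows "\<forall>\<^sub>F n in sequentially. d (Inl (\<gamma> n)) (Inr x) < e"
  using conv_lim[OF assms(1) _ _ assms(2), of "Inl id"] by (simp add: InlI)

text \<open>Left translation moves the attracting point and keeps the repelling one; this allows
  coinciding limits to be separated later.\<close>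

lemma conv_mult_left:
  assumes "conv \<gamma> x y" "f \<in> \<Gamma>"
  shows "conv (\<lambda>n. f \<circ> \<gamma> n) (boundary_action f x) y"
  unfolding conv_def
proof (intro conjI allI impI)
  fix e :: real assume e: "e > 0"
  have x: "Inr x \<in> E" using convD[OF assms(1)] by auto
  obtain r where r: "r > 0" "\<And>v. v \<in> E \<Longrightarrow> d (Inr x) v < r \<Longrightarrow> d (shift f (Inr x)) (shift f v) < e"
    using shift_continuous[OF assms(2) x e] by blast
  have "0 < min e r" using e r by auto
  from convD(4)[OF assms(1) this]
  show "\<forall>\<^sub>F n in sequentially. \<forall>u\<in>E. e \<le> d u (Inr y) \<longrightarrow> d (shift (f \<circ> \<gamma> n) u) (Inr (boundary_action f x)) < e"
  proof (rule eventually_mono, intro ballI impI)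
    fix n u assume *: "\<forall>u\<in>E. min e r \<le> d u (Inr y) \<longrightarrow> d (shift (\<gamma> n) u) (Inr x) < min e r"
      and u: "u \<in> E" "e \<le> d u (Inr y)"
    then have "d (Inr x) (shift (\<gamma> n) u) < r" by (force simp: MS.commute)
    then have "d (shift f (Inr x)) (shift f (shift (\<gamma> n) u)) < e"
      using r(2) shift_in[OF convD(1)[OF assms(1)] u(1)] by blast
    then show "d (shift (f \<circ> \<gamma> n) u) (Inr (boundary_action f x)) < e"
      by (simp add: MS.commute shift_comp)
  qed
qed (use assms convD in auto)

lemma lim_unique:
  assumes "u \<in> E" "v \<in> E" and "\<And>n. w n \<in> E"
    and "\<And>e. e > 0 \<Longrightarrow> \<forall>\<^sub>F n in sequentially. d (w n) u < e"
    and "\<And>e. e > 0 \<Longrightarrow> \<forall>\<^sub>F n in sequentially. d (w n) v < e"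
  shows "u = v"
proof (rule ccontr)
  assume "u \<noteq> v"
  then have pos: "d u v / 2 > 0" using d_pos assms by auto
  obtain n where "d (w n) u < d u v / 2" "d (w n) v < d u v / 2"
    using eventually_happens[OF eventually_conj[OF assms(4,5)[OF pos]]] by auto
  then show False using MS.triangle'[of u "w n" v] assms MS.commute by (smt (verit) field_sum_of_halves)
qed

lemma no_group_limit:
  fixes \<beta> :: "nat \<Rightarrow> 'a \<Rightarrow> 'a"
  assumes "inj \<beta>" "range \<beta> \<subseteq> \<Gamma>" "g \<in> \<Gamma>"
  shows "\<exists>e>0. \<not> (\<forall>\<^sub>F n in sequentially. d (Inl (\<beta> n)) (Inl g) < e)"
proof -
  obtain e where e: "e > 0" "\<And>h. h \<in> \<Gamma> \<Longrightarrow> d (Inl g) (Inl h) < e \<Longrightarrow> h = g"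
    using group_isolated[OF assms(3)] by blast
  have False if "\<forall>\<^sub>F n in sequentially. d (Inl (\<beta> n)) (Inl g) < e"
  proof -
    have "\<forall>\<^sub>F n in sequentially. \<beta> n = g"
      using that by (rule eventually_mono) (use e assms(2) MS.commute in \<open>simp add: image_subset_iff\<close>)
    then obtain N where "\<And>n. n \<ge> N \<Longrightarrow> \<beta> n = g" by (auto simp: eventually_sequentially)
    then have "\<beta> N = \<beta> (Suc N)" by simp
    then show False using assms(1) by (simp add: inj_eq)
  qed
  then show ?thesis using e by blast
qed

text \<open>The convergence property of the action on \<Gamma> together with the boundary gives
  limits that might a priori be group elements. Discreteness of \<Gamma> excludes this, because each
  such limit would be approached by a sequence of distinct group elements.\<close>

lemma conv_exists_inj:
  fixes \<gamma> :: "nat \<Rightarrow> 'a \<Rightarrow> 'a"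
  assumes "inj \<gamma>" "range \<gamma> \<subseteq> \<Gamma>"
  shows "\<exists>\<phi> x y. strict_mono \<phi> \<and> conv (\<lambda>n. \<gamma> (\<phi> n)) x y"
proof -
  obtain x' y' \<phi> where x': "x' \<in> E" and y': "y' \<in> E" and \<phi>: "strict_mono (\<phi> :: nat \<Rightarrow> nat)"
    and loc: "loc_unif_to_const MS.mtopology (\<lambda>j. shift (\<gamma> (\<phi> j))) (E - {y'}) x'"
  proof -
    have *: "\<forall>\<gamma>::nat \<Rightarrow> 'a \<Rightarrow> 'a. range \<gamma> \<subseteq> \<Gamma> \<and> inj \<gamma> \<longrightarrow> (\<exists>x\<in>E. \<exists>y\<in>E. \<exists>\<phi>::nat \<Rightarrow> nat. strict_mono \<phi> \<and>
        loc_unif_to_const MS.mtopology (\<lambda>j. shift (\<gamma> (\<phi> j))) (E - {y}) x)"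
      using conv_act unfolding convergence_action_def MS.topspace_mtopology G_simps by (elim conjE)
    have "range \<gamma> \<subseteq> \<Gamma> \<and> inj \<gamma>" using assms by blast
    from *[THEN spec, THEN mp, OF this] show thesis
      by (elim bexE exE conjE) (rule that)
  qed
  have compact: "compact_space MS.mtopology"
    using conv_act by (simp add: convergence_action_def)
  \<comment> \<open>The complement of the \<open>e\<close>-ball around \<open>y'\<close> is compact,
    so finitely many of the open sets from local uniformity cover it.\<close>
  have unif: "\<forall>\<^sub>F n in sequentially. \<forall>u\<in>E. e \<le> d u y' \<longrightarrow> d (shift (\<gamma> (\<phi> n)) u) x' < e" if e: "e > 0" for e
  proof -
    define K where "K = {u \<in> E. e \<le> d u y'}"
    have "K = topspace MS.mtopology - MS.mball y' e"
      using y' by (auto simp: K_def MS.commute simp del: Plus_eq_empty_conv)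
    then have "closedin MS.mtopology K"
      by (metis MS.openin_mball openin_closedin_eq closedin_diff closedin_topspace)
    then have K: "compactin MS.mtopology K"
      using compact by (rule closedin_compact_space[rotated])
    define \<U> where "\<U> = {W. openin MS.mtopology W \<and>
        (\<forall>\<^sub>F n in sequentially. shift (\<gamma> (\<phi> n)) ` (W \<inter> (E - {y'})) \<subseteq> MS.mball x' e)}"
    have "z \<in> \<Union>\<U>" if z: "z \<in> K" for z
    proof -
      have "z \<noteq> y'"
      proof
        assume "z = y'"
        then have "d z y' = 0" using y' by simp
        then show False using z e by (simp add: K_def)
      qed
      then have "z \<in> E - {y'}" using z by (simp add: K_def)
      from loc[unfolded loc_unif_to_const_def, THEN bspec, OF this]
      obtain V where V: "openin (subtopology MS.mtopology (E - {y'})) V" "z \<in> V"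
        "\<forall>U. openin MS.mtopology U \<and> x' \<in> U \<longrightarrow> (\<forall>\<^sub>F n in sequentially. shift (\<gamma> (\<phi> n)) ` V \<subseteq> U)"
        by (elim exE conjE)
      obtain W where W: "openin MS.mtopology W" "V = W \<inter> (E - {y'})"
        using V(1) by (auto simp: openin_subtopology)
      have "\<forall>\<^sub>F n in sequentially. shift (\<gamma> (\<phi> n)) ` (W \<inter> (E - {y'})) \<subseteq> MS.mball x' e"
        using V(3)[rule_format, of "MS.mball x' e"] e x' unfolding W(2) by simp
      then have "W \<in> \<U>" using W(1) by (simp add: \<U>_def)
      then show ?thesis using V(2) W(2) by blast
    qed
    then have "K \<subseteq> \<Union>\<U>" by blast
    moreover have "\<forall>U\<in>\<U>. openin MS.mtopology U" by (simp add: \<U>_def)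
    ultimately obtain \<F> where \<F>: "finite \<F>" "\<F> \<subseteq> \<U>" "K \<subseteq> \<Union>\<F>"
      using K unfolding compactin_def by meson
    have "\<forall>\<^sub>F n in sequentially. \<forall>W\<in>\<F>. shift (\<gamma> (\<phi> n)) ` (W \<inter> (E - {y'})) \<subseteq> MS.mball x' e"
      using \<F>(2) by (intro eventually_ball_finite[OF \<F>(1)]) (auto simp: \<U>_def)
    then show ?thesis
    proof (rule eventually_mono, intro ballI impI)
      fix n u assume *: "\<forall>W\<in>\<F>. shift (\<gamma> (\<phi> n)) ` (W \<inter> (E - {y'})) \<subseteq> MS.mball x' e"
        and u: "u \<in> E" "e \<le> d u y'"
      then have "u \<in> K" by (simp add: K_def)
      then obtain W where W: "W \<in> \<F>" "u \<in> W" using \<F>(3) by blast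
      have "u \<noteq> y'"
      proof
        assume "u = y'"
        then have "d u y' = 0" using y' by simp
        then show False using u e by simp
      qed
      then have "u \<in> W \<inter> (E - {y'})" using u W by simp
      then have "shift (\<gamma> (\<phi> n)) u \<in> MS.mball x' e" using * W(1) by blast
      then show "d (shift (\<gamma> (\<phi> n)) u) x' < e" by (simp add: MS.commute)
    qed
  qed
  have inj\<phi>: "inj (\<lambda>n. \<gamma> (\<phi> n))"
    using inj_compose[OF assms(1) strict_mono_imp_inj_on[OF \<phi>]] by (simp add: comp_def)
  \<comment> \<open>For a group element \<open>h\<close> other than \<open>y'\<close>, the distinct
    elements \<open>\<gamma> (\<phi> n) \<circ> h\<close> would converge to
    \<open>g\<close>.\<close>
  have "False" if g: "x' = Inl g" for g
  proof -
    obtain h where h: "h \<in> \<Gamma>" "Inl h \<noteq> y'"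
    proof (cases "y' = Inl id")
      case True
      have "\<gamma> 0 \<noteq> \<gamma> 1" using assms(1) by (simp add: inj_eq)
      then obtain k where "\<gamma> k \<noteq> id" by metis
      then show ?thesis using that[of "\<gamma> k"] True assms(2) by auto
    qed (use that[of id] in auto)
    have pos: "d (Inl h) y' > 0" using d_pos h y' by (simp add: InlI)
    have 1: "inj (\<lambda>n. \<gamma> (\<phi> n) \<circ> h)"
    proof (rule injI)
      fix m n assume "\<gamma> (\<phi> m) \<circ> h = \<gamma> (\<phi> n) \<circ> h"
      then have "\<gamma> (\<phi> m) = \<gamma> (\<phi> n)"
        by (metis h(1) cinv_comp(1) comp_assoc comp_id)
      then show "m = n" using injD[OF inj\<phi>] by blast
    qed
    have "\<forall>\<^sub>F n in sequentially. d (Inl (\<gamma> (\<phi> n) \<circ> h)) (Inl g) < e" if "e > 0" for e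
    proof -
      have "min e (d (Inl h) y') > 0" using pos that by simp
      from unif[OF this] show ?thesis
        by (rule eventually_mono) (use h g in \<open>force simp: InlI\<close>)
    qed
    then show False
      using no_group_limit[OF 1, of g] h assms(2) x' g by (auto simp: image_subset_iff)
  qed
  then obtain x where x: "x' = Inr x" "x \<in> M" using x' by auto
  \<comment> \<open>The inverses would converge to \<open>g\<close>: if one stayed away from
    \<open>y'\<close>, its image under \<gamma>, which is \<open>id\<close>, would be closer to
    \<open>x'\<close> than it is.\<close>
  have "False" if g: "y' = Inl g" for g
  proof -
    have 1: "inj (\<lambda>n. cinv (\<gamma> (\<phi> n)))"
    proof (rule injI)
      fix m n assume "cinv (\<gamma> (\<phi> m)) = cinv (\<gamma> (\<phi> n))"
      then have "\<gamma> (\<phi> m) = \<gamma> (\<phi> n)"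
        using cinv_cinv[of "\<gamma> (\<phi> m)"] cinv_cinv[of "\<gamma> (\<phi> n)"] assms(2)
        by (metis rangeI subsetD)
      then show "m = n" using injD[OF inj\<phi>] by blast
    qed
    have pos: "d (Inl id) x' > 0" using d_pos x x' by (auto simp: InlI)
    have "\<forall>\<^sub>F n in sequentially. d (Inl (cinv (\<gamma> (\<phi> n)))) (Inl g) < e" if "e > 0" for e
    proof -
      have "min e (d (Inl id) x') > 0" using pos that by simp
      from unif[OF this] show ?thesis
      proof (rule eventually_mono)
        fix n assume *: "\<forall>u\<in>E. min e (d (Inl id) x') \<le> d u y' \<longrightarrow> d (shift (\<gamma> (\<phi> n)) u) x' < min e (d (Inl id) x')"
        have \<gamma>: "\<gamma> (\<phi> n) \<in> \<Gamma>" using assms(2) by auto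
        show "d (Inl (cinv (\<gamma> (\<phi> n)))) (Inl g) < e"
        proof (rule ccontr)
          assume "\<not> ?thesis"
          then have "min e (d (Inl id) x') \<le> d (Inl (cinv (\<gamma> (\<phi> n)))) y'" using g by simp
          then show False
            using *[rule_format, of "Inl (cinv (\<gamma> (\<phi> n)))"] \<gamma> by (simp add: InlI)
        qed
      qed
    qed
    then show False
      using no_group_limit[OF 1, of g] assms(2) y' g by (auto simp: image_subset_iff)
  qed
  then obtain y where y: "y' = Inr y" "y \<in> M" using y' by auto
  have "conv (\<lambda>n. \<gamma> (\<phi> n)) x y"
    unfolding conv_def using unif x y assms(2) by (auto simp: image_subset_iff)
  then show ?thesis using \<phi> by blast
qed

text \<open>Unbounded displacement permits a subsequence with strictly increasing displacement,
  whose elements are therefore distinct.\<close>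

lemma conv_exists:
  assumes "range \<gamma> \<subseteq> \<Gamma>" and lim: "filterlim (\<lambda>n. dist b (\<gamma> n b)) at_top sequentially"
  shows "\<exists>\<phi> x y. strict_mono \<phi> \<and> inj (\<lambda>n. \<gamma> (\<phi> n)) \<and> conv (\<lambda>n. \<gamma> (\<phi> n)) x y"
proof -
  have "\<exists>\<phi>. \<forall>n::nat. True \<and> (\<phi> n < \<phi> (Suc n) \<and> dist b (\<gamma> (\<phi> n) b) < dist b (\<gamma> (\<phi> (Suc n)) b))"
  proof (rule dependent_nat_choice)
    fix k n :: nat
    have "\<forall>\<^sub>F m in sequentially. dist b (\<gamma> k b) < dist b (\<gamma> m b)"
      using lim by (simp add: filterlim_at_top_dense)
    then obtain N where "\<And>m. m \<ge> N \<Longrightarrow> dist b (\<gamma> k b) < dist b (\<gamma> m b)"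
      by (auto simp: eventually_sequentially)
    then show "\<exists>m. True \<and> (k < m \<and> dist b (\<gamma> k b) < dist b (\<gamma> m b))"
      by (intro exI[of _ "max N (Suc k)"]) auto
  qed auto
  then obtain \<phi> :: "nat \<Rightarrow> nat" where \<phi>: "\<And>n. \<phi> n < \<phi> (Suc n)"
    "\<And>n. dist b (\<gamma> (\<phi> n) b) < dist b (\<gamma> (\<phi> (Suc n)) b)" by blast
  have mono: "strict_mono \<phi>" using \<phi>(1) by (simp add: strict_mono_Suc_iff)
  have "strict_mono (\<lambda>n. dist b (\<gamma> (\<phi> n) b))" using \<phi>(2) by (simp add: strict_mono_Suc_iff)
  then have "inj (\<lambda>n. dist b (\<gamma> (\<phi> n) b))" by (rule strict_mono_imp_inj_on)
  then have inj: "inj (\<lambda>n. \<gamma> (\<phi> n))" by (auto simp: inj_def)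
  have "range (\<lambda>n. \<gamma> (\<phi> n)) \<subseteq> \<Gamma>" using assms(1) by auto
  from conv_exists_inj[OF inj this]
  obtain \<psi> x y where \<psi>: "strict_mono \<psi>" "conv (\<lambda>n. \<gamma> (\<phi> (\<psi> n))) x y"
    by blast
  moreover have "inj (\<lambda>n. \<gamma> (\<phi> (\<psi> n)))"
    using inj_compose[OF inj strict_mono_imp_inj_on[OF \<psi>(1)]] by (simp add: comp_def)
  ultimately show ?thesis using mono by (intro exI[of _ "\<phi> \<circ> \<psi>"]) (auto simp: strict_mono_o)
qed

section \<open>Comparison of the compatible metric with Gromov products\<close>

lemma conv_near_action:
  assumes "conv \<gamma> x y" "z \<in> M" "z \<noteq> y"
  shows "\<forall>\<^sub>F n in sequentially. near b R (Inr x) (Inr (boundary_action (\<gamma> n) z))"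
proof -
  obtain e where e: "e > 0" "\<And>\<eta>. \<eta> \<in> M \<Longrightarrow> d (Inr x) (Inr \<eta>) < e \<Longrightarrow> near b R (Inr x) (Inr \<eta>)"
    using d_imp_near[OF convD(2)[OF assms(1)]] by metis
  have "\<forall>\<^sub>F n in sequentially. d (shift (\<gamma> n) (Inr z)) (Inr x) < e"
    by (rule conv_lim[OF assms(1)]) (use assms e in \<open>simp_all add: InrI\<close>)
  then show ?thesis
    by (rule eventually_mono) (use e convD(1)[OF assms(1)] assms(2) in \<open>simp add: MS.commute\<close>)
qed

text \<open>
  Two points \<open>z \<noteq> z'\<close> other than \<open>y\<close> are both sent towards \<open>x\<close>, while \<open>\<gamma> n b\<close> stays at bounded
  distance from a geodesic joining their images.
\<close>

lemma conv_near:
  assumes "conv \<gamma> x y"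
  shows "\<forall>\<^sub>F n in sequentially. near b R (Inr x) (Inl (\<gamma> n b))"
proof -
  obtain z z' where z: "z \<in> M" "z \<noteq> y" and z': "z' \<in> M" "z' \<noteq> y" and zz: "z \<noteq> z'"
    using three_points by metis
  obtain r0 where r0: "\<not> near b r0 (Inr z) (Inr z')" using boundary_eqI[OF z(1) z'(1)] zz by blast
  obtain s t where s: "s \<in> z" and t: "t \<in> z'" using boundary_nonempty z z' by meson
  \<comment> \<open>By \<open>nearI\<close>, products of the chosen representatives that were
    eventually larger than r0 + 2\<delta> would put \<open>z\<close> and \<open>z'\<close> near each
    other at level \<open>r0\<close>.\<close>
  have small: "\<exists>m\<ge>N. \<exists>n\<ge>N. gromov_product b (s m) (t n) \<le> r0 + 2 * \<delta>" for N
  proof (rule ccontr)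
    assume "\<not> ?thesis"
    then have "\<forall>m\<ge>N. \<forall>n\<ge>N. r0 + 2 * \<delta> < gromov_product b (s m) (t n)"
      by (meson not_le)
    then have "near b (r0 + 2 * \<delta> - 2 * \<delta>) (Inr z) (Inr z')"
      by (intro nearI[where s=s and t=t and N=N]) (use s t z z' in \<open>simp_all add: InrI\<close>)
    then show False using r0 by simp
  qed
  define c where "c = max 0 (r0 + 2 * \<delta>)"
  have key: "near b (R - (c + 5 * \<delta>)) (Inr x) (Inl (g b))"
    if g: "g \<in> \<Gamma>" and n1: "near b R (Inr x) (Inr (boundary_action g z))"
      and n2: "near b R (Inr x) (Inr (boundary_action g z'))" for g R
  proof -
    have x: "Inr x \<in> UNIV <+> M" using convD(2)[OF assms] by (rule InrI)
    have gz: "Inr (boundary_action g z) \<in> UNIV <+> M" "Inr (boundary_action g z') \<in> UNIV <+> M"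
      using g z z' by (simp_all add: InrI)
    have gs: "g \<circ> s \<in> bordification_reps (Inr (boundary_action g z))"
      and gt: "g \<circ> t \<in> bordification_reps (Inr (boundary_action g z'))"
      using s t by (auto simp: boundary_action_def)
    have "near b (R - \<delta>) (Inr (boundary_action g z)) (Inr (boundary_action g z'))"
      using near_trans[OF near_sym[OF n1] n2 x] .
    from nearD[OF this gs gt] obtain N1 where
      N1: "\<And>m n. m \<ge> N1 \<Longrightarrow> n \<ge> N1 \<Longrightarrow> R - \<delta> < gromov_product b (g (s m)) (g (t n))" by auto
    have "near b R (Inr (boundary_action g z')) (Inr (boundary_action g z'))"
      by (rule near_self) (use g z' in simp)
    from nearD[OF this gt gt] obtain N2 where
      N2: "\<And>m n. m \<ge> N2 \<Longrightarrow> n \<ge> N2 \<Longrightarrow> R < gromov_product b (g (t m)) (g (t n))" by auto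
    obtain m n where mn: "m \<ge> max N1 N2" "n \<ge> max N1 N2" "gromov_product b (s m) (t n) \<le> r0 + 2 * \<delta>"
      using small by blast
    have "gromov_product (g b) (g (s m)) (g (t n)) \<le> c"
      using mn isometry_gromov_product[OF iso[OF g]] by (simp add: c_def)
    \<comment> \<open>Here \<open>gromov_product_add\<close> is used with \<open>g b\<close> in the
      role of the point close to the geodesic from \<open>g (s m)\<close> to
      \<open>g (t n)\<close>.\<close>
    then have *: "R - \<delta> - c < gromov_product b (g (t n)) (g b)"
      using gromov_product_add[of b "g (s m)" "g b" "g (t n)"] N1[of m n] mn
        gromov_product_le_dist[of b "g (s m)" "g b"] by simp
    have "R - \<delta> - c - \<delta> < gromov_product b (g (t n')) (g b)" if "n' \<ge> N2" for n'
    proof (rule hyperbolicD[OF _ *])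
      have "c \<ge> 0" by (simp add: c_def)
      then show "R - \<delta> - c < gromov_product b (g (t n')) (g (t n))"
        using N2[OF that, of n] mn delta_nonneg by simp
    qed
    then have "near b (R - \<delta> - c - \<delta> - 2 * \<delta>) (Inr (boundary_action g z')) (Inl (g b))"
      by (intro nearI[where s="g \<circ> t" and t="\<lambda>_. g b" and N=N2]) (use gt gz in auto)
    moreover have "near b (R - \<delta> - c - \<delta> - 2 * \<delta>) (Inr x) (Inr (boundary_action g z'))"
      using n2 by (rule near_mono) (use delta_nonneg in \<open>simp add: c_def\<close>)
    \<comment> \<open>The total loss c + 5\<delta> consists of \<open>c\<close> for the distance to
      the geodesic, \<delta> for each of two passages between boundary points, \<delta> for the
      change of index in \<open>t\<close>, and 2\<delta> for the independence of
      representatives.\<close>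
    ultimately have "near b (R - \<delta> - c - \<delta> - 2 * \<delta> - \<delta>) (Inr x) (Inl (g b))"
      by (intro near_trans[OF _ _ gz(2)])
    then show ?thesis by (rule near_mono) simp
  qed
  from eventually_conj[OF conv_near_action[OF assms z, of "R + (c + 5 * \<delta>)"]
      conv_near_action[OF assms z', of "R + (c + 5 * \<delta>)"]]
  show ?thesis
  proof (rule eventually_mono)
    fix n
    assume *: "near b (R + (c + 5 * \<delta>)) (Inr x) (Inr (boundary_action (\<gamma> n) z)) \<and>
         near b (R + (c + 5 * \<delta>)) (Inr x) (Inr (boundary_action (\<gamma> n) z'))"
    show "near b R (Inr x) (Inl (\<gamma> n b))"
      using key[OF convD(1)[OF assms], of "R + (c + 5 * \<delta>)" n] * by simp
  qed
qed

lemma near_boundary_dist: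
  assumes "\<xi> \<in> M" "near b R (Inr \<xi>) (Inl p)" shows "R < dist b p"
  using near_dist_bound[OF assms(2)] boundary_nonempty[OF assms(1)] by auto

lemma conv_unique:
  assumes "conv \<gamma> x y" "\<xi> \<in> M" "\<And>R. \<forall>\<^sub>F n in sequentially. near b R (Inr \<xi>) (Inl (\<gamma> n b))"
  shows "x = \<xi>"
proof (rule boundary_eqI)
  show "near b r (Inr x) (Inr \<xi>)" for r
  proof -
    from eventually_conj[OF conv_near[OF assms(1), of "r + \<delta>"] assms(3)[of "r + \<delta>"]]
    obtain n where n: "near b (r + \<delta>) (Inr x) (Inl (\<gamma> n b))" "near b (r + \<delta>) (Inr \<xi>) (Inl (\<gamma> n b))"
      using eventually_happens by force
    show ?thesis using near_trans[OF n(1) near_sym[OF n(2)]] by (simp add: InlI)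
  qed
qed (use assms convD in auto)

lemma eventually_near_mono:
  assumes "\<And>n. near b (real n) (Inr (\<xi> n)) (Inl (p n))"
  shows "\<forall>\<^sub>F n in sequentially. near b R (Inr (\<xi> n)) (Inl (p n))"
  unfolding eventually_sequentially
proof (intro exI allI impI)
  fix n assume "nat \<lceil>R\<rceil> \<le> n"
  then show "near b R (Inr (\<xi> n)) (Inl (p n))"
    using assms[of n] by (auto intro: near_mono)
qed

lemma filterlim_dist_orbit:
  assumes "\<And>n. real n \<le> dist b (\<gamma> n b)"
  shows "filterlim (\<lambda>n. dist b (\<gamma> n b)) at_top sequentially"
  by (rule filterlim_at_top_mono[OF filterlim_real_sequentially]) (use assms in auto)

lemma orbit_near_boundary:
  assumes "\<xi> \<in> M" shows "\<exists>h\<in>\<Gamma>. near b R (Inr \<xi>) (Inl (h b))"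
proof -
  obtain s where s: "s \<in> \<xi>" using boundary_nonempty[OF assms] by blast
  obtain n where n: "near b (R + D) (Inr \<xi>) (Inl (s n))" using near_rep[OF assms s] by blast
  obtain h where h: "h \<in> \<Gamma>" "dist (s n) (h b) \<le> D" using orbit_dense by blast
  have "near b R (Inr \<xi>) (Inl (h b))"
    by (rule near_mono[OF near_lipschitz[OF n]]) (use h in simp)
  then show ?thesis using h by blast
qed

text \<open>Every boundary point is attracting for some sequence: orbit points approach \<xi> by
  \<open>orbit_dense\<close>, and a convergent subsequence of the corresponding elements can only be
  attracted to \<xi>.\<close>

lemma conv_to_exists:
  assumes "\<xi> \<in> M" shows "\<exists>\<gamma> y. conv \<gamma> \<xi> y"
proof -
  have "\<forall>n::nat. \<exists>h\<in>\<Gamma>. near b (real n) (Inr \<xi>) (Inl (h b))"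
    using orbit_near_boundary[OF assms] by blast
  then obtain h where h: "\<And>n. h n \<in> \<Gamma>" "\<And>n::nat. near b (real n) (Inr \<xi>) (Inl (h n b))" by metis
  have "filterlim (\<lambda>n. dist b (h n b)) at_top sequentially"
    by (rule filterlim_dist_orbit) (use near_boundary_dist[OF assms h(2)] in \<open>simp add: less_imp_le\<close>)
  then obtain \<phi> x y where \<phi>: "strict_mono \<phi>" "conv (\<lambda>n. h (\<phi> n)) x y"
    using conv_exists[of h] h(1) by blast
  have "x = \<xi>"
    using conv_unique[OF \<phi>(2) assms] eventually_subseq[OF \<phi>(1) eventually_near_mono[of "\<lambda>_. \<xi>", OF h(2)]]
    by blast
  then show ?thesis using \<phi> by blast
qed

text \<open>Counterexamples at levels tending to infinity have a convergent subsequence whose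
  attracting point is \<xi>; group elements tend in \<open>d\<close> to the attracting point of
  their sequence, a contradiction.\<close>

lemma near_orbit_imp_d:
  assumes "\<xi> \<in> M" "e > 0"
  shows "\<exists>R. \<forall>h\<in>\<Gamma>. near b R (Inr \<xi>) (Inl (h b)) \<longrightarrow> d (Inl h) (Inr \<xi>) < e"
proof (rule ccontr)
  assume "\<not> ?thesis"
  then have "\<forall>n::nat. \<exists>h\<in>\<Gamma>. near b (real n) (Inr \<xi>) (Inl (h b)) \<and> \<not> d (Inl h) (Inr \<xi>) < e" by blast
  then obtain h where h: "\<And>n. h n \<in> \<Gamma>" "\<And>n::nat. near b (real n) (Inr \<xi>) (Inl (h n b))"
    "\<And>n. \<not> d (Inl (h n)) (Inr \<xi>) < e" by metis
  have "filterlim (\<lambda>n. dist b (h n b)) at_top sequentially"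
    by (rule filterlim_dist_orbit) (use near_boundary_dist[OF assms(1) h(2)] in \<open>simp add: less_imp_le\<close>)
  then obtain \<phi> x y where \<phi>: "strict_mono \<phi>" "conv (\<lambda>n. h (\<phi> n)) x y"
    using conv_exists[of h] h(1) by blast
  have "x = \<xi>"
    using conv_unique[OF \<phi>(2) assms(1)] eventually_subseq[OF \<phi>(1) eventually_near_mono[of "\<lambda>_. \<xi>", OF h(2)]]
    by blast
  then have "\<forall>\<^sub>F n in sequentially. d (Inl (h (\<phi> n))) (Inr \<xi>) < e"
    using conv_lim_group[OF \<phi>(2) assms(2)] by simp
  then show False using h(3) by simp
qed

text \<open>Counterexamples with displacement at least \<open>n\<close> and
  \<open>d\<close>-distance below 1/(n+1) have subsequences with a common attracting point, and two
  orbit points near the same boundary point have a large product. The bound \<rho> is essential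
  already for \<open>g = h\<close>, where the product is just the displacement.\<close>

lemma close_group_imp_near:
  "\<exists>e>0. \<exists>\<rho>. \<forall>g\<in>\<Gamma>. \<forall>h\<in>\<Gamma>. \<rho> \<le> dist b (g b) \<longrightarrow> \<rho> \<le> dist b (h b) \<longrightarrow> d (Inl g) (Inl h) < e \<longrightarrow>
     R < gromov_product b (g b) (h b)"
proof (rule ccontr)
  assume neg: "\<not> ?thesis"
  have "\<forall>n::nat. \<exists>g\<in>\<Gamma>. \<exists>h\<in>\<Gamma>. real n \<le> dist b (g b) \<and> real n \<le> dist b (h b) \<and>
      d (Inl g) (Inl h) < 1 / (real n + 1) \<and> \<not> R < gromov_product b (g b) (h b)"
  proof
    fix n :: nat
    have "1 / (real n + 1) > 0" by simp
    with neg show "\<exists>g\<in>\<Gamma>. \<exists>h\<in>\<Gamma>. real n \<le> dist b (g b) \<and> real n \<le> dist b (h b) \<and>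
      d (Inl g) (Inl h) < 1 / (real n + 1) \<and> \<not> R < gromov_product b (g b) (h b)" by blast
  qed
  then obtain g h where gh: "\<And>n. g n \<in> \<Gamma>" "\<And>n. h n \<in> \<Gamma>" "\<And>n::nat. real n \<le> dist b (g n b)"
    "\<And>n::nat. real n \<le> dist b (h n b)" "\<And>n::nat. d (Inl (g n)) (Inl (h n)) < 1 / (real n + 1)"
    "\<And>n. \<not> R < gromov_product b (g n b) (h n b)" by metis
  obtain \<phi> x y where \<phi>: "strict_mono \<phi>" "conv (\<lambda>n. g (\<phi> n)) x y"
    using conv_exists[of g] gh(1) filterlim_dist_orbit[of g, OF gh(3)] by blast
  have "filterlim (\<lambda>n. dist b (h (\<phi> n) b)) at_top sequentially"
    using filterlim_compose[OF filterlim_dist_orbit[of h, OF gh(4)] filterlim_subseq[OF \<phi>(1)]] .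
  then obtain \<psi> x' y' where \<psi>: "strict_mono \<psi>" "conv (\<lambda>n. h (\<phi> (\<psi> n))) x' y'"
    using conv_exists[of "\<lambda>n. h (\<phi> n)"] gh(2) by blast
  have g': "conv (\<lambda>n. g (\<phi> (\<psi> n))) x y" using conv_subseq[OF \<phi>(2) \<psi>(1)] .
  have "(\<lambda>n. 1 / (real n + 1)) \<longlonglongrightarrow> 0"
    using LIMSEQ_inverse_real_of_nat by (simp add: inverse_eq_divide add.commute)
  then have small: "\<forall>\<^sub>F n in sequentially. 1 / (real (\<phi> (\<psi> n)) + 1) < e" if "e > 0" for e
    using eventually_subseq[OF strict_mono_o[OF \<phi>(1) \<psi>(1)], of "\<lambda>n. 1 / (real n + 1) < e"] that
      order_tendstoD(2)[of _ 0 sequentially e] by auto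
  have "(Inr x :: ('a \<Rightarrow> 'a) + 'a bdry_point) = Inr x'"
  proof (rule lim_unique[where w="\<lambda>n. Inl (h (\<phi> (\<psi> n)))"])
    fix e :: real assume e: "e > 0"
    then have "e / 2 > 0" by simp
    from eventually_conj[OF conv_lim_group[OF g' this] small[OF this]]
    show "\<forall>\<^sub>F n in sequentially. d (Inl (h (\<phi> (\<psi> n)))) (Inr x) < e"
    proof (rule eventually_mono)
      fix n assume "d (Inl (g (\<phi> (\<psi> n)))) (Inr x) < e / 2 \<and> 1 / (real (\<phi> (\<psi> n)) + 1) < e / 2"
      then show "d (Inl (h (\<phi> (\<psi> n)))) (Inr x) < e"
        using MS.triangle''[of "Inl (h (\<phi> (\<psi> n)))" "Inl (g (\<phi> (\<psi> n)))" "Inr x"] gh(1,2) gh(5)[of "\<phi> (\<psi> n)"]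
          convD(2)[OF g'] by (simp add: InlI InrI MS.commute)
    qed
    show "\<forall>\<^sub>F n in sequentially. d (Inl (h (\<phi> (\<psi> n)))) (Inr x') < e"
      using conv_lim_group[OF \<psi>(2) e] .
  qed (use convD(2)[OF g'] convD(2)[OF \<psi>(2)] gh(2) in \<open>simp_all add: InlI InrI\<close>)
  then have "x = x'" by simp
  then obtain n where n: "near b (R + \<delta>) (Inr x) (Inl (g (\<phi> (\<psi> n)) b))" "near b (R + \<delta>) (Inr x) (Inl (h (\<phi> (\<psi> n)) b))"
    using eventually_happens[OF eventually_conj[OF conv_near[OF g'] conv_near[OF \<psi>(2)]]] by force
  have "near b (R + \<delta> - \<delta>) (Inl (g (\<phi> (\<psi> n)) b)) (Inl (h (\<phi> (\<psi> n)) b))"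
    using near_trans[OF near_sym[OF n(1)] n(2)] convD(2)[OF g'] by (simp add: InrI)
  then show False using gh(6) by simp
qed

text \<open>For a sequence in \<open>conv\<close>, the elements tend to the attracting point and
  their inverses to the repelling point. The limits can thus be replaced by \<open>h\<close> and
  \<open>cinv h\<close>, which makes the contraction uniform over all elements of large
  displacement; each replacement uses up e/2.\<close>

lemma contract_uniform:
  assumes "e > 0"
  shows "\<exists>\<rho>. \<forall>h\<in>\<Gamma>. \<rho> \<le> dist b (h b) \<longrightarrow> (\<forall>u\<in>E. e \<le> d u (Inl (cinv h)) \<longrightarrow> d (shift h u) (Inl h) < e)"
proof (rule ccontr)
  assume "\<not> ?thesis"
  then have "\<forall>n::nat. \<exists>h\<in>\<Gamma>. real n \<le> dist b (h b) \<and> (\<exists>u\<in>E. e \<le> d u (Inl (cinv h)) \<and> \<not> d (shift h u) (Inl h) < e)"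
    by meson
  then obtain h u where h: "\<And>n. h n \<in> \<Gamma>" "\<And>n::nat. real n \<le> dist b (h n b)" "\<And>n. u n \<in> E"
    "\<And>n. e \<le> d (u n) (Inl (cinv (h n)))" "\<And>n. \<not> d (shift (h n) (u n)) (Inl (h n)) < e" by metis
  obtain \<phi> x y where \<phi>: "strict_mono \<phi>" "conv (\<lambda>n. h (\<phi> n)) x y"
    using conv_exists[of h] h(1) filterlim_dist_orbit[of h, OF h(2)] by blast
  have e2: "e / 2 > 0" using assms by simp
  obtain n where n: "d (Inl (h (\<phi> n))) (Inr x) < e / 2" "d (Inl (cinv (h (\<phi> n)))) (Inr y) < e / 2"
    "\<forall>u\<in>E. e / 2 \<le> d u (Inr y) \<longrightarrow> d (shift (h (\<phi> n)) u) (Inr x) < e / 2"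
    using eventually_happens[OF eventually_conj[OF conv_lim_group[OF \<phi>(2) e2]
      eventually_conj[OF conv_lim_group[OF conv_cinv[OF \<phi>(2)] e2] convD(4)[OF \<phi>(2) e2]]]] by force
  have xy: "Inr x \<in> E" "Inr y \<in> E" using convD(2,3)[OF \<phi>(2)] by (simp_all add: InrI)
  have hn: "Inl (h (\<phi> n)) \<in> E" "Inl (cinv (h (\<phi> n))) \<in> E" using h(1) by (simp_all add: InlI)
  have "e / 2 \<le> d (u (\<phi> n)) (Inr y)"
    using MS.triangle''[OF h(3) hn(2) xy(2), of "\<phi> n"] h(4)[of "\<phi> n"] n(2)
      MS.triangle[OF h(3) xy(2) hn(2), of "\<phi> n"] MS.commute[of "Inr y"] by simp
  then have "d (shift (h (\<phi> n)) (u (\<phi> n))) (Inr x) < e / 2" using n(3) h(3) by blast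
  then have "d (shift (h (\<phi> n)) (u (\<phi> n))) (Inl (h (\<phi> n))) < e"
    using MS.triangle[OF shift_in[OF h(1) h(3)] xy(1) hn(1), of "\<phi> n" "\<phi> n"] n(1)
      MS.commute[of "Inr x"] by simp
  then show False using h(5) by blast
qed

text \<open>If boundary points converged to \<open>g\<close>, then orbit points chosen ever closer
  to them would have a subsequence attracted to some boundary point \<open>x\<close>. The boundary
  points would then converge to \<open>x\<close> as well, although \<open>g\<close> is not a
  boundary point.\<close>

lemma group_away_from_boundary:
  assumes "g \<in> \<Gamma>" shows "\<exists>e>0. \<forall>x\<in>M. e < d (Inr x) (Inl g)"
proof (rule ccontr)
  assume neg: "\<not> ?thesis"
  have "\<forall>n::nat. \<exists>x\<in>M. d (Inr x) (Inl g) \<le> 1 / (real n + 1)"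
  proof
    fix n :: nat
    have "1 / (real n + 1) > 0" by simp
    with neg show "\<exists>x\<in>M. d (Inr x) (Inl g) \<le> 1 / (real n + 1)" by (meson not_le)
  qed
  then obtain \<xi> where \<xi>: "\<And>n. \<xi> n \<in> M" "\<And>n::nat. d (Inr (\<xi> n)) (Inl g) \<le> 1 / (real n + 1)" by metis
  have "\<forall>n::nat. \<exists>h\<in>\<Gamma>. near b (real n) (Inr (\<xi> n)) (Inl (h b))"
    using orbit_near_boundary[OF \<xi>(1)] by blast
  then obtain h where h: "\<And>n. h n \<in> \<Gamma>" "\<And>n::nat. near b (real n) (Inr (\<xi> n)) (Inl (h n b))" by metis
  have "filterlim (\<lambda>n. dist b (h n b)) at_top sequentially"
    by (rule filterlim_dist_orbit) (use near_boundary_dist[OF \<xi>(1) h(2)] in \<open>simp add: less_imp_le\<close>)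
  then obtain \<phi> x y where \<phi>: "strict_mono \<phi>" "conv (\<lambda>n. h (\<phi> n)) x y"
    using conv_exists[of h] h(1) by blast
  have x: "x \<in> M" using convD[OF \<phi>(2)] by simp
  have "(Inl g :: ('a \<Rightarrow> 'a) + 'a bdry_point) = Inr x"
  proof (rule lim_unique[where w="\<lambda>n. Inr (\<xi> (\<phi> n))"])
    fix e :: real assume e: "e > 0"
    have "(\<lambda>n. 1 / (real n + 1)) \<longlonglongrightarrow> 0"
      using LIMSEQ_inverse_real_of_nat by (simp add: inverse_eq_divide add.commute)
    then have "\<forall>\<^sub>F n in sequentially. 1 / (real n + 1) < e"
      using e by (rule order_tendstoD)
    then have "\<forall>\<^sub>F n in sequentially. d (Inr (\<xi> n)) (Inl g) < e"
      by (rule eventually_mono) (use \<xi>(2) le_less_trans in blast)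
    then show "\<forall>\<^sub>F n in sequentially. d (Inr (\<xi> (\<phi> n))) (Inl g) < e"
      by (rule eventually_subseq[OF \<phi>(1)])
    obtain R where R: "\<And>\<eta>. \<eta> \<in> M \<Longrightarrow> near b R (Inr x) (Inr \<eta>) \<Longrightarrow> d (Inr x) (Inr \<eta>) < e"
      using near_imp_d[OF x e] by blast
    from eventually_conj[OF conv_near[OF \<phi>(2), of "R + \<delta>"] eventually_subseq[OF \<phi>(1) eventually_near_mono[OF h(2)], of "R + \<delta>"]]
    show "\<forall>\<^sub>F n in sequentially. d (Inr (\<xi> (\<phi> n))) (Inr x) < e"
    proof (rule eventually_mono)
      fix n assume "near b (R + \<delta>) (Inr x) (Inl (h (\<phi> n) b)) \<and> near b (R + \<delta>) (Inr (\<xi> (\<phi> n))) (Inl (h (\<phi> n) b))"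
      then have "near b (R + \<delta> - \<delta>) (Inr x) (Inr (\<xi> (\<phi> n)))"
        using near_trans near_sym by (meson InlI UNIV_I)
      then show "d (Inr (\<xi> (\<phi> n))) (Inr x) < e"
        using R[OF \<xi>(1), of "\<phi> n"] MS.commute[of "Inr x"] by simp
    qed
  qed (use x \<xi>(1) assms in \<open>simp_all add: InlI InrI\<close>)
  then show False by simp
qed

section \<open>Loxodromic elements\<close>


lemma pow_in [simp]: "g \<in> \<Gamma> \<Longrightarrow> g ^^ n \<in> \<Gamma>"
proof (induction n)
  case 0
  then show ?case using id_in by (simp add: id_def)
next
  case (Suc n)
  then show ?case unfolding funpow.simps(2) by (intro comp_in)
qed

lemma pow_G: "g \<in> \<Gamma> \<Longrightarrow> g [^]\<^bsub>G\<^esub> (n::nat) = g ^^ n"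
proof (induction n)
  case 0
  then show ?case by (simp add: nat_pow_def isometry_group_def)
next
  case (Suc n)
  then show ?case
    unfolding funpow_Suc_right monoid.nat_pow_Suc[OF group.is_monoid[OF group_G]] G_simps by metis
qed

lemma cinv_pow: "g \<in> \<Gamma> \<Longrightarrow> cinv (g ^^ n) = cinv g ^^ n"
proof (induction n)
  case 0
  then show ?case by (simp add: inv_id)
next
  case (Suc n)
  have "cinv (g ^^ Suc n) = cinv (g \<circ> g ^^ n)" unfolding funpow.simps(2) ..
  also have "\<dots> = cinv g ^^ n \<circ> cinv g" using Suc cinv_mult by simp
  finally show ?case unfolding funpow_Suc_right .
qed

lemma conv_imp_loc_unif:
  assumes "conv \<gamma> x y"
  shows "loc_unif_to_const T (\<lambda>n. boundary_action (\<gamma> n)) (M - {y}) x"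
  unfolding loc_unif_to_const_def
proof
  fix z assume z: "z \<in> M - {y}"
  have xy: "x \<in> M" "y \<in> M" using convD[OF assms] by simp_all
  define c where "c = d (Inr z) (Inr y) / 2"
  have c: "c > 0" using z d_pos xy by (simp add: c_def InrI)
  define V where "V = {w \<in> M. d (Inr z) (Inr w) < c}"
  have V: "openin T V" using boundary_ball_open z by (simp add: V_def)
  have far: "c \<le> d (Inr w) (Inr y)" if "w \<in> V" for w
    using MS.triangle[of "Inr z" "Inr w" "Inr y"] z xy that by (simp add: V_def c_def InrI)
  have "y \<notin> V" using far[of y] c xy by (auto simp: InrI)
  then have "V = V \<inter> (M - {y})" by (auto simp: V_def)
  then have 1: "openin (subtopology T (M - {y})) V" using V unfolding openin_subtopology by blast
  have 2: "z \<in> V" using z c by (simp add: V_def InrI)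
  have 3: "\<forall>\<^sub>F n in sequentially. boundary_action (\<gamma> n) ` V \<subseteq> U" if U: "openin T U" "x \<in> U" for U
  proof -
    obtain e where e: "e > 0" "\<And>\<eta>. \<eta> \<in> M \<Longrightarrow> d (Inr x) (Inr \<eta>) < e \<Longrightarrow> \<eta> \<in> U"
      using boundary_open_d[OF U] by metis
    have "min c e > 0" using c e by simp
    from convD(4)[OF assms this] show ?thesis
    proof (rule eventually_mono)
      fix n assume *: "\<forall>u\<in>E. min c e \<le> d u (Inr y) \<longrightarrow> d (shift (\<gamma> n) u) (Inr x) < min c e"
      have "boundary_action (\<gamma> n) w \<in> U" if w: "w \<in> V" for w
      proof -
        have "w \<in> M" using w by (simp add: V_def)
        then have "d (Inr (boundary_action (\<gamma> n) w)) (Inr x) < e"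
          using *[rule_format, of "Inr w"] far[OF w] by (simp add: InrI)
        then show ?thesis using e(2) convD(1)[OF assms] \<open>w \<in> M\<close> MS.commute[of "Inr x"] by simp
      qed
      then show "boundary_action (\<gamma> n) ` V \<subseteq> U" by blast
    qed
  qed
  show "\<exists>V. openin (subtopology T (M - {y})) V \<and> z \<in> V \<and>
     (\<forall>U. openin T U \<and> x \<in> U \<longrightarrow> (\<forall>\<^sub>F n in sequentially. boundary_action (\<gamma> n) ` V \<subseteq> U))"
    using 1 2 3 by blast
qed

text \<open>Loxodromic dynamics on \<Gamma> together with the boundary; restricting the convergence
  to the boundary gives \<open>loxodromic\<close>.\<close>

definition north_south :: "('a \<Rightarrow> 'a) \<Rightarrow> 'a bdry_point \<Rightarrow> 'a bdry_point \<Rightarrow> bool" where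
  "north_south g a r \<longleftrightarrow> g \<in> \<Gamma> \<and> conv (\<lambda>n. g ^^ n) a r \<and> a \<noteq> r \<and>
     boundary_action g a = a \<and> boundary_action g r = r"

lemma north_south_loxodromic:
  assumes "north_south g a r" shows "loxodromic G T boundary_action g a r"
proof -
  have g: "g \<in> \<Gamma>" and c: "conv (\<lambda>n. g ^^ n) a r" using assms by (auto simp: north_south_def)
  have c': "conv (\<lambda>n. cinv g ^^ n) r a" using conv_cinv[OF c] by (simp add: cinv_pow g)
  have ar: "a \<in> M" "r \<in> M" using convD[OF c] by auto
  have "range (\<lambda>n. g ^^ n) \<subseteq> carrier G" "range (\<lambda>n. cinv g ^^ n) \<subseteq> carrier G" using g by auto
  then have lim: "a \<in> limit_set G T boundary_action" "r \<in> limit_set G T boundary_action"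
    using conv_imp_loc_unif[OF c] conv_imp_loc_unif[OF c'] ar
    unfolding limit_set_def topspace_boundary by blast+
  have "inv\<^bsub>G\<^esub> g \<in> \<Gamma>" using g by (simp add: inv_G)
  then show ?thesis
    unfolding loxodromic_def
    using assms g lim conv_imp_loc_unif[OF c] conv_imp_loc_unif[OF c'] pow_G[of g] pow_G[of "cinv g"]
    by (simp add: north_south_def inv_G)
qed

lemma conv_of_subseqs:
  assumes \<gamma>: "range \<gamma> \<subseteq> \<Gamma>" and xy: "x \<in> M" "y \<in> M"
    and sub: "\<And>\<phi>::nat \<Rightarrow> nat. strict_mono \<phi> \<Longrightarrow> \<exists>\<psi>. strict_mono \<psi> \<and> conv (\<lambda>n. \<gamma> (\<phi> (\<psi> n))) x y"
  shows "conv \<gamma> x y"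
  unfolding conv_def
proof (intro conjI allI impI \<gamma> xy)
  fix e :: real assume e: "e > 0"
  let ?P = "\<lambda>g. \<forall>u\<in>E. e \<le> d u (Inr y) \<longrightarrow> d (shift g u) (Inr x) < e"
  show "\<forall>\<^sub>F n in sequentially. ?P (\<gamma> n)"
  proof (rule ccontr)
    assume "\<not> (\<forall>\<^sub>F n in sequentially. ?P (\<gamma> n))"
    then have "infinite {n. \<not> ?P (\<gamma> n)}"
      unfolding cofinite_eq_sequentially[symmetric] eventually_cofinite .
    then obtain \<phi> :: "nat \<Rightarrow> nat" where \<phi>: "strict_mono \<phi>" "\<And>n. \<phi> n \<in> {n. \<not> ?P (\<gamma> n)}"
      using infinite_enumerate by blast
    obtain \<psi> where "conv (\<lambda>n. \<gamma> (\<phi> (\<psi> n))) x y" using sub[OF \<phi>(1)] by blast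
    from eventually_happens[OF convD(4)[OF this e]] obtain n where "?P (\<gamma> (\<phi> (\<psi> n)))" by force
    then show False using \<phi>(2)[of "\<psi> n"] by blast
  qed
qed

lemma conv_lim_boundary:
  assumes "conv \<gamma> x y" "c \<in> M" "c \<noteq> y" "e > 0"
  shows "\<forall>\<^sub>F n in sequentially. d (Inr (boundary_action (\<gamma> n) c)) (Inr x) < e"
  using conv_lim[OF assms(1), of "Inr c"] assms by (simp add: InrI)

lemma boundary_lim_unique:
  assumes "x \<in> M" "y \<in> M" and "\<And>n. w n \<in> M"
    and "\<And>e. e > 0 \<Longrightarrow> \<forall>\<^sub>F n in sequentially. d (Inr (w n)) (Inr x) < e"
    and "\<And>e. e > 0 \<Longrightarrow> \<forall>\<^sub>F n in sequentially. d (Inr (w n)) (Inr y) < e"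
  shows "x = y"
  using lim_unique[of "Inr x" "Inr y" "\<lambda>n. Inr (w n)"] assms by (simp add: InrI)

lemma conv_fixed:
  assumes "conv \<gamma> x y" "c \<in> M" "c \<noteq> y" "\<And>n. boundary_action (\<gamma> n) c = c"
  shows "c = x"
proof (rule boundary_lim_unique[where w="\<lambda>_. c"])
  show "\<forall>\<^sub>F n in sequentially. d (Inr c) (Inr x) < e" if "e > 0" for e
    using conv_lim_boundary[OF assms(1-3) that] assms(4) by simp
qed (use assms convD in \<open>simp_all add: InrI\<close>)

lemma fixed_pow: "boundary_action g c = c \<Longrightarrow> boundary_action (g ^^ n) c = c"
  by (induction n) (simp_all add: boundary_action_comp[symmetric] flip: id_def)

text \<open>Since \<open>g\<close> commutes with its powers, one sequence has two descriptions: as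
  \<open>g\<close> applied to powers acting on \<open>a\<close> it tends to the image of
  \<open>a\<close>, and as powers acting on the image of \<open>a\<close> it tends to
  \<open>a\<close>. The two inequalities keep the test points away from \<open>r\<close>.\<close>

lemma pow_limit_fixed:
  assumes "conv (\<lambda>n. g ^^ \<phi> n) a r" "g \<in> \<Gamma>" "a \<noteq> r" "boundary_action g a \<noteq> r"
  shows "boundary_action g a = a"
proof (rule boundary_lim_unique[where w="\<lambda>n. boundary_action (g \<circ> g ^^ \<phi> n) a"])
  have a: "a \<in> M" using convD[OF assms(1)] by simp
  show "boundary_action g a \<in> M" "a \<in> M" "\<And>n. boundary_action (g \<circ> g ^^ \<phi> n) a \<in> M"
    using a assms by simp_all
  show "\<forall>\<^sub>F n in sequentially. d (Inr (boundary_action (g \<circ> g ^^ \<phi> n) a)) (Inr (boundary_action g a)) < e"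
    if "e > 0" for e
    using conv_lim_boundary[OF conv_mult_left[OF assms(1,2)] a assms(3) that] .
  show "\<forall>\<^sub>F n in sequentially. d (Inr (boundary_action (g \<circ> g ^^ \<phi> n) a)) (Inr a) < e"
    if "e > 0" for e
  proof -
    have "boundary_action (g \<circ> g ^^ \<phi> n) a = boundary_action (g ^^ \<phi> n) (boundary_action g a)" for n
      by (metis boundary_action_comp funpow.simps(2) funpow_Suc_right)
    then show ?thesis
      using conv_lim_boundary[OF assms(1) _ assms(4) that] a assms(2) by simp
  qed
qed

text \<open>Two test points are needed because one of them may be the repelling point, where
  convergence gives no information.\<close>

lemma conv_limit_ball:
  assumes "conv \<beta> a r" "x \<in> M" "u \<in> E" "v \<in> E" "u \<noteq> v"
    and uv: "\<forall>\<^sub>F n in sequentially. d (shift (\<beta> n) u) (Inr x) < e \<and> d (shift (\<beta> n) v) (Inr x) < e"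
  shows "d (Inr a) (Inr x) \<le> e"
proof -
  obtain w where w: "w \<in> E" "w \<noteq> Inr r" "w = u \<or> w = v" using assms by metis
  have ev: "\<forall>\<^sub>F n in sequentially. d (shift (\<beta> n) w) (Inr x) < e"
    using uv by (rule eventually_mono) (use w in blast)
  show ?thesis
  proof (rule field_le_epsilon)
    fix \<epsilon> :: real assume \<epsilon>: "\<epsilon> > 0"
    obtain n where n: "d (shift (\<beta> n) w) (Inr x) < e" "d (shift (\<beta> n) w) (Inr a) < \<epsilon>"
      using eventually_happens[OF eventually_conj[OF ev conv_lim[OF assms(1) w(1,2) \<epsilon>]]] by force
    then show "d (Inr a) (Inr x) \<le> e + \<epsilon>"
      using MS.triangle''[of "Inr a" "shift (\<beta> n) w" "Inr x"] shift_in[OF convD(1)[OF assms(1)] w(1)]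
        convD(2)[OF assms(1)] assms(2) by (simp add: InrI)
  qed
qed

text \<open>One element sending the outside of a ball around \<open>y\<close> into a disjoint ball
  around \<open>x\<close> has powers that do the same. Their attracting and repelling limits lie in
  the closed balls and are fixed by the element, and being fixed they do not depend on the
  subsequence. The witness \<open>z\<close> outside both balls shows that the element has infinite
  order and supplies test points.\<close>

lemma ping_pong_north_south:
  assumes g: "g \<in> \<Gamma>" and xy: "x \<in> M" "y \<in> M" and sep: "2 * e < d (Inr x) (Inr y)"
    and H: "\<And>u. u \<in> E \<Longrightarrow> e \<le> d u (Inr y) \<Longrightarrow> d (shift g u) (Inr x) < e"
    and z: "z \<in> E" "e \<le> d z (Inr x)" "e \<le> d z (Inr y)"
  shows "\<exists>a r. north_south g a r \<and> d (Inr a) (Inr x) \<le> e \<and> d (Inr r) (Inr y) \<le> e"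
proof -
  have xyE: "Inr x \<in> E" "Inr y \<in> E" using xy by (simp_all add: InrI)
  have disj: "e < d u (Inr y)" if "u \<in> E" "d u (Inr x) \<le> e" for u
    using MS.triangle''[OF xyE(1) that(1) xyE(2)] that(2) sep by linarith
  have pw: "d (shift (g ^^ n) u) (Inr x) < e" if "u \<in> E" "e \<le> d u (Inr y)" "1 \<le> n" for n u
    using that(3)
  proof (induction n rule: dec_induct)
    case base
    have "g ^^ 1 = g" by (simp add: fun_eq_iff)
    show ?case unfolding \<open>g ^^ 1 = g\<close> by (rule H[OF that(1,2)])
  next
    case (step n)
    have "shift (g ^^ n) u \<in> E" using shift_in[OF pow_in[OF g] that(1)] .
    from H[OF this less_imp_le[OF disj[OF this less_imp_le[OF step.IH]]]]
    have "d (shift g (shift (g ^^ n) u)) (Inr x) < e" .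
    then show ?case unfolding shift_comp funpow.simps(2) .
  qed
  have pw': "d (shift (cinv (g ^^ n)) u) (Inr y) < e" if u: "u \<in> E" "e \<le> d u (Inr x)" "1 \<le> n" for n u
  proof (rule ccontr)
    assume "\<not> ?thesis"
    then have "d (shift (g ^^ n) (shift (cinv (g ^^ n)) u)) (Inr x) < e"
      using pw[OF shift_in[OF cinv_in[OF pow_in[OF g]] u(1)] _ u(3)] by simp
    then show False using u g by simp
  qed
  \<comment> \<open>A coincidence of powers would make a positive power the identity, yet positive
    powers move \<open>z\<close> into the ball around \<open>x\<close>.\<close>
  have inj: "inj (\<lambda>n. g ^^ n)"
  proof -
    have "g ^^ m \<noteq> g ^^ n" if "m < n" for m n
    proof
      assume eq: "g ^^ m = g ^^ n"
      have "g ^^ n = g ^^ m \<circ> g ^^ (n - m)" using that by (metis funpow_add le_add_diff_inverse less_imp_le)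
      then have "g ^^ (n - m) = id"
        using eq g by (metis cinv_comp(2) comp_assoc comp_id id_comp pow_in)
      then have "d (shift id z) (Inr x) < e"
        using pw[OF z(1,3), of "n - m"] that by simp
      then show False using z by simp
    qed
    then show ?thesis by (metis injI linorder_neq_iff)
  qed
  have balls: "d (Inr a) (Inr x) \<le> e \<and> d (Inr r) (Inr y) \<le> e"
    if c: "conv (\<lambda>n. g ^^ \<phi> n) a r" and \<phi>: "strict_mono \<phi>" for a r \<phi>
  proof
    have ev: "\<forall>\<^sub>F n in sequentially. 1 \<le> \<phi> n"
      using eventually_subseq[OF \<phi>, of "\<lambda>n. 1 \<le> n"] eventually_ge_at_top by blast
    have gz: "shift g z \<in> E" "d (shift g z) (Inr x) < e" using shift_in g z H by auto
    have gz': "shift (cinv g) z \<in> E" "d (shift (cinv g) z) (Inr y) < e"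
      using shift_in g z pw'[of z 1] by auto
    have far: "e \<le> d (shift g z) (Inr y)" using disj[OF gz(1)] gz(2) by simp
    have "\<not> d (shift (cinv g) z) (Inr x) \<le> e" using disj[OF gz'(1)] gz'(2) by auto
    then have far': "e \<le> d (shift (cinv g) z) (Inr x)" by simp
    show "d (Inr a) (Inr x) \<le> e"
    proof (rule conv_limit_ball[OF c xy(1) z(1) gz(1)])
      show "z \<noteq> shift g z" using gz(2) z(2) by auto
      show "\<forall>\<^sub>F n in sequentially. d (shift (g ^^ \<phi> n) z) (Inr x) < e \<and> d (shift (g ^^ \<phi> n) (shift g z)) (Inr x) < e"
        using ev by (rule eventually_mono) (use pw[OF z(1,3)] pw[OF gz(1) far] in blast)
    qed
    show "d (Inr r) (Inr y) \<le> e"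
    proof (rule conv_limit_ball[OF conv_cinv[OF c] xy(2) z(1) gz'(1)])
      show "z \<noteq> shift (cinv g) z" using gz'(2) z(3) by auto
      show "\<forall>\<^sub>F n in sequentially. d (shift (cinv (g ^^ \<phi> n)) z) (Inr y) < e \<and>
           d (shift (cinv (g ^^ \<phi> n)) (shift (cinv g) z)) (Inr y) < e"
        using ev by (rule eventually_mono) (use pw'[OF z(1,2)] pw'[OF gz'(1) far'] in blast)
    qed
  qed
  \<comment> \<open>As \<open>a\<close> lies outside the ball around \<open>y\<close>, its image
    lies in the ball around \<open>x\<close> and so differs from \<open>r\<close>; the same holds
    for \<open>r\<close> under the inverse. This is what \<open>pow_limit_fixed\<close> asks
    for.\<close>
  have fixed: "a \<in> M \<and> r \<in> M \<and> a \<noteq> r \<and> boundary_action g a = a \<and> boundary_action g r = r"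
    if c: "conv (\<lambda>n. g ^^ \<phi> n) a r" and \<phi>: "strict_mono \<phi>" for a r \<phi>
  proof -
    have aM: "a \<in> M" "r \<in> M" using convD[OF c] by simp_all
    then have aE: "Inr a \<in> E" "Inr r \<in> E" by (simp_all add: InrI)
    have ab: "d (Inr a) (Inr x) \<le> e" "d (Inr r) (Inr y) \<le> e" using balls[OF c \<phi>] by simp_all
    have far: "e < d (Inr a) (Inr y)" using disj[OF aE(1) ab(1)] .
    have far': "e < d (Inr r) (Inr x)" using disj[OF aE(2)] ab(2) by linarith
    have ne: "a \<noteq> r" using far ab by auto
    have 1: "boundary_action g a = a"
    proof (rule pow_limit_fixed[OF c g ne])
      have "d (shift g (Inr a)) (Inr x) < e" using H[OF aE(1)] far by simp
      then show "boundary_action g a \<noteq> r" using far' by auto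
    qed
    have c': "conv (\<lambda>n. cinv g ^^ \<phi> n) r a" using conv_cinv[OF c] by (simp add: cinv_pow g)
    have "boundary_action (cinv g) r = r"
    proof (rule pow_limit_fixed[OF c' cinv_in[OF g] ne[symmetric]])
      have "d (shift (cinv g) (Inr r)) (Inr y) < e" using pw'[OF aE(2), of 1] far' by simp
      then show "boundary_action (cinv g) r \<noteq> a" using far by auto
    qed
    then have 2: "boundary_action g r = r" using action_cancel(1)[OF g, of r] by simp
    show ?thesis using aM ne 1 2 by blast
  qed
  obtain \<phi> a r where \<phi>: "strict_mono \<phi>" and c: "conv (\<lambda>n. g ^^ \<phi> n) a r"
  proof -
    have "range (\<lambda>n. g ^^ n) \<subseteq> \<Gamma>" using pow_in[OF g] by blast
    from conv_exists_inj[OF inj this] that show thesis by blast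
  qed
  have ar: "a \<in> M" "r \<in> M" "a \<noteq> r" "boundary_action g a = a" "boundary_action g r = r"
    using fixed[OF c \<phi>] by simp_all
  \<comment> \<open>A convergent subsequence has limits \<open>a'\<close> and \<open>r'\<close> in
    the same disjoint balls. The fixed point \<open>a\<close> differs from \<open>r'\<close> and
    must equal \<open>a'\<close>; inverses then give \<open>r = r'\<close>.\<close>
  have "conv (\<lambda>n. g ^^ n) a r"
  proof (rule conv_of_subseqs)
    fix \<phi>' :: "nat \<Rightarrow> nat" assume \<phi>': "strict_mono \<phi>'"
    have "inj (\<lambda>n. g ^^ \<phi>' n)"
      using inj_compose[OF inj strict_mono_imp_inj_on[OF \<phi>']] by (simp add: comp_def)
    then obtain \<psi> a' r' where \<psi>: "strict_mono \<psi>" and c': "conv (\<lambda>n. g ^^ \<phi>' (\<psi> n)) a' r'"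
    proof -
      have "range (\<lambda>n. g ^^ \<phi>' n) \<subseteq> \<Gamma>" using pow_in[OF g] by blast
      from conv_exists_inj[OF \<open>inj (\<lambda>n. g ^^ \<phi>' n)\<close> this] that show thesis by blast
    qed
    have mono: "strict_mono (\<lambda>n. \<phi>' (\<psi> n))" using strict_mono_o[OF \<phi>' \<psi>] by (simp add: comp_def)
    have b: "d (Inr a) (Inr x) \<le> e" "d (Inr r) (Inr y) \<le> e" using balls[OF c \<phi>] by simp_all
    have b': "d (Inr a') (Inr x) \<le> e" "d (Inr r') (Inr y) \<le> e" using balls[OF c' mono] by simp_all
    have "a \<noteq> r'" using disj[of "Inr a"] ar b b' by (auto simp: InrI)
    then have "a = a'" using conv_fixed[OF c' ar(1)] fixed_pow[OF ar(4)] by blast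
    have r: "boundary_action (cinv g) r = r" using action_cancel(2)[OF g, of r] ar(5) by simp
    have "r \<noteq> a'" using ar(3) \<open>a = a'\<close> by simp
    then have "r = r'"
      using conv_fixed[OF conv_cinv[OF c'] ar(2)] fixed_pow[OF r] g by (simp add: cinv_pow)
    then show "\<exists>\<psi>. strict_mono \<psi> \<and> conv (\<lambda>n. g ^^ \<phi>' (\<psi> n)) a r"
      using \<psi> c' \<open>a = a'\<close> by blast
  qed (use g ar in auto)
  then have "north_south g a r" using g ar by (simp add: north_south_def)
  then show ?thesis using balls[OF c \<phi>] by blast
qed

lemma conv_north_south:
  assumes "conv \<gamma> x y" "x \<noteq> y" "e > 0"
  shows "\<forall>\<^sub>F n in sequentially. \<exists>a r. north_south (\<gamma> n) a r \<and> d (Inr a) (Inr x) \<le> e \<and> d (Inr r) (Inr y) \<le> e"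
proof -
  have xy: "x \<in> M" "y \<in> M" using convD[OF assms(1)] by simp_all
  obtain z where z: "z \<in> M" "z \<noteq> x" "z \<noteq> y" using three_points by metis
  \<comment> \<open>A third of the distance makes the balls around \<open>x\<close> and
    \<open>y\<close> disjoint, and the last two entries leave \<open>z\<close> outside both.\<close>
  define e' where "e' = Min {e, d (Inr x) (Inr y) / 3, d (Inr z) (Inr x), d (Inr z) (Inr y)}"
  have pos: "0 < d (Inr x) (Inr y)" "0 < d (Inr z) (Inr x)" "0 < d (Inr z) (Inr y)"
    using d_pos xy z assms(2) by (simp_all add: InrI)
  have e': "0 < e'" "e' \<le> e" "2 * e' < d (Inr x) (Inr y)" "e' \<le> d (Inr z) (Inr x)" "e' \<le> d (Inr z) (Inr y)"
    using pos assms(3) by (auto simp: e'_def min_def)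
  from convD(4)[OF assms(1) e'(1)] show ?thesis
  proof (rule eventually_mono)
    fix n assume "\<forall>u\<in>E. e' \<le> d u (Inr y) \<longrightarrow> d (shift (\<gamma> n) u) (Inr x) < e'"
    then have "\<exists>a r. north_south (\<gamma> n) a r \<and> d (Inr a) (Inr x) \<le> e' \<and> d (Inr r) (Inr y) \<le> e'"
      using z e' by (intro ping_pong_north_south[where z="Inr z", OF convD(1)[OF assms(1)] xy e'(3)]) (auto simp: InrI)
    then show "\<exists>a r. north_south (\<gamma> n) a r \<and> d (Inr a) (Inr x) \<le> e \<and> d (Inr r) (Inr y) \<le> e"
      using e'(2) by (meson order_trans)
  qed
qed

end

section \<open>Expanding coarse-cocycles\<close>

lemma finite_uniform_bound:
  fixes Q :: "'b \<Rightarrow> real \<Rightarrow> bool"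
  assumes "finite S" "\<And>f. f \<in> S \<Longrightarrow> \<exists>B. Q f B" "\<And>f B B'. Q f B \<Longrightarrow> B \<le> B' \<Longrightarrow> Q f B'"
  shows "\<exists>B. \<forall>f\<in>S. Q f B"
  using assms(1,2)
proof (induction S rule: finite_induct)
  case (insert x S)
  then obtain B B' where "\<forall>f\<in>S. Q f B" "Q x B'" by blast
  then have "\<forall>f\<in>insert x S. Q f (max B B')" using assms(3) by (auto intro: max.cobounded1 max.cobounded2)
  then show ?case by blast
qed auto

locale expanding_action = hyperbolic_group_action b \<delta> \<Gamma> d D
  for b :: "'a::metric_space" and \<delta> \<Gamma> d D +
  fixes \<sigma> :: "('a \<Rightarrow> 'a) \<Rightarrow> 'a bdry_point \<Rightarrow> real" and N :: "('a \<Rightarrow> 'a) \<Rightarrow> real" and \<kappa> :: real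
  assumes kappa_nonneg: "0 \<le> \<kappa>"
    and sigma_cocycle: "coarse_cocycle_with \<kappa> (isometry_subgroup \<Gamma>) (gromov_boundary_topology b) boundary_action \<sigma>"
    and sigma_proper: "proper_cocycle (isometry_subgroup \<Gamma>) (gromov_boundary_topology b) boundary_action d \<sigma>"
    and magnitude: "\<epsilon> > 0 \<Longrightarrow> \<exists>C. \<forall>x\<in>gromov_boundary b. \<forall>g\<in>\<Gamma>.
       \<epsilon> < d (Inr x) (Inl (inv_into UNIV g)) \<longrightarrow> \<bar>\<sigma> g x - N g\<bar> \<le> C"
begin

lemma cocycle:
  "g \<in> \<Gamma> \<Longrightarrow> h \<in> \<Gamma> \<Longrightarrow> x \<in> M \<Longrightarrow> \<bar>\<sigma> (g \<circ> h) x - (\<sigma> g (boundary_action h x) + \<sigma> h x)\<bar> \<le> \<kappa>"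
  using sigma_cocycle by (simp add: coarse_cocycle_with_def isometry_group_def)

lemma sigma_coarsely_continuous:
  assumes "g \<in> \<Gamma>" "x \<in> M"
  shows "\<exists>e>0. \<forall>x'\<in>M. d (Inr x) (Inr x') < e \<longrightarrow> \<bar>\<sigma> g x - \<sigma> g x'\<bar> < \<kappa> + 1"
proof -
  have "Limsup (nhdsin T x) (\<lambda>x'. ereal \<bar>\<sigma> g x - \<sigma> g x'\<bar>) \<le> ereal \<kappa>"
    using sigma_cocycle assms by (simp add: coarse_cocycle_with_def)
  then have "Limsup (nhdsin T x) (\<lambda>x'. ereal \<bar>\<sigma> g x - \<sigma> g x'\<bar>) < ereal (\<kappa> + 1)"
    by (rule le_less_trans) simp
  from Limsup_lessD[OF this] obtain U where "openin T U" "x \<in> U" "\<forall>x'\<in>U. \<bar>\<sigma> g x - \<sigma> g x'\<bar> < \<kappa> + 1"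
    using assms by (auto simp: eventually_nhdsin)
  then show ?thesis using boundary_open_d by meson
qed

section \<open>Bounds on the cocycle and estimates for its magnitude\<close>

lemma sigma_id: "x \<in> M \<Longrightarrow> \<bar>\<sigma> id x\<bar> \<le> \<kappa>"
  using cocycle[of id id x] by (simp add: abs_minus_commute)

text \<open>For one fixed \<open>g\<close> the point \<open>cinv g\<close> has positive distance
  from the whole boundary, so the expansion estimate holds at all boundary points at once.\<close>

lemma sigma_bounded:
  assumes "g \<in> \<Gamma>" shows "\<exists>B. \<forall>x\<in>M. \<bar>\<sigma> g x\<bar> \<le> B"
proof -
  obtain e where e: "e > 0" "\<And>x. x \<in> M \<Longrightarrow> e < d (Inr x) (Inl (cinv g))"
    using group_away_from_boundary[of "cinv g"] assms by auto
  obtain C where "\<forall>x\<in>M. \<forall>g\<in>\<Gamma>. e < d (Inr x) (Inl (cinv g)) \<longrightarrow> \<bar>\<sigma> g x - N g\<bar> \<le> C"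
    using magnitude[OF e(1)] by blast
  then have "\<bar>\<sigma> g x - N g\<bar> \<le> C" if "x \<in> M" for x using e(2) assms that by blast
  then have "\<bar>\<sigma> g x\<bar> \<le> \<bar>N g\<bar> + C" if "x \<in> M" for x using that by fastforce
  then show ?thesis by blast
qed

text \<open>Pigeonhole: three boundary points and their images under \<open>f\<close> are pairwise
  at least 3e apart, so \<open>u\<close> rules out at most one of the points and \<open>v\<close> at
  most one of the images.\<close>

lemma far_from_two:
  assumes "f \<in> \<Gamma>"
  shows "\<exists>e>0. \<forall>u\<in>E. \<forall>v\<in>E. \<exists>y\<in>M. e < d (Inr y) u \<and> e < d (Inr (boundary_action f y)) v"
proof -
  obtain z1 z2 z3 where z: "z1 \<in> M" "z2 \<in> M" "z3 \<in> M" "z1 \<noteq> z2" "z1 \<noteq> z3" "z2 \<noteq> z3"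
    using three_points by blast
  have sep: "e < d (Inr z) u \<or> e < d (Inr z') u"
    if "z \<in> M" "z' \<in> M" "u \<in> E" "0 < e" "3 * e \<le> d (Inr z) (Inr z')" for z z' u e
    using MS.triangle'[of "Inr z" u "Inr z'"] that by (simp add: InrI) linarith
  have fz: "boundary_action f z1 \<in> M" "boundary_action f z2 \<in> M" "boundary_action f z3 \<in> M"
      "boundary_action f z1 \<noteq> boundary_action f z2" "boundary_action f z1 \<noteq> boundary_action f z3"
      "boundary_action f z2 \<noteq> boundary_action f z3"
    using z assms action_inj[OF assms] by simp_all
  define S where "S = {d (Inr z1) (Inr z2), d (Inr z1) (Inr z3), d (Inr z2) (Inr z3),
    d (Inr (boundary_action f z1)) (Inr (boundary_action f z2)),
    d (Inr (boundary_action f z1)) (Inr (boundary_action f z3)),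
    d (Inr (boundary_action f z2)) (Inr (boundary_action f z3))}"
  define e where "e = Min S / 3"
  have "finite S" "S \<noteq> {}" by (simp_all add: S_def)
  moreover have "\<forall>s\<in>S. 0 < s"
    using z fz d_pos by (simp add: S_def InrI)
  ultimately have e: "e > 0" "\<And>s. s \<in> S \<Longrightarrow> 3 * e \<le> s"
    by (simp_all add: e_def)
  have "\<exists>y\<in>M. e < d (Inr y) u \<and> e < d (Inr (boundary_action f y)) v" if uv: "u \<in> E" "v \<in> E" for u v
  proof -
    have "e < d (Inr z1) u \<or> e < d (Inr z2) u" "e < d (Inr z1) u \<or> e < d (Inr z3) u" "e < d (Inr z2) u \<or> e < d (Inr z3) u"
      using sep[OF _ _ uv(1) e(1) e(2)] z unfolding S_def by blast+
    moreover have "e < d (Inr (boundary_action f z1)) v \<or> e < d (Inr (boundary_action f z2)) v"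
      "e < d (Inr (boundary_action f z1)) v \<or> e < d (Inr (boundary_action f z3)) v"
      "e < d (Inr (boundary_action f z2)) v \<or> e < d (Inr (boundary_action f z3)) v"
      using sep[OF _ _ uv(2) e(1) e(2)] fz unfolding S_def by blast+
    ultimately show ?thesis using z(1-3) by blast
  qed
  then show ?thesis using e(1) by blast
qed

text \<open>The distance of \<open>y\<close> from \<open>cinv h\<close> is retained in the
  conclusion because it lets \<open>contract_uniform\<close> place the image of \<open>y\<close>
  under \<open>h\<close> next to \<open>h\<close>.\<close>

lemma magnitude_diff:
  "\<exists>K. \<exists>e>0. \<forall>g\<in>\<Gamma>. \<forall>h\<in>\<Gamma>. \<exists>y\<in>M. e < d (Inr y) (Inl (cinv h)) \<and> \<bar>\<sigma> h y - N h\<bar> \<le> K \<and>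
     \<bar>N (g \<circ> h) - N h - \<sigma> g (boundary_action h y)\<bar> \<le> K"
proof -
  obtain e where e: "e > 0" "\<And>u v. u \<in> E \<Longrightarrow> v \<in> E \<Longrightarrow> \<exists>y\<in>M. e < d (Inr y) u \<and> e < d (Inr y) v"
    using far_from_two[OF id_in] by auto
  obtain C where C: "\<And>x g. x \<in> M \<Longrightarrow> g \<in> \<Gamma> \<Longrightarrow> e < d (Inr x) (Inl (cinv g)) \<Longrightarrow> \<bar>\<sigma> g x - N g\<bar> \<le> C"
    using magnitude[OF e(1)] by blast
  have "\<exists>y\<in>M. e < d (Inr y) (Inl (cinv h)) \<and> \<bar>\<sigma> h y - N h\<bar> \<le> \<bar>C\<bar> + \<bar>C\<bar> + \<kappa> \<and>
       \<bar>N (g \<circ> h) - N h - \<sigma> g (boundary_action h y)\<bar> \<le> \<bar>C\<bar> + \<bar>C\<bar> + \<kappa>" if g: "g \<in> \<Gamma>" and h: "h \<in> \<Gamma>" for g h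
  proof -
    obtain y where y: "y \<in> M" "e < d (Inr y) (Inl (cinv h))" "e < d (Inr y) (Inl (cinv (g \<circ> h)))"
      using e(2)[of "Inl (cinv h)" "Inl (cinv (g \<circ> h))"] g h by (auto simp: InlI)
    have "\<bar>\<sigma> h y - N h\<bar> \<le> C" "\<bar>\<sigma> (g \<circ> h) y - N (g \<circ> h)\<bar> \<le> C"
      using C y g h comp_in by blast+
    then have "\<bar>\<sigma> h y - N h\<bar> \<le> \<bar>C\<bar> + \<bar>C\<bar> + \<kappa> \<and>
       \<bar>N (g \<circ> h) - N h - \<sigma> g (boundary_action h y)\<bar> \<le> \<bar>C\<bar> + \<bar>C\<bar> + \<kappa>"
      using cocycle[OF g h y(1)] kappa_nonneg by linarith
    then show ?thesis using y by blast
  qed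
  then show ?thesis using e(1) by blast
qed

lemma magnitude_left:
  assumes "f \<in> \<Gamma>" shows "\<exists>B. \<forall>g\<in>\<Gamma>. \<bar>N (f \<circ> g) - N g\<bar> \<le> B"
proof -
  obtain K where K: "\<And>g h. g \<in> \<Gamma> \<Longrightarrow> h \<in> \<Gamma> \<Longrightarrow> \<exists>y\<in>M. \<bar>N (g \<circ> h) - N h - \<sigma> g (boundary_action h y)\<bar> \<le> K"
    using magnitude_diff by metis
  obtain B where B: "\<And>x. x \<in> M \<Longrightarrow> \<bar>\<sigma> f x\<bar> \<le> B" using sigma_bounded[OF assms] by blast
  have "\<bar>N (f \<circ> g) - N g\<bar> \<le> K + B" if g: "g \<in> \<Gamma>" for g
  proof -
    obtain y where y: "y \<in> M" "\<bar>N (f \<circ> g) - N g - \<sigma> f (boundary_action g y)\<bar> \<le> K" using K[OF assms g] by blast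
    then show ?thesis using B[of "boundary_action g y"] g by simp
  qed
  then show ?thesis by blast
qed

text \<open>Now \<open>f\<close> acts first, so \<open>y\<close> must avoid the inverse of
  \<open>g \<circ> f\<close> while its image under \<open>f\<close> avoids \<open>cinv g\<close>;
  this is the purpose of the twist by \<open>f\<close> in \<open>far_from_two\<close>.\<close>

lemma magnitude_right:
  assumes "f \<in> \<Gamma>" shows "\<exists>B. \<forall>g\<in>\<Gamma>. \<bar>N (g \<circ> f) - N g\<bar> \<le> B"
proof -
  obtain e where e: "e > 0" "\<And>u v. u \<in> E \<Longrightarrow> v \<in> E \<Longrightarrow> \<exists>y\<in>M. e < d (Inr y) u \<and> e < d (Inr (boundary_action f y)) v"
    using far_from_two[OF assms] by blast
  obtain C where C: "\<And>x g. x \<in> M \<Longrightarrow> g \<in> \<Gamma> \<Longrightarrow> e < d (Inr x) (Inl (cinv g)) \<Longrightarrow> \<bar>\<sigma> g x - N g\<bar> \<le> C"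
    using magnitude[OF e(1)] by blast
  obtain B where B: "\<And>x. x \<in> M \<Longrightarrow> \<bar>\<sigma> f x\<bar> \<le> B" using sigma_bounded[OF assms] by blast
  have "\<bar>N (g \<circ> f) - N g\<bar> \<le> 2 * C + \<kappa> + B" if g: "g \<in> \<Gamma>" for g
  proof -
    obtain y where y: "y \<in> M" "e < d (Inr y) (Inl (cinv (g \<circ> f)))" "e < d (Inr (boundary_action f y)) (Inl (cinv g))"
      using e(2)[of "Inl (cinv (g \<circ> f))" "Inl (cinv g)"] g assms by (auto simp: InlI)
    have "\<bar>\<sigma> (g \<circ> f) y - N (g \<circ> f)\<bar> \<le> C" "\<bar>\<sigma> g (boundary_action f y) - N g\<bar> \<le> C"
      using C y g assms comp_in action_in by blast+
    then show ?thesis using cocycle[OF g assms y(1)] B[OF y(1)] by linarith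
  qed
  then show ?thesis by blast
qed

lemma magnitude_left_uniform: "\<exists>B. \<forall>f\<in>\<Gamma>. dist b (f b) \<le> r \<longrightarrow> (\<forall>g\<in>\<Gamma>. \<bar>N (f \<circ> g) - N g\<bar> \<le> B)"
proof -
  have "\<exists>B. \<forall>f\<in>{f\<in>\<Gamma>. dist b (f b) \<le> r}. \<forall>g\<in>\<Gamma>. \<bar>N (f \<circ> g) - N g\<bar> \<le> B"
    by (rule finite_uniform_bound[OF finite_bounded]) (use magnitude_left order_trans in \<open>blast+\<close>)
  then show ?thesis by blast
qed

lemma magnitude_right_uniform: "\<exists>B. \<forall>f\<in>\<Gamma>. dist b (f b) \<le> r \<longrightarrow> (\<forall>g\<in>\<Gamma>. \<bar>N (g \<circ> f) - N g\<bar> \<le> B)"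
proof -
  have "\<exists>B. \<forall>f\<in>{f\<in>\<Gamma>. dist b (f b) \<le> r}. \<forall>g\<in>\<Gamma>. \<bar>N (g \<circ> f) - N g\<bar> \<le> B"
    by (rule finite_uniform_bound[OF finite_bounded]) (use magnitude_right order_trans in \<open>blast+\<close>)
  then show ?thesis by blast
qed

lemma magnitude_bounded: "\<exists>B. \<forall>f\<in>\<Gamma>. dist b (f b) \<le> r \<longrightarrow> \<bar>N f\<bar> \<le> B"
proof -
  have "\<exists>B. \<forall>f\<in>{f\<in>\<Gamma>. dist b (f b) \<le> r}. \<bar>N f\<bar> \<le> B"
    by (rule finite_uniform_bound[OF finite_bounded]) (auto intro: order_trans)
  then show ?thesis by blast
qed

lemma magnitude_quasi_additive:
  "\<exists>K. \<forall>g\<in>\<Gamma>. \<forall>h\<in>\<Gamma>. gromov_product b (cinv g b) (h b) \<le> R \<longrightarrow> \<bar>N (g \<circ> h) - N g - N h\<bar> \<le> K"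
proof -
  obtain e \<rho>1 where e: "e > 0" and \<rho>1: "\<And>g h. g\<in>\<Gamma> \<Longrightarrow> h\<in>\<Gamma> \<Longrightarrow> \<rho>1 \<le> dist b (g b) \<Longrightarrow> \<rho>1 \<le> dist b (h b) \<Longrightarrow>
     d (Inl g) (Inl h) < e \<Longrightarrow> R < gromov_product b (g b) (h b)"
    using close_group_imp_near by metis
  obtain e0 where e0: "e0 > 0" "\<And>u v. u \<in> E \<Longrightarrow> v \<in> E \<Longrightarrow> \<exists>y\<in>M. e0 < d (Inr y) u \<and> e0 < d (Inr y) v"
    using far_from_two[OF id_in] by auto
  \<comment> \<open>The bound \<open>e0\<close> makes \<open>y\<close> far enough from
    \<open>cinv h\<close> to be contracted; e/2 keeps the image of \<open>y\<close> so close to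
    \<open>h\<close> that \<open>cinv g\<close>, at distance at least \<open>e\<close> from
    \<open>h\<close>, remains at distance more than e/2 from that image.\<close>
  define e' where "e' = min e0 (e / 2)"
  have e': "e' > 0" "e' \<le> e0" "e' \<le> e / 2" using e e0 by (auto simp: e'_def)
  obtain \<rho>2 where \<rho>2: "\<And>h u. h \<in> \<Gamma> \<Longrightarrow> \<rho>2 \<le> dist b (h b) \<Longrightarrow> u \<in> E \<Longrightarrow> e' \<le> d u (Inl (cinv h)) \<Longrightarrow> d (shift h u) (Inl h) < e'"
    using contract_uniform[OF e'(1)] by blast
  obtain C where C: "\<And>x g. x \<in> M \<Longrightarrow> g \<in> \<Gamma> \<Longrightarrow> e0 < d (Inr x) (Inl (cinv g)) \<Longrightarrow> \<bar>\<sigma> g x - N g\<bar> \<le> C"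
    using magnitude[OF e0(1)] by blast
  have "e / 2 > 0" using e by simp
  from magnitude[OF this]
  obtain C' where C': "\<And>x g. x \<in> M \<Longrightarrow> g \<in> \<Gamma> \<Longrightarrow> e / 2 < d (Inr x) (Inl (cinv g)) \<Longrightarrow> \<bar>\<sigma> g x - N g\<bar> \<le> C'"
    by blast
  define \<rho> where "\<rho> = max \<rho>1 \<rho>2"
  obtain B1 where B1: "\<And>f g. f \<in> \<Gamma> \<Longrightarrow> dist b (f b) \<le> \<rho> \<Longrightarrow> g \<in> \<Gamma> \<Longrightarrow> \<bar>N (f \<circ> g) - N g\<bar> \<le> B1"
    using magnitude_left_uniform by metis
  obtain B2 where B2: "\<And>f g. f \<in> \<Gamma> \<Longrightarrow> dist b (f b) \<le> \<rho> \<Longrightarrow> g \<in> \<Gamma> \<Longrightarrow> \<bar>N (g \<circ> f) - N g\<bar> \<le> B2"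
    using magnitude_right_uniform by metis
  obtain B3 where B3: "\<And>f. f \<in> \<Gamma> \<Longrightarrow> dist b (f b) \<le> \<rho> \<Longrightarrow> \<bar>N f\<bar> \<le> B3"
    using magnitude_bounded by metis
  \<comment> \<open>The constants \<open>B1\<close>, \<open>B2\<close>, \<open>B3\<close> serve the
    cases in which one factor has displacement at most \<rho>; there the uniform bounds over a
    finite set of elements suffice.\<close>
  have "\<bar>N (g \<circ> h) - N g - N h\<bar> \<le> \<bar>B1\<bar> + \<bar>B2\<bar> + \<bar>B3\<bar> + 2 * \<bar>C\<bar> + \<bar>C'\<bar> + \<kappa>"
    if g: "g \<in> \<Gamma>" and h: "h \<in> \<Gamma>" and R: "gromov_product b (cinv g b) (h b) \<le> R" for g h
  proof (cases "dist b (g b) \<le> \<rho>")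
    case True
    then show ?thesis using B1[OF g True h] B3[OF g True] kappa_nonneg by linarith
  next
    case gbig: False
    show ?thesis
    proof (cases "dist b (h b) \<le> \<rho>")
      case True
      then show ?thesis using B2[OF h True g] B3[OF h True] kappa_nonneg by linarith
    next
      case hbig: False
      obtain y where y: "y \<in> M" "e0 < d (Inr y) (Inl (cinv h))" "e0 < d (Inr y) (Inl (cinv (g \<circ> h)))"
        using e0(2)[of "Inl (cinv h)" "Inl (cinv (g \<circ> h))"] g h by (auto simp: InlI)
      have "d (shift h (Inr y)) (Inl h) < e'"
        using \<rho>2[OF h, of "Inr y"] hbig y e' by (simp add: \<rho>_def InrI)
      then have 1: "d (Inr (boundary_action h y)) (Inl h) < e / 2" using e' by simp
      have "\<not> d (Inl h) (Inl (cinv g)) < e"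
      proof
        assume "d (Inl h) (Inl (cinv g)) < e"
        then have "R < gromov_product b (h b) (cinv g b)"
          using \<rho>1[OF h cinv_in[OF g]] gbig hbig dist_cinv[OF g] by (simp add: \<rho>_def)
        then show False using R by (simp add: gromov_product_commute)
      qed
      then have "e / 2 < d (Inr (boundary_action h y)) (Inl (cinv g))"
        using MS.triangle''[of "Inl h" "Inr (boundary_action h y)" "Inl (cinv g)"] 1 g h y(1)
        by (simp add: InlI InrI)
      then have "\<bar>\<sigma> g (boundary_action h y) - N g\<bar> \<le> C'" using C' g h y(1) by simp
      moreover have "\<bar>\<sigma> h y - N h\<bar> \<le> C" "\<bar>\<sigma> (g \<circ> h) y - N (g \<circ> h)\<bar> \<le> C"
        using C y g h comp_in by blast+
      ultimately have "\<bar>N (g \<circ> h) - N g - N h\<bar> \<le> 2 * C + C' + \<kappa>"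
        using cocycle[OF g h y(1)] by linarith
      then show ?thesis by linarith
    qed
  qed
  then show ?thesis by blast
qed

text \<open>The elements are loxodromic only from some index \<open>n0\<close> on, whereas
  properness concerns sequences that are loxodromic throughout; it is applied to the shifted
  sequence and the limit transferred back.\<close>

lemma cocycle_at_attracting_point:
  assumes c: "conv \<gamma> x y" and "inj \<gamma>" "x \<noteq> y" "e > 0"
  shows "\<exists>a r. filterlim (\<lambda>n. \<sigma> (\<gamma> n) (a n)) at_top sequentially \<and>
     (\<forall>\<^sub>F n in sequentially. north_south (\<gamma> n) (a n) (r n) \<and> d (Inr (a n)) (Inr x) \<le> e \<and> d (Inr (r n)) (Inr y) \<le> e)"
proof -
  have xy: "Inr x \<in> E" "Inr y \<in> E" using convD[OF c] by (simp_all add: InrI)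
  \<comment> \<open>With \<open>e'\<close> at most a third of the distance, the fixed points stay
    \<open>e'\<close> apart, as the liminf condition in \<open>proper_cocycle\<close>
    demands.\<close>
  define e' where "e' = min e (d (Inr x) (Inr y) / 3)"
  have pos: "0 < d (Inr x) (Inr y)" using d_pos xy assms(3) by simp
  then have e': "e' > 0" "e' \<le> e" "3 * e' \<le> d (Inr x) (Inr y)" using assms(4) by (auto simp: e'_def)
  obtain n0 where n0: "\<And>n. n \<ge> n0 \<Longrightarrow> \<exists>a r. north_south (\<gamma> n) a r \<and> d (Inr a) (Inr x) \<le> e' \<and> d (Inr r) (Inr y) \<le> e'"
    using conv_north_south[OF c assms(3) e'(1)] by (auto simp: eventually_sequentially)
  then have "\<forall>n. \<exists>a r. n \<ge> n0 \<longrightarrow> north_south (\<gamma> n) a r \<and> d (Inr a) (Inr x) \<le> e' \<and> d (Inr r) (Inr y) \<le> e'"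
    by blast
  then obtain a r where ar: "\<And>n. n \<ge> n0 \<Longrightarrow> north_south (\<gamma> n) (a n) (r n) \<and> d (Inr (a n)) (Inr x) \<le> e' \<and> d (Inr (r n)) (Inr y) \<le> e'"
    by metis
  have sep: "e' \<le> d (Inr (r (n + n0))) (Inr (a (n + n0)))" for n
  proof -
    have ns: "north_south (\<gamma> (n + n0)) (a (n + n0)) (r (n + n0))" "d (Inr (a (n + n0))) (Inr x) \<le> e'"
       "d (Inr (r (n + n0))) (Inr y) \<le> e'" using ar[of "n + n0"] by simp_all
    then have in_E: "Inr (a (n + n0)) \<in> E" "Inr (r (n + n0)) \<in> E" using convD by (auto simp: north_south_def InrI)
    show ?thesis
      using MS.triangle''[OF xy(1) in_E(1) xy(2)] MS.triangle''[OF in_E(1) in_E(2) xy(2)] ns(2,3) e'(3)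
        MS.triangle[OF in_E(1) in_E(2) xy(2)] MS.commute[of "Inr (a (n + n0))"] by simp
  qed
  have "filterlim (\<lambda>n. \<sigma> (\<gamma> (n + n0)) (a (n + n0))) at_top sequentially"
  proof -
    have "inj (\<lambda>n. \<gamma> (n + n0))" using injD[OF assms(2)] by (intro injI) fastforce
    moreover have "\<forall>n. loxodromic G T boundary_action (\<gamma> (n + n0)) (a (n + n0)) (r (n + n0))"
      using ar north_south_loxodromic by simp
    moreover have "liminf (\<lambda>n. ereal (d (Inr (r (n + n0))) (Inr (a (n + n0))))) > 0"
    proof (rule less_le_trans)
      show "(0::ereal) < ereal e'" using e' by simp
      show "ereal e' \<le> liminf (\<lambda>n. ereal (d (Inr (r (n + n0))) (Inr (a (n + n0)))))"
        by (rule Liminf_bounded) (use sep in simp)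
    qed
    ultimately show ?thesis
      using sigma_proper[unfolded proper_cocycle_def, rule_format, of "\<lambda>n. \<gamma> (n + n0)" "\<lambda>n. a (n + n0)" "\<lambda>n. r (n + n0)"]
      by blast
  qed
  then have "filterlim (\<lambda>n. \<sigma> (\<gamma> n) (a n)) at_top sequentially"
    unfolding filterlim_at_top using eventually_sequentially_seg[of "\<lambda>n. _ \<le> \<sigma> (\<gamma> n) (a n)" n0] by blast
  moreover have "\<forall>\<^sub>F n in sequentially. north_south (\<gamma> n) (a n) (r n) \<and> d (Inr (a n)) (Inr x) \<le> e \<and> d (Inr (r n)) (Inr y) \<le> e"
    unfolding eventually_sequentially using ar e'(2) by (meson order_trans)
  ultimately show ?thesis by blast
qed

text \<open>At a common fixed point the coarse cocycle is additive up to \<kappa>, and the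
  contributions of \<open>k\<close> and its inverse cancel. Three uses of the cocycle relation and
  one of \<open>sigma_id\<close> give 4\<kappa>.\<close>

lemma cocycle_conjugate:
  assumes "k \<in> \<Gamma>" "g \<in> \<Gamma>" "a \<in> M" "boundary_action k a = a" "boundary_action g a = a"
  shows "\<bar>\<sigma> (k \<circ> g \<circ> cinv k) a\<bar> \<le> \<bar>\<sigma> g a\<bar> + 4 * \<kappa>"
proof -
  have k: "boundary_action (cinv k) a = a" using action_cancel(2)[OF assms(1), of a] assms(4) by simp
  show ?thesis
    using cocycle[of "k \<circ> g" "cinv k" a] cocycle[of k g a] cocycle[of k "cinv k" a] sigma_id[of a] assms k
    by simp
qed

text \<open>
  If \<open>\<Gamma>\<close> fixed \<open>a\<close>, the conjugates of any \<open>g\<close> by powers of a loxodromic \<open>k\<close> repelling from \<open>a\<close>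
  would have bounded cocycle at \<open>a\<close>, so by properness they repeat; then a power of \<open>k\<close> commutes with \<open>g\<close>
  and the other fixed point of \<open>k\<close> is fixed by \<open>g\<close> as well.
\<close>

lemma no_global_fixed_point:
  assumes "a \<in> M" shows "\<exists>f\<in>\<Gamma>. boundary_action f a \<noteq> a"
proof (rule ccontr)
  assume "\<not> ?thesis"
  then have fix_a: "\<And>f. f \<in> \<Gamma> \<Longrightarrow> boundary_action f a = a" by blast
  obtain q where q: "q \<in> M" "q \<noteq> a" using three_points by metis
  obtain \<gamma> y where \<gamma>: "conv \<gamma> q y" using conv_to_exists[OF q(1)] by blast
  \<comment> \<open>The inverse sequence is attracted to \<open>y\<close> and repelled by
    \<open>q\<close>; the fixed point \<open>a\<close> differs from \<open>q\<close>, so it is the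
    attracting point.\<close>
  have "a = y"
    using conv_fixed[OF conv_cinv[OF \<gamma>] assms q(2)[symmetric]] fix_a convD(1)[OF \<gamma>] by simp
  have pos: "d (Inr q) (Inr a) / 3 > 0" using d_pos q assms by (simp add: InrI)
  obtain n p p' where p: "north_south (\<gamma> n) p p'" "d (Inr p) (Inr q) \<le> d (Inr q) (Inr a) / 3"
    "d (Inr p') (Inr y) \<le> d (Inr q) (Inr a) / 3"
    using eventually_happens[OF conv_north_south[OF \<gamma> _ pos]] q(2) \<open>a = y\<close> by force
  define k where "k = \<gamma> n"
  have k: "k \<in> \<Gamma>" and kconv: "conv (\<lambda>n. k ^^ n) p p'" and kp: "boundary_action k p = p" and "p \<noteq> p'"
    using p(1) by (auto simp: north_south_def k_def)
  have pM: "p \<in> M" using convD[OF kconv] by simp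
  have "p \<noteq> a" using p(2) pos MS.commute[of "Inr a"] by auto
  have "p' = a"
    using conv_fixed[OF kconv assms] fix_a[OF pow_in[OF k]] \<open>p \<noteq> a\<close> by metis
  define w where "w g n = (k ^^ n) \<circ> g \<circ> cinv (k ^^ n)" for g n
  have w: "w g n \<in> \<Gamma>" if "g \<in> \<Gamma>" for g n using that k by (simp add: w_def)
  have cinv_w: "cinv (w g n) = w (cinv g) n" if "g \<in> \<Gamma>" for g n
    using that k by (simp add: w_def cinv_mult comp_assoc)
  \<comment> \<open>The attracting fixed point of \<open>w g (\<phi> n)\<close> is eventually
    \<open>a\<close> itself, since \<open>a\<close> is fixed and stays away from the repelling
    points near \<open>p\<close>. Properness makes the cocycle there unbounded, but conjugation by
    powers of \<open>k\<close> keeps it bounded.\<close>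
  have no_attract: False if g: "g \<in> \<Gamma>" and c: "conv (\<lambda>n. w g (\<phi> n)) a p" and inj: "inj (\<lambda>n. w g (\<phi> n))" for g and \<phi> :: "nat \<Rightarrow> nat"
  proof -
    have "d (Inr a) (Inr p) / 2 > 0" using d_pos \<open>p \<noteq> a\<close> pM assms by (simp add: InrI)
    from cocycle_at_attracting_point[OF c inj \<open>p \<noteq> a\<close>[symmetric] this]
    obtain s r where lim: "filterlim (\<lambda>n. \<sigma> (w g (\<phi> n)) (s n)) at_top sequentially"
      and ev: "\<forall>\<^sub>F n in sequentially. north_south (w g (\<phi> n)) (s n) (r n) \<and> d (Inr (s n)) (Inr a) \<le> d (Inr a) (Inr p) / 2 \<and>
       d (Inr (r n)) (Inr p) \<le> d (Inr a) (Inr p) / 2" by blast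
    have "\<forall>\<^sub>F n in sequentially. s n = a"
      using ev
    proof (rule eventually_mono)
      fix n assume *: "north_south (w g (\<phi> n)) (s n) (r n) \<and> d (Inr (s n)) (Inr a) \<le> d (Inr a) (Inr p) / 2 \<and>
       d (Inr (r n)) (Inr p) \<le> d (Inr a) (Inr p) / 2"
      then have "a \<noteq> r n" using \<open>d (Inr a) (Inr p) / 2 > 0\<close> by auto
      then show "s n = a"
        using * conv_fixed[of _ "s n" "r n" a] fix_a assms w[OF g] pow_in
        unfolding north_south_def by metis
    qed
    moreover have "\<forall>\<^sub>F n in sequentially. \<bar>\<sigma> g a\<bar> + 4 * \<kappa> + 1 \<le> \<sigma> (w g (\<phi> n)) (s n)"
      using lim by (simp add: filterlim_at_top)
    ultimately have "\<forall>\<^sub>F n in sequentially. \<bar>\<sigma> g a\<bar> + 4 * \<kappa> + 1 \<le> \<sigma> (w g (\<phi> n)) a"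
      by eventually_elim simp
    then obtain n where n: "\<bar>\<sigma> g a\<bar> + 4 * \<kappa> + 1 \<le> \<sigma> (w g (\<phi> n)) a"
      using eventually_happens by force
    have "\<bar>\<sigma> (w g (\<phi> n)) a\<bar> \<le> \<bar>\<sigma> g a\<bar> + 4 * \<kappa>"
      unfolding w_def using cocycle_conjugate[OF pow_in[OF k] g assms] fix_a k g by simp
    then show False using n by linarith
  qed
  have fix_p: "boundary_action g p = p" if g: "g \<in> \<Gamma>" for g
  proof (rule ccontr)
    assume gp: "boundary_action g p \<noteq> p"
    have gpM: "boundary_action g p \<in> M" using g pM by simp
    have gpa: "boundary_action g p \<noteq> a" using action_inj[OF g, of p a] fix_a[OF g] \<open>p \<noteq> a\<close> by simp
    have ckp: "boundary_action (cinv (k ^^ n)) p = p" for n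
      using action_cancel(2)[OF pow_in[OF k], of n p] fixed_pow[OF kp] by simp
    \<comment> \<open>Equal conjugates would make a positive power of \<open>k\<close> fix
      \<open>boundary_action g p\<close>, but the fixed points of such a power are only
      \<open>p\<close> and \<open>a\<close>.\<close>
    have "w g m \<noteq> w g n" if "m < n" for m n
    proof
      assume eq: "w g m = w g n"
      define j where "j = n - m"
      have j: "k ^^ n = k ^^ m \<circ> k ^^ j" using that unfolding j_def by (metis funpow_add le_add_diff_inverse less_imp_le)
      have "boundary_action (w g n) p = boundary_action (w g m) p" using eq by simp
      then have "boundary_action (k ^^ n) (boundary_action g p) = boundary_action (k ^^ m) (boundary_action g p)"
        by (simp add: w_def boundary_action_comp[symmetric] ckp)
      then have kj: "boundary_action (k ^^ j) (boundary_action g p) = boundary_action g p"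
        unfolding j boundary_action_comp[symmetric] using action_inj[OF pow_in[OF k]] by blast
      have "strict_mono (\<lambda>i. j * i)" using that by (simp add: strict_mono_def j_def)
      from conv_subseq[OF kconv this] have "conv (\<lambda>i. k ^^ (j * i)) p a" using \<open>p' = a\<close> by simp
      from conv_fixed[OF this gpM gpa] have "boundary_action g p = p"
        using fixed_pow[OF kj] by (simp add: funpow_mult)
      then show False using gp by simp
    qed
    then have injw: "inj (w g)" by (metis injI linorder_neq_iff)
    obtain \<phi> u v where \<phi>: "strict_mono \<phi>" and c: "conv (\<lambda>n. w g (\<phi> n)) u v"
      using conv_exists_inj[OF injw] w[OF g] by blast
    have inj\<phi>: "inj (\<lambda>n. w g (\<phi> n))"
      using inj_compose[OF injw strict_mono_imp_inj_on[OF \<phi>]] by (simp add: comp_def)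
    have u: "u = a" if "v \<noteq> a"
      using conv_fixed[OF c assms] that fix_a w[OF g] by metis
    \<comment> \<open>As the powers of \<open>k\<close> fix \<open>p\<close>, the conjugates send
      \<open>p\<close> to the images of \<open>boundary_action g p\<close> under powers of
      \<open>k\<close>, and these tend to \<open>p\<close>.\<close>
    have v: "u = p" if "v \<noteq> p"
    proof (rule boundary_lim_unique[where w="\<lambda>n. boundary_action (w g (\<phi> n)) p"])
      show "\<forall>\<^sub>F n in sequentially. d (Inr (boundary_action (w g (\<phi> n)) p)) (Inr u) < e" if "e > 0" for e
        using conv_lim_boundary[OF c pM \<open>v \<noteq> p\<close>[symmetric] that] .
      show "\<forall>\<^sub>F n in sequentially. d (Inr (boundary_action (w g (\<phi> n)) p)) (Inr p) < e" if "e > 0" for e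
      proof -
        have "boundary_action (w g n) p = boundary_action (k ^^ n) (boundary_action g p)" for n
          by (simp add: w_def boundary_action_comp[symmetric] ckp)
        then show ?thesis
          using conv_lim_boundary[OF conv_subseq[OF kconv \<phi>] gpM _ that] gpa \<open>p' = a\<close> by simp
      qed
    qed (use convD[OF c] pM w[OF g] in simp_all)
    show False
    \<comment> \<open>The limits are \<open>a\<close> and \<open>p\<close> in one of the two orders;
      if \<open>a\<close> is the repelling one, passing to \<open>cinv g\<close> inverts the
      conjugates and exchanges them.\<close>
    proof (cases "v = a")
      case True
      then have "u = p" using v \<open>p \<noteq> a\<close> by blast
      have c': "conv (\<lambda>n. w (cinv g) (\<phi> n)) a p"
        using conv_cinv[OF c] True \<open>u = p\<close> cinv_w[OF g] by simp
      have "inj (\<lambda>n. w (cinv g) (\<phi> n))"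
      proof (rule injI)
        fix m n assume "w (cinv g) (\<phi> m) = w (cinv g) (\<phi> n)"
        then have "cinv (cinv (w g (\<phi> m))) = cinv (cinv (w g (\<phi> n)))" using cinv_w[OF g] by simp
        then show "m = n" using injD[OF inj\<phi>] w[OF g] by simp
      qed
      then show False using no_attract[OF cinv_in[OF g] c'] by blast
    next
      case False
      then have "u = a" using u by blast
      then have "v = p" using v \<open>p \<noteq> a\<close> by blast
      then show False using no_attract[OF g _ inj\<phi>] c \<open>u = a\<close> by blast
    qed
  qed
  \<comment> \<open>Now \<Gamma> fixes both \<open>a\<close> and \<open>p\<close>. For a sequence
    attracted to a third point, inversion forces both to equal its single repelling point.\<close>
  obtain z where z: "z \<in> M" "z \<noteq> a" "z \<noteq> p" using three_points by metis
  obtain \<beta> y' where \<beta>: "conv \<beta> z y'" using conv_to_exists[OF z(1)] by blast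
  have "a = y'" "p = y'"
    using conv_fixed[OF conv_cinv[OF \<beta>]] assms pM z fix_a fix_p convD(1)[OF \<beta>] cinv_in by metis+
  then show False using \<open>p \<noteq> a\<close> by simp
qed

lemma magnitude_proper: "\<exists>\<rho>. \<forall>g\<in>\<Gamma>. \<rho> \<le> dist b (g b) \<longrightarrow> B \<le> N g"
proof (rule ccontr)
  assume "\<not> ?thesis"
  then have "\<forall>n::nat. \<exists>g\<in>\<Gamma>. real n \<le> dist b (g b) \<and> \<not> B \<le> N g" by blast
  then obtain g where g: "\<And>n. g n \<in> \<Gamma>" "\<And>n::nat. real n \<le> dist b (g n b)" "\<And>n. \<not> B \<le> N (g n)" by metis
  obtain \<phi> x y where \<phi>: "strict_mono \<phi>" "inj (\<lambda>n. g (\<phi> n))" "conv (\<lambda>n. g (\<phi> n)) x y"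
    using conv_exists[of g] g(1) filterlim_dist_orbit[of g, OF g(2)] by blast
  have xy: "x \<in> M" "y \<in> M" using convD[OF \<phi>(3)] by simp_all
  \<comment> \<open>Translating by \<open>f\<close> separates the attracting from the repelling
    limit and changes \<open>N\<close> only by a bounded amount, by
    \<open>magnitude_left\<close>.\<close>
  obtain f where f: "f \<in> \<Gamma>" "boundary_action f x \<noteq> y"
  proof (cases "x = y")
    case True
    then show ?thesis using no_global_fixed_point[OF xy(1)] that by blast
  qed (use that[of id] in simp)
  define \<beta> where "\<beta> n = f \<circ> g (\<phi> n)" for n
  have \<beta>: "conv \<beta> (boundary_action f x) y"
    using conv_mult_left[OF \<phi>(3) f(1)] unfolding \<beta>_def[abs_def] .
  have "inj \<beta>"
  proof (rule injI)
    fix m n assume "\<beta> m = \<beta> n"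
    then have "cinv f \<circ> (f \<circ> g (\<phi> m)) = cinv f \<circ> (f \<circ> g (\<phi> n))" by (simp add: \<beta>_def)
    then have "g (\<phi> m) = g (\<phi> n)" using f(1) by (metis cinv_comp(2) comp_assoc id_comp)
    then show "m = n" using injD[OF \<phi>(2)] by blast
  qed
  \<comment> \<open>A quarter suffices: the attracting fixed point and the inverse element are each
    within \<open>c\<close> of points that are 4c apart, so the expansion estimate applies with
    \<epsilon> = c.\<close>
  define c where "c = d (Inr (boundary_action f x)) (Inr y) / 4"
  have fxE: "Inr (boundary_action f x) \<in> E" "Inr y \<in> E" using f xy by (simp_all add: InrI)
  have c: "c > 0" using d_pos[OF fxE] f(2) by (simp add: c_def)
  from cocycle_at_attracting_point[OF \<beta> \<open>inj \<beta>\<close> f(2) this]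
  obtain a r where lim: "filterlim (\<lambda>n. \<sigma> (\<beta> n) (a n)) at_top sequentially"
    and ev: "\<forall>\<^sub>F n in sequentially. north_south (\<beta> n) (a n) (r n) \<and> d (Inr (a n)) (Inr (boundary_action f x)) \<le> c \<and> d (Inr (r n)) (Inr y) \<le> c"
    by blast
  obtain C where C: "\<And>x g. x \<in> M \<Longrightarrow> g \<in> \<Gamma> \<Longrightarrow> c < d (Inr x) (Inl (cinv g)) \<Longrightarrow> \<bar>\<sigma> g x - N g\<bar> \<le> C"
    using magnitude[OF c] by blast
  obtain B' where B': "\<And>g. g \<in> \<Gamma> \<Longrightarrow> \<bar>N (f \<circ> g) - N g\<bar> \<le> B'" using magnitude_left[OF f(1)] by blast
  have "\<forall>\<^sub>F n in sequentially. B + B' + C + 1 \<le> \<sigma> (\<beta> n) (a n)" using lim by (simp add: filterlim_at_top)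
  from eventually_happens[OF eventually_conj[OF this eventually_conj[OF ev conv_lim_group[OF conv_cinv[OF \<beta>] c]]]]
  obtain n where n: "B + B' + C + 1 \<le> \<sigma> (\<beta> n) (a n)" "north_south (\<beta> n) (a n) (r n)"
    "d (Inr (a n)) (Inr (boundary_action f x)) \<le> c" "d (Inl (cinv (\<beta> n))) (Inr y) < c" by force
  have aM: "a n \<in> M" using n(2) convD by (auto simp: north_south_def)
  then have aE: "Inr (a n) \<in> E" by (simp add: InrI)
  have \<beta>n: "\<beta> n \<in> \<Gamma>" using convD(1)[OF \<beta>] .
  then have bE: "Inl (cinv (\<beta> n)) \<in> E" by (simp add: InlI)
  have "c < d (Inr (a n)) (Inl (cinv (\<beta> n)))"
    using MS.triangle''[OF fxE(1) aE fxE(2)] MS.triangle[OF aE bE fxE(2)] n(3,4) c by (simp add: c_def)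
  then have "\<bar>\<sigma> (\<beta> n) (a n) - N (\<beta> n)\<bar> \<le> C" using C[OF aM \<beta>n] by simp
  moreover have "\<bar>N (\<beta> n) - N (g (\<phi> n))\<bar> \<le> B'" using B'[OF g(1)] by (simp add: \<beta>_def)
  ultimately have "B \<le> N (g (\<phi> n))" using n(1) by linarith
  then show False using g(3) by blast
qed

section \<open>The potential\<close>


definition potential_values :: "'a \<Rightarrow> 'a \<Rightarrow> real set" where
  "potential_values p q = {N (cinv \<alpha> \<circ> \<beta>) | \<alpha> \<beta>. \<alpha> \<in> \<Gamma> \<and> \<beta> \<in> \<Gamma> \<and> dist p (\<alpha> b) \<le> D \<and> dist q (\<beta> b) \<le> D}"

text \<open>
  The choice depends only on the set \<open>potential_values p q\<close>, which is \<open>\<Gamma>\<close>-invariant; this makes the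
  potential invariant even where the action is not free.
\<close>

definition potential :: "'a \<Rightarrow> 'a \<Rightarrow> real" where
  "potential p q = (SOME v. v \<in> potential_values p q)"

lemma potential_ex:
  "\<exists>\<alpha>\<in>\<Gamma>. \<exists>\<beta>\<in>\<Gamma>. dist p (\<alpha> b) \<le> D \<and> dist q (\<beta> b) \<le> D \<and> potential p q = N (cinv \<alpha> \<circ> \<beta>)"
proof -
  obtain \<alpha> \<beta> where "\<alpha> \<in> \<Gamma>" "\<beta> \<in> \<Gamma>" "dist p (\<alpha> b) \<le> D" "dist q (\<beta> b) \<le> D"
    using orbit_dense[of p] orbit_dense[of q] by blast
  then have "N (cinv \<alpha> \<circ> \<beta>) \<in> potential_values p q" unfolding potential_values_def by blast
  then have "potential p q \<in> potential_values p q" unfolding potential_def by (rule someI)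
  then show ?thesis unfolding potential_values_def by blast
qed

lemma potential_invariant:
  assumes "\<gamma> \<in> \<Gamma>" shows "potential (\<gamma> p) (\<gamma> q) = potential p q"
proof -
  have sub: "potential_values p q \<subseteq> potential_values (\<gamma> p) (\<gamma> q)" if \<gamma>: "\<gamma> \<in> \<Gamma>" for \<gamma> p q
  proof
    fix v assume "v \<in> potential_values p q"
    then obtain \<alpha> \<beta> where ab: "\<alpha> \<in> \<Gamma>" "\<beta> \<in> \<Gamma>" "dist p (\<alpha> b) \<le> D" "dist q (\<beta> b) \<le> D" "v = N (cinv \<alpha> \<circ> \<beta>)"
      unfolding potential_values_def by blast
    have "cinv (\<gamma> \<circ> \<alpha>) \<circ> (\<gamma> \<circ> \<beta>) = cinv \<alpha> \<circ> \<beta>" using ab \<gamma> by (auto simp: cinv_mult fun_eq_iff)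
    moreover have "dist (\<gamma> p) ((\<gamma> \<circ> \<alpha>) b) \<le> D" "dist (\<gamma> q) ((\<gamma> \<circ> \<beta>) b) \<le> D" using ab \<gamma> by simp_all
    ultimately show "v \<in> potential_values (\<gamma> p) (\<gamma> q)"
      unfolding potential_values_def using ab comp_in[OF \<gamma>] by (smt (verit) mem_Collect_eq)
  qed
  have "potential_values (\<gamma> p) (\<gamma> q) = potential_values p q"
    using sub[OF assms, of p q] sub[OF cinv_in[OF assms], of "\<gamma> p" "\<gamma> q"] assms by simp
  then show ?thesis by (simp add: potential_def)
qed

text \<open>Another choice of orbit points near \<open>p\<close> and \<open>q\<close> multiplies the
  group element on the left and on the right by elements of displacement at most
  \<open>D + r\<close>.\<close>

lemma potential_compare:
  "\<exists>K. \<forall>p q. \<forall>\<alpha>\<in>\<Gamma>. \<forall>\<beta>\<in>\<Gamma>. dist p (\<alpha> b) \<le> r \<longrightarrow> dist q (\<beta> b) \<le> r \<longrightarrow> \<bar>potential p q - N (cinv \<alpha> \<circ> \<beta>)\<bar> \<le> K"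
proof -
  obtain B1 where B1: "\<And>f g. f \<in> \<Gamma> \<Longrightarrow> dist b (f b) \<le> D + r \<Longrightarrow> g \<in> \<Gamma> \<Longrightarrow> \<bar>N (f \<circ> g) - N g\<bar> \<le> B1"
    using magnitude_left_uniform by metis
  obtain B2 where B2: "\<And>f g. f \<in> \<Gamma> \<Longrightarrow> dist b (f b) \<le> D + r \<Longrightarrow> g \<in> \<Gamma> \<Longrightarrow> \<bar>N (g \<circ> f) - N g\<bar> \<le> B2"
    using magnitude_right_uniform by metis
  have "\<bar>potential p q - N (cinv \<alpha> \<circ> \<beta>)\<bar> \<le> B1 + B2"
    if ab: "\<alpha> \<in> \<Gamma>" "\<beta> \<in> \<Gamma>" "dist p (\<alpha> b) \<le> r" "dist q (\<beta> b) \<le> r" for p q \<alpha> \<beta>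
  proof -
    obtain \<alpha>' \<beta>' where ab': "\<alpha>' \<in> \<Gamma>" "\<beta>' \<in> \<Gamma>" "dist p (\<alpha>' b) \<le> D" "dist q (\<beta>' b) \<le> D"
      and pot: "potential p q = N (cinv \<alpha>' \<circ> \<beta>')" using potential_ex by blast
    have eq: "cinv \<alpha>' \<circ> \<beta>' = (cinv \<alpha>' \<circ> \<alpha>) \<circ> ((cinv \<alpha> \<circ> \<beta>) \<circ> (cinv \<beta> \<circ> \<beta>'))"
      using ab ab' by (simp add: fun_eq_iff)
    have "dist b ((cinv \<alpha>' \<circ> \<alpha>) b) = dist (\<alpha>' b) (\<alpha> b)"
      using dist_iso[OF ab'(1), of b "cinv \<alpha>' (\<alpha> b)"] ab' by simp
    then have 1: "dist b ((cinv \<alpha>' \<circ> \<alpha>) b) \<le> D + r"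
      using dist_triangle3[of "\<alpha>' b" "\<alpha> b" p] ab ab' by simp
    have "dist b ((cinv \<beta> \<circ> \<beta>') b) = dist (\<beta> b) (\<beta>' b)"
      using dist_iso[OF ab(2), of b "cinv \<beta> (\<beta>' b)"] ab by simp
    then have 2: "dist b ((cinv \<beta> \<circ> \<beta>') b) \<le> D + r"
      using dist_triangle3[of "\<beta> b" "\<beta>' b" q] ab ab' by simp
    have "\<bar>N (cinv \<alpha>' \<circ> \<beta>') - N ((cinv \<alpha> \<circ> \<beta>) \<circ> (cinv \<beta> \<circ> \<beta>'))\<bar> \<le> B1"
      unfolding eq by (rule B1[of "cinv \<alpha>' \<circ> \<alpha>", OF _ 1]) (use ab ab' in simp_all)
    moreover have "\<bar>N ((cinv \<alpha> \<circ> \<beta>) \<circ> (cinv \<beta> \<circ> \<beta>')) - N (cinv \<alpha> \<circ> \<beta>)\<bar> \<le> B2"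
      by (rule B2[of "cinv \<beta> \<circ> \<beta>'", OF _ 2]) (use ab ab' in simp_all)
    ultimately show ?thesis unfolding pot by linarith
  qed
  then show ?thesis by blast
qed

text \<open>With orbit points of \<alpha>, \<beta>, \<omega> close to \<open>p\<close>,
  \<open>q\<close>, \<open>u\<close>, the elements \<open>cinv \<alpha> \<circ> \<omega>\<close> and
  \<open>cinv \<omega> \<circ> \<beta>\<close> multiply to
  \<open>cinv \<alpha> \<circ> \<beta>\<close>. After translation by \<omega>, the product
  controlled in \<open>magnitude_quasi_additive\<close> is the one of the orbit points seen from
  \<open>\<omega> b\<close>; exchanging the three points for \<open>p\<close>, \<open>q\<close>,
  \<open>u\<close> costs 3D.\<close>

lemma potential_additive:
  "\<exists>K. \<forall>p q u. gromov_product u p q \<le> R \<longrightarrow> \<bar>potential p q - (potential p u + potential u q)\<bar> \<le> K"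
proof -
  obtain K where K: "\<And>p q \<alpha> \<beta>. \<alpha> \<in> \<Gamma> \<Longrightarrow> \<beta> \<in> \<Gamma> \<Longrightarrow> dist p (\<alpha> b) \<le> D \<Longrightarrow> dist q (\<beta> b) \<le> D \<Longrightarrow>
     \<bar>potential p q - N (cinv \<alpha> \<circ> \<beta>)\<bar> \<le> K"
    using potential_compare by metis
  obtain L where L: "\<And>g h. g \<in> \<Gamma> \<Longrightarrow> h \<in> \<Gamma> \<Longrightarrow> gromov_product b (cinv g b) (h b) \<le> R + 3 * D \<Longrightarrow>
     \<bar>N (g \<circ> h) - N g - N h\<bar> \<le> L"
    using magnitude_quasi_additive by metis
  have "\<bar>potential p q - (potential p u + potential u q)\<bar> \<le> 3 * K + L" if R: "gromov_product u p q \<le> R" for p q u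
  proof -
    obtain \<alpha> \<beta> \<omega> where g: "\<alpha> \<in> \<Gamma>" "\<beta> \<in> \<Gamma>" "\<omega> \<in> \<Gamma>" and dist: "dist p (\<alpha> b) \<le> D" "dist q (\<beta> b) \<le> D" "dist u (\<omega> b) \<le> D"
      using orbit_dense by metis
    have "gromov_product b (cinv (cinv \<alpha> \<circ> \<omega>) b) ((cinv \<omega> \<circ> \<beta>) b) = gromov_product b (cinv \<omega> (\<alpha> b)) (cinv \<omega> (\<beta> b))"
      using g by (simp add: cinv_mult)
    also have "\<dots> = gromov_product (\<omega> b) (\<alpha> b) (\<beta> b)"
      using isometry_gromov_product[OF iso[OF g(3)], of b "cinv \<omega> (\<alpha> b)" "cinv \<omega> (\<beta> b)"] g by simp
    also have "\<dots> \<le> gromov_product u (\<alpha> b) (\<beta> b) + D"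
      using gromov_product_lipschitz_base[of "\<omega> b" "\<alpha> b" "\<beta> b" u] dist(3) by (simp add: dist_commute)
    also have "\<dots> \<le> gromov_product u (\<alpha> b) q + D + D"
      using gromov_product_lipschitz[of u "\<alpha> b" "\<beta> b" q] dist(2) by (simp add: dist_commute)
    also have "\<dots> \<le> gromov_product u p q + D + D + D"
      using gromov_product_lipschitz[of u q "\<alpha> b" p] dist(1) by (simp add: dist_commute gromov_product_commute)
    finally have "gromov_product b (cinv (cinv \<alpha> \<circ> \<omega>) b) ((cinv \<omega> \<circ> \<beta>) b) \<le> R + 3 * D" using R by simp
    then have "\<bar>N ((cinv \<alpha> \<circ> \<omega>) \<circ> (cinv \<omega> \<circ> \<beta>)) - N (cinv \<alpha> \<circ> \<omega>) - N (cinv \<omega> \<circ> \<beta>)\<bar> \<le> L"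
      using g by (intro L) simp_all
    moreover have "(cinv \<alpha> \<circ> \<omega>) \<circ> (cinv \<omega> \<circ> \<beta>) = cinv \<alpha> \<circ> \<beta>" using g by (simp add: fun_eq_iff)
    ultimately show ?thesis
      using K[OF g(1,2) dist(1,2)] K[OF g(1,3) dist(1,3)] K[OF g(3,2) dist(3,2)] by auto
  qed
  then show ?thesis by blast
qed

lemma potential_dist:
  assumes "\<alpha> \<in> \<Gamma>" "dist p (\<alpha> b) \<le> D" "dist q (\<beta> b) \<le> D"
  shows "\<bar>dist b ((cinv \<alpha> \<circ> \<beta>) b) - dist p q\<bar> \<le> 2 * D"
proof -
  have "dist b ((cinv \<alpha> \<circ> \<beta>) b) = dist (\<alpha> b) (\<beta> b)"
    using dist_iso[OF assms(1), of b "cinv \<alpha> (\<beta> b)"] assms by simp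
  then show ?thesis
    using assms dist_triangle[of p q "\<alpha> b"] dist_triangle[of "\<alpha> b" q "\<beta> b"]
      dist_triangle[of "\<alpha> b" "\<beta> b" p] dist_triangle[of p "\<beta> b" q] by (simp add: dist_commute)
qed

lemma potential_proper: "\<exists>r. \<forall>p q. r \<le> dist p q \<longrightarrow> B \<le> potential p q"
proof -
  obtain \<rho> where \<rho>: "\<And>g. g \<in> \<Gamma> \<Longrightarrow> \<rho> \<le> dist b (g b) \<Longrightarrow> B \<le> N g" using magnitude_proper by blast
  have "B \<le> potential p q" if "\<rho> + 2 * D \<le> dist p q" for p q
  proof -
    obtain \<alpha> \<beta> where ab: "\<alpha> \<in> \<Gamma>" "\<beta> \<in> \<Gamma>" "dist p (\<alpha> b) \<le> D" "dist q (\<beta> b) \<le> D"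
      and pot: "potential p q = N (cinv \<alpha> \<circ> \<beta>)" using potential_ex by blast
    show ?thesis unfolding pot
      by (rule \<rho>) (use ab potential_dist[of \<alpha> p q \<beta>] that in auto)
  qed
  then show ?thesis by blast
qed

lemma potential_bounded: "\<exists>K. \<forall>p q. dist p q \<le> r \<longrightarrow> \<bar>potential p q\<bar> \<le> K"
proof -
  obtain B where B: "\<And>g. g \<in> \<Gamma> \<Longrightarrow> dist b (g b) \<le> r + 2 * D \<Longrightarrow> \<bar>N g\<bar> \<le> B" using magnitude_bounded by blast
  have "\<bar>potential p q\<bar> \<le> B" if "dist p q \<le> r" for p q
  proof -
    obtain \<alpha> \<beta> where ab: "\<alpha> \<in> \<Gamma>" "\<beta> \<in> \<Gamma>" "dist p (\<alpha> b) \<le> D" "dist q (\<beta> b) \<le> D"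
      and pot: "potential p q = N (cinv \<alpha> \<circ> \<beta>)" using potential_ex by blast
    show ?thesis unfolding pot
      by (rule B) (use ab potential_dist[of \<alpha> p q \<beta>] that in auto)
  qed
  then show ?thesis by blast
qed

lemma coarsely_additive_potential: "coarsely_additive_potential potential"
  unfolding coarsely_additive_potential_def
proof (intro conjI allI impI)
  show "((\<lambda>r::real. INF (p, q)\<in>{(p, q). dist p q \<ge> r}. ereal (potential p q)) \<longlongrightarrow> \<infinity>) at_top"
    unfolding tendsto_PInfty
  proof
    fix B :: real
    obtain r0 where r0: "\<And>p q. r0 \<le> dist p q \<Longrightarrow> B + 1 \<le> potential p q" using potential_proper by blast
    have "ereal B < (INF (p, q)\<in>{(p, q). dist p q \<ge> r}. ereal (potential p q))" if "r \<ge> r0" for r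
    proof -
      have "ereal (B + 1) \<le> (INF (p, q)\<in>{(p, q). dist p q \<ge> r}. ereal (potential p q))"
        by (rule INF_greatest) (use r0 that in force)
      then show ?thesis by (rule less_le_trans[rotated]) simp
    qed
    then show "\<forall>\<^sub>F r in at_top. ereal B < (INF (p, q)\<in>{(p, q). dist p q \<ge> r}. ereal (potential p q))"
      unfolding eventually_at_top_linorder by blast
  qed
next
  fix r :: real
  obtain K where K: "\<And>p q. dist p q \<le> r \<Longrightarrow> \<bar>potential p q\<bar> \<le> K" using potential_bounded by blast
  have "(SUP (p, q)\<in>{(p, q). dist p q \<le> r}. ereal \<bar>potential p q\<bar>) \<le> ereal K"
    by (rule SUP_least) (use K in auto)
  then show "(SUP (p, q)\<in>{(p, q). dist p q \<le> r}. ereal \<bar>potential p q\<bar>) < \<infinity>"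
    by (rule le_less_trans) simp
next
  fix r :: real
  obtain K where K: "\<And>p q u. gromov_product u p q \<le> r \<Longrightarrow> \<bar>potential p q - (potential p u + potential u q)\<bar> \<le> K"
    using potential_additive by blast
  have "\<bar>potential p q - (potential p u + potential u q)\<bar> \<le> max K 1"
    if c: "geodesic_joining c p q" and t: "t \<in> {0..dist p q}" "dist u (c t) < r" for p q u c t
  proof -
    have "dist p (c t) = t" "dist (c t) q = dist p q - t"
      using c t unfolding geodesic_joining_def
      by (metis abs_of_nonneg abs_minus_commute atLeastAtMost_iff diff_zero order_refl zero_le_dist,
          metis abs_of_nonneg abs_minus_commute atLeastAtMost_iff diff_ge_0_iff_ge order_refl zero_le_dist)
    \<comment> \<open>For \<open>u\<close> within \<open>r\<close> of a point of a geodesic, the two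
      triangle inequalities through that point add up to (p|q)_u <= r.\<close>
    then have "gromov_product u p q \<le> r"
      using dist_triangle[of p u "c t"] dist_triangle[of q u "c t"] t(2)
      by (simp add: gromov_product_def dist_commute)
    from K[OF this] show ?thesis by simp
  qed
  then show "\<exists>\<kappa>>0. \<forall>p q u c. geodesic_joining c p q \<and> (\<exists>t\<in>{0..dist p q}. dist u (c t) < r) \<longrightarrow>
     \<bar>potential p q - (potential p u + potential u q)\<bar> \<le> \<kappa>"
    by (intro exI[of _ "max K 1"]) auto
qed

lemma near_exists: "\<xi> \<in> M \<Longrightarrow> \<exists>p. near b r (Inr \<xi>) (Inl p)"
  using near_rep boundary_nonempty by blast

text \<open>Replacing \<open>p\<close> by a nearby orbit point \<open>h b\<close> turns the
  difference into \<open>N (\<gamma> \<circ> h) - N h\<close>, which \<open>magnitude_diff\<close>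
  compares with \<sigma> at the image of some \<open>y\<close> under \<open>h\<close>. That image is
  close to \<open>h\<close> and \<open>h\<close> is close to \<open>x\<close>, so coarse continuity
  of \<sigma> finishes; the bound involves neither \<gamma> nor \<open>x\<close>.\<close>

lemma potential_difference_sigma:
  "\<exists>K. \<forall>\<gamma>\<in>\<Gamma>. \<forall>x\<in>M. \<exists>R. \<forall>p. near b R (Inr x) (Inl p) \<longrightarrow>
     \<bar>potential (cinv \<gamma> b) p - potential b p - \<sigma> \<gamma> x\<bar> \<le> K"
proof -
  \<comment> \<open>The radius \<open>max D 0\<close> admits both orbit points at distance
    \<open>D\<close> and the exact choices \<open>cinv \<gamma>\<close> and \<open>id\<close> at
    distance 0.\<close>
  obtain Kc where Kc: "\<And>p q \<alpha> \<beta>. \<alpha> \<in> \<Gamma> \<Longrightarrow> \<beta> \<in> \<Gamma> \<Longrightarrow> dist p (\<alpha> b) \<le> max D 0 \<Longrightarrow> dist q (\<beta> b) \<le> max D 0 \<Longrightarrow>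
     \<bar>potential p q - N (cinv \<alpha> \<circ> \<beta>)\<bar> \<le> Kc"
    using potential_compare by metis
  obtain Km e where e: "e > 0" and Km: "\<And>g h. g \<in> \<Gamma> \<Longrightarrow> h \<in> \<Gamma> \<Longrightarrow> \<exists>y\<in>M. e < d (Inr y) (Inl (cinv h)) \<and>
     \<bar>N (g \<circ> h) - N h - \<sigma> g (boundary_action h y)\<bar> \<le> Km"
    using magnitude_diff by metis
  have "\<exists>R. \<forall>p. near b R (Inr x) (Inl p) \<longrightarrow> \<bar>potential (cinv \<gamma> b) p - potential b p - \<sigma> \<gamma> x\<bar> \<le> 2 * Kc + Km + \<kappa> + 1"
    if \<gamma>: "\<gamma> \<in> \<Gamma>" and x: "x \<in> M" for \<gamma> x
  proof -
    obtain e1 where e1: "e1 > 0" "\<And>x'. x' \<in> M \<Longrightarrow> d (Inr x) (Inr x') < e1 \<Longrightarrow> \<bar>\<sigma> \<gamma> x - \<sigma> \<gamma> x'\<bar> < \<kappa> + 1"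
      using sigma_coarsely_continuous[OF \<gamma> x] by blast
    have "min e (e1 / 2) > 0" using e e1 by simp
    from contract_uniform[OF this] obtain \<rho> where \<rho>: "\<And>h u. h \<in> \<Gamma> \<Longrightarrow> \<rho> \<le> dist b (h b) \<Longrightarrow> u \<in> E \<Longrightarrow>
       min e (e1 / 2) \<le> d u (Inl (cinv h)) \<Longrightarrow> d (shift h u) (Inl h) < min e (e1 / 2)" by blast
    have "e1 / 2 > 0" using e1 by simp
    from near_orbit_imp_d[OF x this] obtain R where
      R: "\<And>h. h \<in> \<Gamma> \<Longrightarrow> near b R (Inr x) (Inl (h b)) \<Longrightarrow> d (Inl h) (Inr x) < e1 / 2" by blast
    have "\<bar>potential (cinv \<gamma> b) p - potential b p - \<sigma> \<gamma> x\<bar> \<le> 2 * Kc + Km + \<kappa> + 1"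
      if p: "near b (max R \<rho> + D) (Inr x) (Inl p)" for p
    proof -
      obtain h where h: "h \<in> \<Gamma>" "dist p (h b) \<le> D" using orbit_dense by blast
      have nr: "near b (max R \<rho>) (Inr x) (Inl (h b))"
        by (rule near_mono[OF near_lipschitz[OF p]]) (use h in linarith)
      have far: "\<rho> \<le> dist b (h b)" using near_boundary_dist[OF x nr] by simp
      have close: "d (Inl h) (Inr x) < e1 / 2" using R[OF h(1) near_mono[OF nr]] by simp
      obtain y where y: "y \<in> M" "e < d (Inr y) (Inl (cinv h))" "\<bar>N (\<gamma> \<circ> h) - N h - \<sigma> \<gamma> (boundary_action h y)\<bar> \<le> Km"
        using Km[OF \<gamma> h(1)] by blast
      have "d (Inr (boundary_action h y)) (Inl h) < e1 / 2"
        using \<rho>[OF h(1) far, of "Inr y"] y by (simp add: InrI)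
      then have "d (Inr x) (Inr (boundary_action h y)) < e1"
        using MS.triangle''[of "Inr x" "Inl h" "Inr (boundary_action h y)"] close x y h(1) MS.commute[of "Inl h"]
        by (simp add: InlI InrI)
      then have 1: "\<bar>\<sigma> \<gamma> x - \<sigma> \<gamma> (boundary_action h y)\<bar> < \<kappa> + 1" using e1(2) h y by simp
      have 2: "\<bar>potential (cinv \<gamma> b) p - N (cinv (cinv \<gamma>) \<circ> h)\<bar> \<le> Kc"
        by (rule Kc) (use \<gamma> h in simp_all)
      have 3: "\<bar>potential b p - N (cinv id \<circ> h)\<bar> \<le> Kc"
        by (rule Kc) (use h in simp_all)
      show ?thesis using 1 2 3 y(3) \<gamma> by (simp add: inv_id)
    qed
    then show ?thesis by blast
  qed
  then show ?thesis by blast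
qed

lemma potential_cocycle_close:
  "\<exists>K. \<forall>\<gamma>\<in>\<Gamma>. \<forall>x\<in>M. \<bar>potential_cocycle b potential \<gamma> x - ereal (\<sigma> \<gamma> x)\<bar> \<le> ereal K"
proof -
  obtain K where K: "\<And>\<gamma> x. \<gamma> \<in> \<Gamma> \<Longrightarrow> x \<in> M \<Longrightarrow> \<exists>R. \<forall>p. near b R (Inr x) (Inl p) \<longrightarrow>
     \<bar>potential (cinv \<gamma> b) p - potential b p - \<sigma> \<gamma> x\<bar> \<le> K"
    using potential_difference_sigma by blast
  have "\<bar>potential_cocycle b potential \<gamma> x - ereal (\<sigma> \<gamma> x)\<bar> \<le> ereal K" if \<gamma>: "\<gamma> \<in> \<Gamma>" and x: "x \<in> M" for \<gamma> x
  proof -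
    have ev: "\<forall>\<^sub>F p in to_boundary x. \<bar>potential (cinv \<gamma> b) p - potential b p - \<sigma> \<gamma> x\<bar> \<le> K"
      using K[OF \<gamma> x] unfolding eventually_to_boundary[OF x] .
    let ?L = "Limsup (to_boundary x) (\<lambda>p. ereal (potential (cinv \<gamma> b) p - potential b p))"
    have 1: "?L \<le> ereal (\<sigma> \<gamma> x + K)"
      by (rule Limsup_bounded, rule eventually_mono[OF ev]) auto
    have 2: "ereal (\<sigma> \<gamma> x - K) \<le> ?L"
      by (rule le_Limsup[OF to_boundary_neq_bot[OF x]], rule eventually_mono[OF ev]) auto
    have "\<bar>?L - ereal (\<sigma> \<gamma> x)\<bar> \<le> ereal K"
      using 1 2 by (cases ?L) auto
    then show ?thesis unfolding potential_cocycle_def to_boundary_def .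
  qed
  then show ?thesis by blast
qed

section \<open>The dual cocycle\<close>

text \<open>
  The differences are compared through a point \<open>u\<close> on a geodesic towards \<open>x\<close>, chosen beyond the point
  where geodesics from \<open>a\<close> and \<open>a'\<close> to \<open>x\<close> have merged.
\<close>

lemma coarse_limit:
  fixes \<psi> :: "'a \<Rightarrow> 'a \<Rightarrow> real"
  assumes A: "\<And>p q u. gromov_product u p q \<le> 2 * \<delta> \<Longrightarrow> \<bar>\<psi> p q - (\<psi> p u + \<psi> u q)\<bar> \<le> K"
    and x: "x \<in> M"
  shows "\<exists>R. \<forall>p p' a a'. near b R (Inr x) (Inl p) \<longrightarrow> near b R (Inr x) (Inl p') \<longrightarrow>
     \<not> near b B (Inr x) (Inl a) \<longrightarrow> \<not> near b B (Inr x) (Inl a') \<longrightarrow>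
     \<bar>(\<psi> p a - \<psi> p a') - (\<psi> p' a - \<psi> p' a')\<bar> \<le> 4 * K"
proof -
  \<comment> \<open>The height of \<open>u\<close> above \<open>b\<close>: 3\<delta> pays for the
    passages from \<open>x\<close> through \<open>p0\<close> and \<open>u\<close> to
    \<open>a\<close>, and the 1 makes the inequalities strict.\<close>
  define t where "t = max 0 B + 1 + 3 * \<delta>"
  have t: "0 < t" "B \<le> t - 1 - 3 * \<delta>" using delta_nonneg by (auto simp: t_def)
  obtain p0 where p0: "near b (t + \<delta>) (Inr x) (Inl p0)" using near_exists[OF x] by blast
  have big: "t < dist b p0" using near_boundary_dist[OF x p0] delta_nonneg by linarith
  obtain c where "geodesic_joining c b p0" using geodesic by (auto simp: geodesic_metric_space_def)
  then have c: "c 0 = b" "c (dist b p0) = p0" "\<And>s t. s \<in> {0..dist b p0} \<Longrightarrow> t \<in> {0..dist b p0} \<Longrightarrow> dist (c s) (c t) = \<bar>s - t\<bar>"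
    by (auto simp: geodesic_joining_def)
  define u where "u = c t"
  have u: "dist b u = t" "dist u p0 = dist b p0 - t"
    using c(3)[of 0 t] c(3)[of t "dist b p0"] c(1,2) t big by (auto simp: u_def)
  have up0: "gromov_product b u p0 = t" using u by (simp add: gromov_product_def dist_commute)
  have 1: "gromov_product u b p \<le> \<delta>" if p: "near b (t + \<delta>) (Inr x) (Inl p)" for p
  proof -
    have "near b (t + \<delta> - \<delta>) (Inl p0) (Inl p)"
      by (rule near_trans[OF near_sym[OF p0] p]) (use x in \<open>simp add: InrI\<close>)
    then have "t < gromov_product b p0 p" by simp
    then have "t - \<delta> \<le> gromov_product b u p" using hyperbolic[of b u p0 p] up0 by simp
    then show ?thesis using gromov_product_basepoint_add[of b u p] u by simp
  qed
  have 2: "2 * \<delta> < gromov_product u b a" if a: "\<not> near b B (Inr x) (Inl a)" for a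
  proof -
    have "near b (t - 1) (Inr x) (Inl p0)" using near_mono[OF p0] delta_nonneg by simp
    moreover have "near b (t - 1) (Inl p0) (Inl u)" using up0 by (simp add: gromov_product_commute)
    ultimately have "near b (t - 1 - \<delta>) (Inr x) (Inl u)" by (rule near_trans) (simp add: InlI)
    then have nu: "near b (t - 1 - 2 * \<delta>) (Inr x) (Inl u)" by (rule near_mono) (use delta_nonneg in simp)
    have "\<not> near b (t - 1 - 2 * \<delta>) (Inl u) (Inl a)"
    proof
      assume "near b (t - 1 - 2 * \<delta>) (Inl u) (Inl a)"
      then have "near b (t - 1 - 2 * \<delta> - \<delta>) (Inr x) (Inl a)" by (intro near_trans[OF nu]) (simp_all add: InlI)
      then show False using a near_mono[of b "t - 1 - 2 * \<delta> - \<delta>" "Inr x" "Inl a" B] t by simp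
    qed
    then show ?thesis using gromov_product_basepoint_add[of b u a] u by simp
  qed
  \<comment> \<open>Seen from \<open>u\<close>, the product of \<open>b\<close> and \<open>p\<close>
    is at most \<delta>, while that of \<open>b\<close> and \<open>a\<close> exceeds 2\<delta>.
    Hyperbolicity at the base point \<open>u\<close> then forces (p|a)_u <= 2\<delta>, the bound
    required by \<open>A\<close>.\<close>
  have 3: "\<bar>\<psi> p a - (\<psi> p u + \<psi> u a)\<bar> \<le> K"
    if "near b (t + \<delta>) (Inr x) (Inl p)" "\<not> near b B (Inr x) (Inl a)" for p a
    using hyperbolic[of u b a p] 1[OF that(1)] 2[OF that(2)]
    by (intro A) (simp add: gromov_product_commute)
  \<comment> \<open>After splitting all four values at \<open>u\<close>, every term cancels and four
    errors \<open>K\<close> remain.\<close>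
  have "\<bar>(\<psi> p a - \<psi> p a') - (\<psi> p' a - \<psi> p' a')\<bar> \<le> 4 * K"
    if "near b (t + \<delta>) (Inr x) (Inl p)" "near b (t + \<delta>) (Inr x) (Inl p')"
      "\<not> near b B (Inr x) (Inl a)" "\<not> near b B (Inr x) (Inl a')" for p p' a a'
    using 3[OF that(1,3)] 3[OF that(1,4)] 3[OF that(2,3)] 3[OF that(2,4)] by linarith
  then show ?thesis by blast
qed

text \<open>By \<open>coarse_limit\<close> the differences agree up to 4K once \<open>p\<close> is
  close to \<open>x\<close>, so the value at any one such \<open>p\<close> can serve as the dual
  cocycle. Only the threshold depends on \<gamma>.\<close>

lemma dual_cocycle_exists:
  "\<exists>\<sigma>' K. \<forall>\<gamma>\<in>\<Gamma>. \<forall>x\<in>M. \<exists>R. \<forall>p. near b R (Inr x) (Inl p) \<longrightarrow>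
     \<bar>potential p (cinv \<gamma> b) - potential p b - \<sigma>' \<gamma> x\<bar> \<le> K"
proof -
  obtain K where K: "\<And>p q u. gromov_product u p q \<le> 2 * \<delta> \<Longrightarrow> \<bar>potential p q - (potential p u + potential u q)\<bar> \<le> K"
    using potential_additive by blast
  have "\<exists>v R. \<forall>p. near b R (Inr x) (Inl p) \<longrightarrow> \<bar>potential p (cinv \<gamma> b) - potential p b - v\<bar> \<le> 4 * K"
    if \<gamma>: "\<gamma> \<in> \<Gamma>" and x: "x \<in> M" for \<gamma> x
  proof -
    define B where "B = dist b (cinv \<gamma> b)"
    have "\<not> near b B (Inr x) (Inl (cinv \<gamma> b))" "\<not> near b B (Inr x) (Inl b)"
      using near_boundary_dist[of x B] x zero_le_dist[of b "cinv \<gamma> b"] by (fastforce simp: B_def)+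
    then obtain R where "\<And>p p'. near b R (Inr x) (Inl p) \<Longrightarrow> near b R (Inr x) (Inl p') \<Longrightarrow>
       \<bar>(potential p (cinv \<gamma> b) - potential p b) - (potential p' (cinv \<gamma> b) - potential p' b)\<bar> \<le> 4 * K"
      using coarse_limit[where \<psi>=potential and K=K and B=B, OF K x] by metis
    moreover obtain p' where "near b R (Inr x) (Inl p')" using near_exists[OF x] by blast
    ultimately show ?thesis by blast
  qed
  then show ?thesis by metis
qed

text \<open>The two variables are moved one after the other: \<open>coarse_limit\<close> for the
  potential moves \<open>p\<close> with \<open>b\<close> and \<open>q\<close> as reference points,
  and for the potential with its arguments exchanged it moves \<open>q\<close>. Each move costs
  4K.\<close>

lemma gromov_function_exists:
  "\<exists>Gr K. \<forall>x\<in>M. \<forall>y\<in>M. x \<noteq> y \<longrightarrow> (\<exists>R. \<forall>p q. near b R (Inr x) (Inl p) \<longrightarrow> near b R (Inr y) (Inl q) \<longrightarrow>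
     \<bar>potential p b + potential b q - potential p q - Gr x y\<bar> \<le> K)"
proof -
  obtain K where K: "\<And>p q u. gromov_product u p q \<le> 2 * \<delta> \<Longrightarrow> \<bar>potential p q - (potential p u + potential u q)\<bar> \<le> K"
    using potential_additive by blast
  have K': "\<bar>potential q p - (potential u p + potential q u)\<bar> \<le> K" if "gromov_product u p q \<le> 2 * \<delta>" for p q u
    using K[of u q p] that by (simp add: gromov_product_commute add.commute)
  have "\<exists>v R. \<forall>p q. near b R (Inr x) (Inl p) \<longrightarrow> near b R (Inr y) (Inl q) \<longrightarrow>
     \<bar>potential p b + potential b q - potential p q - v\<bar> \<le> 8 * K"
    if x: "x \<in> M" and y: "y \<in> M" and ne: "x \<noteq> y" for x y
  proof -
    obtain r0 where "\<not> near b r0 (Inr x) (Inr y)" using boundary_eqI[OF x y] ne by blast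
    \<comment> \<open>At level \<open>B\<close> no point of X is near both \<open>x\<close> and
      \<open>y\<close>, so a point tending to one of them is an admissible reference point for the
      limit at the other; the 0 makes \<open>b\<close> admissible as well.\<close>
    define B where "B = max 0 (r0 + \<delta>)"
    have B: "\<not> near b (B - \<delta>) (Inr x) (Inr y)"
    proof
      assume "near b (B - \<delta>) (Inr x) (Inr y)"
      then have "near b r0 (Inr x) (Inr y)" by (rule near_mono) (simp add: B_def)
      with \<open>\<not> near b r0 (Inr x) (Inr y)\<close> show False by blast
    qed
    have apart: "\<not> (near b B (Inr x) (Inl p) \<and> near b B (Inr y) (Inl p))" for p
      using near_trans[of B "Inr x" "Inl p" "Inr y"] near_sym B by (auto simp: InlI)
    have base: "\<not> near b B (Inr z) (Inl b)" if "z \<in> M" for z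
      using near_boundary_dist[of z B b] that by (auto simp: B_def)
    obtain R1 where R1: "\<And>p p' a a'. near b R1 (Inr x) (Inl p) \<Longrightarrow> near b R1 (Inr x) (Inl p') \<Longrightarrow>
       \<not> near b B (Inr x) (Inl a) \<Longrightarrow> \<not> near b B (Inr x) (Inl a') \<Longrightarrow>
       \<bar>(potential p a - potential p a') - (potential p' a - potential p' a')\<bar> \<le> 4 * K"
      using coarse_limit[where \<psi>=potential and K=K and B=B, OF K x] by metis
    obtain R2 where R2: "\<And>p p' a a'. near b R2 (Inr y) (Inl p) \<Longrightarrow> near b R2 (Inr y) (Inl p') \<Longrightarrow>
       \<not> near b B (Inr y) (Inl a) \<Longrightarrow> \<not> near b B (Inr y) (Inl a') \<Longrightarrow>
       \<bar>(potential a p - potential a' p) - (potential a p' - potential a' p')\<bar> \<le> 4 * K"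
      using coarse_limit[where \<psi>="\<lambda>p q. potential q p" and K=K and B=B, OF K' y] by metis
    define R where "R = Max {B, R1, R2}"
    have R: "B \<le> R" "R1 \<le> R" "R2 \<le> R" by (simp_all add: R_def)
    obtain p' q' where pq': "near b R (Inr x) (Inl p')" "near b R (Inr y) (Inl q')"
      using near_exists x y by meson
    have "\<bar>potential p b + potential b q - potential p q - (potential p' b + potential b q' - potential p' q')\<bar> \<le> 8 * K"
      if p: "near b R (Inr x) (Inl p)" and q: "near b R (Inr y) (Inl q)" for p q
    proof -
      have "\<not> near b B (Inr x) (Inl q)" using apart near_mono[OF q R(1)] by blast
      then have 1: "\<bar>(potential p b - potential p q) - (potential p' b - potential p' q)\<bar> \<le> 4 * K"
        using R1[OF near_mono[OF p R(2)] near_mono[OF pq'(1) R(2)] base[OF x]] by blast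
      have "\<not> near b B (Inr y) (Inl p')" using apart near_mono[OF pq'(1) R(1)] by blast
      then have 2: "\<bar>(potential b q - potential p' q) - (potential b q' - potential p' q')\<bar> \<le> 4 * K"
        using R2[OF near_mono[OF q R(3)] near_mono[OF pq'(2) R(3)] base[OF y]] by blast
      show ?thesis using 1 2 by linarith
    qed
    then show ?thesis by blast
  qed
  then have "\<forall>x y. \<exists>v. x \<in> M \<longrightarrow> y \<in> M \<longrightarrow> x \<noteq> y \<longrightarrow> (\<exists>R. \<forall>p q. near b R (Inr x) (Inl p) \<longrightarrow> near b R (Inr y) (Inl q) \<longrightarrow>
     \<bar>potential p b + potential b q - potential p q - v\<bar> \<le> 8 * K)" by meson
  then obtain Gr where "\<forall>x y. x \<in> M \<longrightarrow> y \<in> M \<longrightarrow> x \<noteq> y \<longrightarrow> (\<exists>R. \<forall>p q. near b R (Inr x) (Inl p) \<longrightarrow> near b R (Inr y) (Inl q) \<longrightarrow>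
     \<bar>potential p b + potential b q - potential p q - Gr x y\<bar> \<le> 8 * K)" by metis
  then show ?thesis by blast
qed

section \<open>The coarse GPS system\<close>

lemma near_translate:
  assumes "\<gamma> \<in> \<Gamma>" "near b (R + dist b (\<gamma> b)) (Inr x) (Inl p)"
  shows "near b R (Inr (boundary_action \<gamma> x)) (Inl (\<gamma> p))"
  using near_isometry[OF iso[OF assms(1)] assms(2)] by simp

lemma near_neighbour:
  assumes "x \<in> M" "near b (R + \<delta>) (Inr x0) (Inr x)" "near b (R + \<delta>) (Inr x) (Inl p)"
  shows "near b R (Inr x0) (Inl p)"
  using near_trans[OF assms(2,3)] assms(1) by (simp add: InrI)

lemma GPS_exists: "\<exists>\<sigma>' Gr. coarse_GPS G T boundary_action d \<sigma> \<sigma>' Gr"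
proof -
  obtain Ks where Ks: "\<And>\<gamma> x. \<gamma> \<in> \<Gamma> \<Longrightarrow> x \<in> M \<Longrightarrow> \<exists>R. \<forall>p. near b R (Inr x) (Inl p) \<longrightarrow>
     \<bar>potential (cinv \<gamma> b) p - potential b p - \<sigma> \<gamma> x\<bar> \<le> Ks"
    using potential_difference_sigma by blast
  obtain \<sigma>' K where K: "\<And>\<gamma> x. \<gamma> \<in> \<Gamma> \<Longrightarrow> x \<in> M \<Longrightarrow> \<exists>R. \<forall>p. near b R (Inr x) (Inl p) \<longrightarrow>
     \<bar>potential p (cinv \<gamma> b) - potential p b - \<sigma>' \<gamma> x\<bar> \<le> K"
    using dual_cocycle_exists by blast
  obtain Gr L where "\<forall>x\<in>M. \<forall>y\<in>M. x \<noteq> y \<longrightarrow> (\<exists>R. \<forall>p q. near b R (Inr x) (Inl p) \<longrightarrow> near b R (Inr y) (Inl q) \<longrightarrow>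
     \<bar>potential p b + potential b q - potential p q - Gr x y\<bar> \<le> L)"
    using gromov_function_exists by (elim exE)
  then have L: "\<exists>R. \<forall>p q. near b R (Inr x) (Inl p) \<longrightarrow> near b R (Inr y) (Inl q) \<longrightarrow>
     \<bar>potential p b + potential b q - potential p q - Gr x y\<bar> \<le> L" if "x \<in> M" "y \<in> M" "x \<noteq> y" for x y
    using that by simp
  have eq: "potential p (cinv \<gamma> q) = potential (\<gamma> p) q" "potential (cinv \<gamma> q) p = potential q (\<gamma> p)" if "\<gamma> \<in> \<Gamma>" for \<gamma> p q
    using potential_invariant[OF that, of p "cinv \<gamma> q"] potential_invariant[OF that, of "cinv \<gamma> q" p] that by simp_all
  have K0: "K \<ge> 0"
  proof -
    obtain x where x: "x \<in> M" using three_points by blast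
    obtain R where "\<forall>p. near b R (Inr x) (Inl p) \<longrightarrow> \<bar>potential p (cinv id b) - potential p b - \<sigma>' id x\<bar> \<le> K"
      using K[OF id_in x] by blast
    then show ?thesis using near_exists[OF x, of R] by fastforce
  qed
  have cont: "\<exists>U. openin T U \<and> x0 \<in> U \<and> (\<forall>x\<in>U. \<bar>\<sigma>' \<gamma> x0 - \<sigma>' \<gamma> x\<bar> \<le> 2 * K)" if \<gamma>: "\<gamma> \<in> \<Gamma>" and x0: "x0 \<in> M" for \<gamma> x0
  proof -
    obtain R where R: "\<And>p. near b R (Inr x0) (Inl p) \<Longrightarrow> \<bar>potential p (cinv \<gamma> b) - potential p b - \<sigma>' \<gamma> x0\<bar> \<le> K"
      using K[OF \<gamma> x0] by blast
    obtain U where U: "openin T U" "x0 \<in> U" "\<And>x. x \<in> U \<Longrightarrow> near b (R + \<delta>) (Inr x0) (Inr x)"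
      using boundary_nhd[OF x0, of "R + \<delta>"] by metis
    have "\<bar>\<sigma>' \<gamma> x0 - \<sigma>' \<gamma> x\<bar> \<le> 2 * K" if "x \<in> U" for x
    proof -
      have x: "x \<in> M" using openin_subset[OF U(1)] that by auto
      obtain R' where R': "\<And>p. near b R' (Inr x) (Inl p) \<Longrightarrow> \<bar>potential p (cinv \<gamma> b) - potential p b - \<sigma>' \<gamma> x\<bar> \<le> K"
        using K[OF \<gamma> x] by blast
      obtain p where p: "near b (max R' (R + \<delta>)) (Inr x) (Inl p)" using near_exists[OF x] by blast
      have "near b R (Inr x0) (Inl p)"
        by (rule near_neighbour[OF x U(3)[OF that] near_mono[OF p]]) simp
      then show ?thesis using R[of p] R'[OF near_mono[OF p]] by simp
    qed
    then show ?thesis using U by blast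
  qed
  have mult: "\<bar>\<sigma>' (g \<circ> h) x - (\<sigma>' g (boundary_action h x) + \<sigma>' h x)\<bar> \<le> 3 * K"
    if g: "g \<in> \<Gamma>" and h: "h \<in> \<Gamma>" and x: "x \<in> M" for g h x
  proof -
    obtain R1 where R1: "\<And>p. near b R1 (Inr x) (Inl p) \<Longrightarrow> \<bar>potential p (cinv (g \<circ> h) b) - potential p b - \<sigma>' (g \<circ> h) x\<bar> \<le> K"
      using K[OF comp_in[OF g h] x] by blast
    obtain R2 where R2: "\<And>p. near b R2 (Inr x) (Inl p) \<Longrightarrow> \<bar>potential p (cinv h b) - potential p b - \<sigma>' h x\<bar> \<le> K"
      using K[OF h x] by blast
    obtain R3 where R3: "\<And>p. near b R3 (Inr (boundary_action h x)) (Inl p) \<Longrightarrow>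
        \<bar>potential p (cinv g b) - potential p b - \<sigma>' g (boundary_action h x)\<bar> \<le> K"
      using K[OF g action_in[OF h x]] by blast
    \<comment> \<open>All three estimates are evaluated at one \<open>p\<close>; the summand
      \<open>dist b (h b)\<close> ensures that \<open>h p\<close> is close enough to the image of
      \<open>x\<close>. Invariance then makes the potentials telescope.\<close>
    obtain p where p: "near b (Max {R1, R2, R3 + dist b (h b)}) (Inr x) (Inl p)" using near_exists[OF x] by blast
    have "\<bar>potential p (cinv (g \<circ> h) b) - potential p b - \<sigma>' (g \<circ> h) x\<bar> \<le> K" by (rule R1[OF near_mono[OF p]]) simp
    moreover have "\<bar>potential p (cinv h b) - potential p b - \<sigma>' h x\<bar> \<le> K" by (rule R2[OF near_mono[OF p]]) simp
    moreover have "\<bar>potential (h p) (cinv g b) - potential (h p) b - \<sigma>' g (boundary_action h x)\<bar> \<le> K"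
      by (rule R3[OF near_translate[OF h near_mono[OF p]]]) simp
    moreover have "potential p (cinv (g \<circ> h) b) = potential (h p) (cinv g b)" "potential (h p) b = potential p (cinv h b)"
      using g h eq(1)[OF h] by (simp_all add: cinv_mult)
    ultimately show ?thesis by linarith
  qed
  \<comment> \<open>Take \<open>p\<close> near \<open>x\<close> and \<open>q\<close> near
    \<open>y\<close>. By invariance, the differences defining the two cocycles sum to the value of
    \<open>potential p b + potential b q - potential p q\<close> at the translated pair minus its
    value at (p, q), the terms in \<open>potential p q\<close> cancelling. The error comes from one
    use of \<open>K\<close>, one of \<open>Ks\<close> and two of \<open>L\<close>.\<close>
  have gps: "\<bar>(\<sigma>' g x + \<sigma> g y) - (Gr (boundary_action g x) (boundary_action g y) - Gr x y)\<bar> \<le> K + Ks + 2 * L"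
    if g: "g \<in> \<Gamma>" and x: "x \<in> M" and y: "y \<in> M" and ne: "x \<noteq> y" for g x y
  proof -
    obtain R1 where R1: "\<And>p. near b R1 (Inr x) (Inl p) \<Longrightarrow> \<bar>potential p (cinv g b) - potential p b - \<sigma>' g x\<bar> \<le> K"
      using K[OF g x] by blast
    obtain R2 where R2: "\<And>p. near b R2 (Inr y) (Inl p) \<Longrightarrow> \<bar>potential (cinv g b) p - potential b p - \<sigma> g y\<bar> \<le> Ks"
      using Ks[OF g y] by blast
    obtain R3 where R3: "\<And>p q. near b R3 (Inr x) (Inl p) \<Longrightarrow> near b R3 (Inr y) (Inl q) \<Longrightarrow>
        \<bar>potential p b + potential b q - potential p q - Gr x y\<bar> \<le> L" using L[OF x y ne] by blast
    have "boundary_action g x \<noteq> boundary_action g y" using ne action_inj[OF g] by blast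
    from L[OF action_in[OF g x] action_in[OF g y] this] obtain R4 where
      R4: "\<And>p q. near b R4 (Inr (boundary_action g x)) (Inl p) \<Longrightarrow> near b R4 (Inr (boundary_action g y)) (Inl q) \<Longrightarrow>
        \<bar>potential p b + potential b q - potential p q - Gr (boundary_action g x) (boundary_action g y)\<bar> \<le> L" by blast
    define R where "R = Max {R1, R2, R3, R4 + dist b (g b)}"
    have R: "R1 \<le> R" "R2 \<le> R" "R3 \<le> R" "R4 + dist b (g b) \<le> R" by (simp_all add: R_def)
    obtain p q where pq: "near b R (Inr x) (Inl p)" "near b R (Inr y) (Inl q)" using near_exists x y by meson
    have "\<bar>potential p (cinv g b) - potential p b - \<sigma>' g x\<bar> \<le> K" by (rule R1[OF near_mono[OF pq(1) R(1)]])
    moreover have "\<bar>potential (cinv g b) q - potential b q - \<sigma> g y\<bar> \<le> Ks" by (rule R2[OF near_mono[OF pq(2) R(2)]])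
    moreover have "\<bar>potential p b + potential b q - potential p q - Gr x y\<bar> \<le> L"
      by (rule R3[OF near_mono[OF pq(1) R(3)] near_mono[OF pq(2) R(3)]])
    moreover have "\<bar>potential (g p) b + potential b (g q) - potential (g p) (g q) - Gr (boundary_action g x) (boundary_action g y)\<bar> \<le> L"
      by (rule R4[OF near_translate[OF g near_mono[OF pq(1) R(4)]] near_translate[OF g near_mono[OF pq(2) R(4)]]])
    ultimately show ?thesis unfolding eq[OF g] potential_invariant[OF g] by linarith
  qed
  have lb: "locally_bounded_on_pairs T Gr"
    unfolding locally_bounded_on_pairs_def
  proof
    fix z assume "z \<in> distinct_pairs T"
    then obtain x0 y0 where z: "z = (x0, y0)" and x0: "x0 \<in> M" and y0: "y0 \<in> M" and ne: "x0 \<noteq> y0"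
      by (auto simp: distinct_pairs_def)
    obtain R where R: "\<And>p q. near b R (Inr x0) (Inl p) \<Longrightarrow> near b R (Inr y0) (Inl q) \<Longrightarrow>
        \<bar>potential p b + potential b q - potential p q - Gr x0 y0\<bar> \<le> L" using L[OF x0 y0 ne] by blast
    obtain U where U: "openin T U" "x0 \<in> U" "\<And>x. x \<in> U \<Longrightarrow> near b (R + \<delta>) (Inr x0) (Inr x)"
      using boundary_nhd[OF x0, of "R + \<delta>"] by metis
    obtain V where V: "openin T V" "y0 \<in> V" "\<And>y. y \<in> V \<Longrightarrow> near b (R + \<delta>) (Inr y0) (Inr y)"
      using boundary_nhd[OF y0, of "R + \<delta>"] by metis
    have "openin (prod_topology T T) (U \<times> V)" using U V by (simp add: openin_prod_Times_iff)
    then have "openin (subtopology (prod_topology T T) (distinct_pairs T)) ((U \<times> V) \<inter> distinct_pairs T)"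
      unfolding openin_subtopology by blast
    moreover have "z \<in> (U \<times> V) \<inter> distinct_pairs T" using U V \<open>z \<in> distinct_pairs T\<close> z by simp
    moreover have "\<bar>Gr x y\<bar> \<le> \<bar>Gr x0 y0\<bar> + 2 * L" if xy: "(x, y) \<in> (U \<times> V) \<inter> distinct_pairs T" for x y
    proof -
      have x: "x \<in> M" "x \<in> U" and y: "y \<in> M" "y \<in> V" and ne: "x \<noteq> y" using xy by (auto simp: distinct_pairs_def)
      obtain R' where R': "\<And>p q. near b R' (Inr x) (Inl p) \<Longrightarrow> near b R' (Inr y) (Inl q) \<Longrightarrow>
        \<bar>potential p b + potential b q - potential p q - Gr x y\<bar> \<le> L" using L[OF x(1) y(1) ne] by blast
      obtain p q where p: "near b (max R' (R + \<delta>)) (Inr x) (Inl p)" and q: "near b (max R' (R + \<delta>)) (Inr y) (Inl q)"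
        using near_exists x y by meson
      have "near b R (Inr x0) (Inl p)" by (rule near_neighbour[OF x(1) U(3)[OF x(2)] near_mono[OF p]]) simp
      moreover have "near b R (Inr y0) (Inl q)" by (rule near_neighbour[OF y(1) V(3)[OF y(2)] near_mono[OF q]]) simp
      ultimately show ?thesis
        using R[of p q] R'[OF near_mono[OF p] near_mono[OF q]] by fastforce
    qed
    ultimately show "\<exists>U. openin (subtopology (prod_topology T T) (distinct_pairs T)) U \<and> z \<in> U \<and> (\<exists>B. \<forall>(x, y)\<in>U. \<bar>Gr x y\<bar> \<le> B)"
      by blast
  qed
  \<comment> \<open>At the fixed points of a loxodromic element the \<open>Gr\<close> terms cancel
    in \<open>gps\<close>. So \<sigma>' at the attracting point is minus \<sigma> at the repelling
    point up to a constant, that is, about \<sigma> of the inverse at its own attracting point, and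
    properness of \<sigma> applies.\<close>
  have proper': "proper_cocycle G T boundary_action d \<sigma>'"
    unfolding proper_cocycle_def
  proof (intro allI impI, elim conjE)
    fix \<gamma> :: "nat \<Rightarrow> 'a \<Rightarrow> 'a" and a r
    assume inj: "inj \<gamma>" and lox: "\<forall>n. loxodromic G T boundary_action (\<gamma> n) (a n) (r n)"
      and sep: "liminf (\<lambda>n. ereal (d (Inr (r n)) (Inr (a n)))) > 0"
    have \<gamma>: "\<gamma> n \<in> \<Gamma>" and ar: "a n \<in> M" "r n \<in> M" "a n \<noteq> r n"
      and fixed: "boundary_action (\<gamma> n) (a n) = a n" "boundary_action (\<gamma> n) (r n) = r n" for n
      using lox by (auto simp: loxodromic_def limit_set_def)
    have fixed': "boundary_action (cinv (\<gamma> n)) (a n) = a n" "boundary_action (cinv (\<gamma> n)) (r n) = r n" for n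
      using action_cancel(2)[OF \<gamma>, of n] fixed by metis+
    have "loxodromic G T boundary_action (cinv (\<gamma> n)) (r n) (a n)" for n
      using lox[rule_format, of n] fixed'[of n] \<gamma>[of n] cinv_in[OF \<gamma>[of n]] inv_G[OF \<gamma>[of n]]
        inv_G[OF cinv_in[OF \<gamma>[of n]]]
      unfolding loxodromic_def by (simp add: ar(3)[of n] ar(3)[of n, symmetric])
    moreover have "inj (\<lambda>n. cinv (\<gamma> n))"
    proof (rule injI)
      fix m n assume "cinv (\<gamma> m) = cinv (\<gamma> n)"
      then have "cinv (cinv (\<gamma> m)) = cinv (cinv (\<gamma> n))" by simp
      then show "m = n" using injD[OF inj] \<gamma> by simp
    qed
    moreover have "liminf (\<lambda>n. ereal (d (Inr (a n)) (Inr (r n)))) > 0" using sep by (simp add: MS.commute)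
    ultimately have lim: "filterlim (\<lambda>n. \<sigma> (cinv (\<gamma> n)) (r n)) at_top sequentially"
      using sigma_proper[unfolded proper_cocycle_def, rule_format, of "\<lambda>n. cinv (\<gamma> n)" r a] by blast
    have bound: "\<sigma> (cinv (\<gamma> n)) (r n) - (K + Ks + 2 * L + 2 * \<kappa>) \<le> \<sigma>' (\<gamma> n) (a n)" for n
      using gps[OF \<gamma>[of n] ar[of n]] cocycle[OF cinv_in[OF \<gamma>[of n]] \<gamma>[of n] ar(2)[of n]]
        sigma_id[OF ar(2)[of n]] fixed[of n] \<gamma>[of n]
      by simp
    show "filterlim (\<lambda>n. \<sigma>' (\<gamma> n) (a n)) at_top sequentially"
      unfolding filterlim_at_top
    proof
      fix Z
      have "\<forall>\<^sub>F n in sequentially. Z + (K + Ks + 2 * L + 2 * \<kappa>) \<le> \<sigma> (cinv (\<gamma> n)) (r n)"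
        using lim unfolding filterlim_at_top by blast
      then show "\<forall>\<^sub>F n in sequentially. Z \<le> \<sigma>' (\<gamma> n) (a n)"
        by (rule eventually_mono) (use bound in \<open>smt (verit)\<close>)
    qed
  qed
  \<comment> \<open>The entries bound the errors of \<sigma>, of the dual cocycle relation and of
    \<open>gps\<close>; with \<open>K0\<close> the second also covers the continuity error
    2K.\<close>
  define \<kappa>' where "\<kappa>' = Max {\<kappa>, 3 * K, K + Ks + 2 * L}"
  have \<kappa>': "\<kappa> \<le> \<kappa>'" "3 * K \<le> \<kappa>'" "2 * K \<le> \<kappa>'" "K + Ks + 2 * L \<le> \<kappa>'" using K0 by (auto simp: \<kappa>'_def)
  have "coarse_cocycle_with \<kappa>' G T boundary_action \<sigma>"
    using sigma_cocycle \<kappa>'(1) unfolding coarse_cocycle_with_def by (meson ereal_less_eq(3) order_trans)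
  moreover have "coarse_cocycle_with \<kappa>' G T boundary_action \<sigma>'"
    unfolding coarse_cocycle_with_def
  proof (intro conjI ballI)
    fix g x0 assume g: "g \<in> carrier G" and x0: "x0 \<in> topspace T"
    then obtain U where U: "openin T U" "x0 \<in> U" "\<And>x. x \<in> U \<Longrightarrow> \<bar>\<sigma>' g x0 - \<sigma>' g x\<bar> \<le> 2 * K"
      using cont[of g x0] by auto
    have "\<forall>\<^sub>F x in nhdsin T x0. ereal \<bar>\<sigma>' g x0 - \<sigma>' g x\<bar> \<le> ereal \<kappa>'"
      unfolding eventually_nhdsin using U \<kappa>'(3) by (metis ereal_less_eq(3) order_trans)
    then show "Limsup (nhdsin T x0) (\<lambda>x. ereal \<bar>\<sigma>' g x0 - \<sigma>' g x\<bar>) \<le> ereal \<kappa>'" by (rule Limsup_bounded)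
  next
    fix g h x assume "g \<in> carrier G" "h \<in> carrier G" "x \<in> topspace T"
    then show "\<bar>\<sigma>' (g \<otimes>\<^bsub>G\<^esub> h) x - (\<sigma>' g (boundary_action h x) + \<sigma>' h x)\<bar> \<le> \<kappa>'"
      using mult[of g h x] \<kappa>'(2) by (simp add: mult_isometry_group)
  qed
  moreover have "\<forall>g\<in>carrier G. \<forall>x\<in>topspace T. \<forall>y\<in>topspace T. x \<noteq> y \<longrightarrow>
     \<bar>(\<sigma>' g x + \<sigma> g y) - (Gr (boundary_action g x) (boundary_action g y) - Gr x y)\<bar> \<le> \<kappa>'"
    using gps \<kappa>'(4) by (fastforce simp del: topspace_boundary simp: topspace_boundary[symmetric])
  ultimately have "coarse_GPS G T boundary_action d \<sigma> \<sigma>' Gr"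
    unfolding coarse_GPS_def using sigma_proper proper' lb kappa_nonneg \<kappa>'(1)
    by (intro exI[of _ \<kappa>']) (simp del: G_simps topspace_boundary)
  then show ?thesis by blast
qed

end

theorem theorem1p13:
  fixes b :: "'a::metric_space"
    and \<Gamma> :: "('a \<Rightarrow> 'a) set"
    and d :: "('a \<Rightarrow> 'a) + 'a bdry_point \<Rightarrow> ('a \<Rightarrow> 'a) + 'a bdry_point \<Rightarrow> real"
    and \<sigma> :: "('a \<Rightarrow> 'a) \<Rightarrow> 'a bdry_point \<Rightarrow> real"
  assumes "proper_metric_space TYPE('a)"
    and "geodesic_metric_space TYPE('a)"
    and "gromov_hyperbolic TYPE('a)"
    and "discrete_isometry_group \<Gamma>"
    and "cocompact \<Gamma>"
    and "non_elementary (isometry_subgroup \<Gamma>) (gromov_boundary_topology b) boundary_action"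
    and "compatible_metric (isometry_subgroup \<Gamma>) (gromov_boundary_topology b) boundary_action d"
    and "expanding_cocycle (isometry_subgroup \<Gamma>) (gromov_boundary_topology b) boundary_action d \<sigma>"
  shows "(\<exists>\<psi>. invariant_potential \<Gamma> \<psi> \<and> coarsely_additive_potential \<psi> \<and>
            (SUP (\<gamma>, x)\<in>\<Gamma> \<times> gromov_boundary b.
               \<bar>potential_cocycle b \<psi> \<gamma> x - ereal (\<sigma> \<gamma> x)\<bar>) < \<infinity>) \<and>
         (\<exists>\<sigma>' Gr. coarse_GPS (isometry_subgroup \<Gamma>) (gromov_boundary_topology b)
                    boundary_action d \<sigma> \<sigma>' Gr)"
proof -
  obtain \<delta> where "0 \<le> \<delta>" and hyp: "\<And>c x y z::'a. min (gromov_product c x y) (gromov_product c y z) - \<delta> \<le> gromov_product c x z"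
    using assms(3) unfolding gromov_hyperbolic_def by blast
  obtain K where K: "compact K" "(\<Union>\<gamma>\<in>\<Gamma>. \<gamma> ` K) = UNIV" using assms(5) by (auto simp: cocompact_def)
  \<comment> \<open>The translates of \<open>K\<close> cover X, so the largest distance from
    \<open>b\<close> to \<open>K\<close> bounds the distance from any point to the orbit of
    \<open>b\<close>.\<close>
  obtain D where D: "\<And>k. k \<in> K \<Longrightarrow> dist b k \<le> D"
    using compact_imp_bounded[OF K(1)] unfolding bounded_any_center[of K b] by blast
  have dense: "\<exists>g\<in>\<Gamma>. dist p (g b) \<le> D" for p
  proof -
    obtain \<gamma> k where k: "\<gamma> \<in> \<Gamma>" "k \<in> K" "p = \<gamma> k" using K(2) by blast
    have "\<gamma> \<in> carrier isometry_group"
      using assms(4) k(1) subgroup.subset unfolding discrete_isometry_group_def by blast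
    then have "dist p (\<gamma> b) = dist k b" using k(3) by (simp add: isometry_group_def)
    then have "dist p (\<gamma> b) \<le> D" using D[OF k(2)] by (simp add: dist_commute)
    then show ?thesis using k(1) by blast
  qed
  interpret hyperbolic_group_action b \<delta> \<Gamma> d D
    by unfold_locales (use assms \<open>0 \<le> \<delta>\<close> hyp dense in blast)+
  have cc: "coarse_cocycle G T boundary_action \<sigma>" and pc: "proper_cocycle G T boundary_action d \<sigma>"
    using assms(8) by (simp_all add: expanding_cocycle_def)
  obtain N where N: "\<And>\<epsilon>. \<epsilon> > 0 \<Longrightarrow> \<exists>C>0. \<forall>x\<in>M. \<forall>g\<in>\<Gamma>. d (Inr x) (Inl (inv\<^bsub>G\<^esub> g)) > \<epsilon> \<longrightarrow> N g - C \<le> \<sigma> g x \<and> \<sigma> g x \<le> N g + C"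
    using assms(8) unfolding expanding_cocycle_def topspace_boundary G_simps by blast
  obtain \<kappa> where \<kappa>: "\<kappa> \<ge> 0" "coarse_cocycle_with \<kappa> G T boundary_action \<sigma>"
    using cc by (auto simp: coarse_cocycle_def)
  interpret expanding_action b \<delta> \<Gamma> d D \<sigma> N \<kappa>
  proof unfold_locales
    fix \<epsilon> :: real assume "\<epsilon> > 0"
    then obtain C where C: "\<And>x g. x \<in> M \<Longrightarrow> g \<in> \<Gamma> \<Longrightarrow> d (Inr x) (Inl (inv\<^bsub>G\<^esub> g)) > \<epsilon> \<Longrightarrow> N g - C \<le> \<sigma> g x \<and> \<sigma> g x \<le> N g + C"
      using N by blast
    have "\<bar>\<sigma> g x - N g\<bar> \<le> C" if "x \<in> M" "g \<in> \<Gamma>" "\<epsilon> < d (Inr x) (Inl (cinv g))" for x g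
      using C[OF that(1,2)] that by (simp add: inv_G abs_le_iff)
    then show "\<exists>C. \<forall>x\<in>M. \<forall>g\<in>\<Gamma>. \<epsilon> < d (Inr x) (Inl (cinv g)) \<longrightarrow> \<bar>\<sigma> g x - N g\<bar> \<le> C" by blast
  qed (use \<kappa> pc in simp_all)
  obtain K' where K': "\<And>\<gamma> x. \<gamma> \<in> \<Gamma> \<Longrightarrow> x \<in> M \<Longrightarrow> \<bar>potential_cocycle b potential \<gamma> x - ereal (\<sigma> \<gamma> x)\<bar> \<le> ereal K'"
    using potential_cocycle_close by blast
  have "(SUP (\<gamma>, x)\<in>\<Gamma> \<times> M. \<bar>potential_cocycle b potential \<gamma> x - ereal (\<sigma> \<gamma> x)\<bar>) \<le> ereal K'"
    by (rule SUP_least) (use K' in auto)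
  then have "(SUP (\<gamma>, x)\<in>\<Gamma> \<times> M. \<bar>potential_cocycle b potential \<gamma> x - ereal (\<sigma> \<gamma> x)\<bar>) < \<infinity>"
    by (rule le_less_trans) simp
  moreover have "invariant_potential \<Gamma> potential"
    using potential_invariant by (simp add: invariant_potential_def)
  ultimately show ?thesis
    using coarsely_additive_potential GPS_exists by blast
qed

end
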